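(* There exists a constant $C_1>0$ such that for all $\mathcal{T}\in\mathbb{T}(\mathcal{T}_0)$, all $\hat{\mathcal{T}}\in\mathbb{T}(\mathcal{T})$, all $\mathcal{S}\subseteq\mathcal{T}\cap\hat{\mathcal{T}}$, all $z\in X(\mathcal{T})$ and all $\hat z\in X(\hat{\mathcal{T}})$, $$\bigg|\bigg(\sum_{T\in\mathcal{S}}\eta_T(\hat{\mathcal{T}};\hat z)^2\bigg)^{1/2}-\bigg(\sum_{T\in\mathcal{S}}\eta_T(\mathcal{T};z)^2\bigg)^{1/2}\bigg|\le C_1\,\mathrm{d}[\hat z,z].$$
   Context: For an element $T$, $|T|$ is its measure; for a matrix $\tau$, $|\tau|$ is the Frobenius norm and $\tau:\mu$ the Frobenius inner product. **Setting.** Let $d\in\{2,3\}$ and let $\Omega\subset\mathbb{R}^d$ be a domain with Lipschitz boundary $\partial\Omega$, which is split into a closed non-empty part $\Gamma_D\subset\partial\Omega$ of positive surface measure and an open part $\Gamma_N:=\partial\Omega\setminus\Gamma_D$ (possibly empty). Let $f\in L^2(\Omega;\mathbb{R}^d)$, $g\in L^2(\Gamma_N;\mathbb{R}^d)$. Put $\mathbb{S}_d:=\{q\in\mathbb{R}^{d\times d}\mid q_{ji}=q_{ij}\}$, $\mathbb{S}_{d,0}:=\{q\in\mathbb{S}_d\mid \sum_{j=1}^d q_{jj}=0\}$, $V:=\{v\in H^1(\Omega;\mathbb{R}^d)\mid v=0\text{ on }\Gamma_D\}$, $Q:=L^2(\Omega;\mathbb{S}_{d,0})$, $M:=L^2(\Omega)$,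 $X:=V\times Q\times M$. For $w\in V$, $\varepsilon(w):=\frac12(\nabla w+(\nabla w)^T)$. Let $\mathbb{C}$ be the isotropic elasticity tensor, symmetric and constant, with $\kappa_{\mathbb{C}}|\tau|^2\le\mathbb{C}\tau:\tau$ for all $\tau\in L^2(\Omega;\mathbb{S}_d)$ and a constant $\kappa_{\mathbb{C}}>0$. The stress is $\sigma(w,p):=\mathbb{C}(\varepsilon(w)-p)$. **Meshes and refinement.** A mesh $\mathcal{T}$ is a finite decomposition of $\Omega$, $\overline\Omega=\bigcup_{T\in\mathcal{T}}T$, into closed triangles ($d=2$) or tetrahedra ($d=3$), which is conforming, i.e. the intersection of two elements is either empty or a common face, edge or vertex. Each $T\in\mathcal{T}$ has a fixed edge $E_T$ (the reference edge). For a set $\mathcal{M}\subset\mathcal{T}$ of elements to be refined, newest vertex bisection (for dimension $d\ge2$ in the generalization of Maubach, Traxler and Stevenson) generates the new mesh $\operatorname{NVB}(\mathcal{T},\mathcal{M})$ as follows. First, each $T\in\mathcal{M}$ is bisected into two triangles or tetrahedra, where the midpoint of $E_T$ (the newest vertex) is connected to the vertex opposite to $E_T$; the edges opposite to the newest vertex are the reference edges of the new triangles or tetrahedra. Second, in the same way all elements of the resulting mesh which have a hanging node (a vertex of the mesh in the interior of an edge of the element) are bisected, until there are no hanging nodes. $\mathbb{T}(\mathcal{T})$ is the set of all meshes created from $\mathcal{T}$ by finitely many successive applications of newest vertex bisection. $\mathcal{T}_0$ is a fixed initial mesh. The meshes in $\mathbb{T}(\mathcal{T}_0)$ are uniformly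 shape regular: there is $c>0$ with $h_T\le c\,\rho_T$ for all elements $T$ of all these meshes, where $h_T$ is the diameter and $\rho_T$ the inradius of $T$. **Discrete spaces.** $X(\mathcal{T}):=V(\mathcal{T})\times Q(\mathcal{T})\times M(\mathcal{T})$, where $V(\mathcal{T})$ consists of the functions in $V$ that are affine on every element, and $Q(\mathcal{T})$, $M(\mathcal{T})$ consist of the functions with values in $\mathbb{S}_{d,0}$, resp. $\mathbb{R}$, that are constant on every element. **Error measure and indicators.** For $z=(v,q,\beta)$, $\hat z=(\hat v,\hat q,\hat\beta)\in X$: $\mathrm{d}[z,\hat z]:=\|\sigma(v,q)-\sigma(\hat v,\hat q)\|_{L^2(\Omega;\mathbb{R}^{d\times d})}$. For $T\in\mathcal{T}$ and $z=(v,q,\beta)\in X(\mathcal{T})$ (for both $d=2$ and $d=3$), $$\eta_T(\mathcal{T};z)^2:=|T|\,\|f\|_{L^2(T;\mathbb{R}^d)}^2+|T|^{1/2}\sum_{E\in\mathcal{E}(T)}R_E(z)^2,$$ where $\mathcal{E}(T)$ is the set of edges ($d=2$) or faces ($d=3$) of $T$, and, with $\nu_E$ the fixed unit normal corresponding to $E$, $R_E(z):=\|[\sigma(v,q)]\nu_E\|_{L^2(E;\mathbb{R}^d)}$ for interior $E$ ($[\cdot]$ the jump along $E$), $R_E(z):=\|g-\sigma(v,q)\nu_E\|_{L^2(E;\mathbb{R}^d)}$ for $E$ on $\Gamma_N$, $R_E(z):=0$ for $E$ on $\Gamma_D$. *)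

theory Defs
  imports "HOL-Analysis.Analysis"
begin

section \<open>Surface measure\<close>

text \<open>
  The surface measure is the \<open>(d - 1)\<close>-dimensional Hausdorff measure, normalised such that it
  agrees with Lebesgue measure on flat pieces: a piece \<open>U\<close> of a cover contributes the volume
  of a \<open>k\<close>-dimensional ball of the same diameter.
  Only \<open>k > 0\<close> is meant; then empty pieces contribute nothing.
\<close>

definition hausdorff_pre :: "nat \<Rightarrow> real \<Rightarrow> 'a::metric_space set \<Rightarrow> ennreal" where
  "hausdorff_pre k \<delta> A =
     (INF U \<in> {U :: nat \<Rightarrow> 'a set. A \<subseteq> (\<Union>i. U i) \<and> (\<forall>i. bounded (U i) \<and> diameter (U i) \<le> \<delta>)}.
        (\<Sum>i. ennreal (unit_ball_vol k * (diameter (U i) / 2) ^ k)))"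

definition hausdorff_outer :: "nat \<Rightarrow> 'a::metric_space set \<Rightarrow> ennreal" where
  "hausdorff_outer k A = (SUP \<delta> \<in> {0<..}. hausdorff_pre k \<delta> A)"

definition hausdorff_measure :: "nat \<Rightarrow> 'a::metric_space measure" where
  "hausdorff_measure k = measure_of UNIV (sets borel) (hausdorff_outer k)"

text \<open>
  The outer measure is additive on separated sets. Hence Borel sets are measurable and
  \<^const>\<open>hausdorff_measure\<close> agrees with \<^const>\<open>hausdorff_outer\<close> on them.
\<close>

lemma hausdorff_pre_mono: "A \<subseteq> B \<Longrightarrow> hausdorff_pre k \<delta> A \<le> hausdorff_pre k \<delta> B"
  unfolding hausdorff_pre_def by (rule INF_superset_mono) auto

lemma hausdorff_pre_antimono: "\<delta> \<le> \<delta>' \<Longrightarrow> hausdorff_pre k \<delta>' A \<le> hausdorff_pre k \<delta> A"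
  unfolding hausdorff_pre_def by (rule INF_superset_mono) (auto intro: order_trans)

lemma hausdorff_pre_le_outer: "\<delta> > 0 \<Longrightarrow> hausdorff_pre k \<delta> A \<le> hausdorff_outer k A"
  unfolding hausdorff_outer_def by (rule SUP_upper) auto

lemma hausdorff_outer_mono: "A \<subseteq> B \<Longrightarrow> hausdorff_outer k A \<le> hausdorff_outer k B"
  unfolding hausdorff_outer_def by (rule SUP_mono) (auto intro: hausdorff_pre_mono)

lemma hausdorff_outer_empty: "k > 0 \<Longrightarrow> hausdorff_outer k {} = 0"
proof -
  assume k: "k > 0"
  have "hausdorff_pre k \<delta> ({} :: 'a set) = 0" if "\<delta> > 0" for \<delta>
  proof -
    have "hausdorff_pre k \<delta> ({} :: 'a set)
        \<le> (\<Sum>i::nat. ennreal (unit_ball_vol k * (diameter ({} :: 'a set) / 2) ^ k))"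
      unfolding hausdorff_pre_def by (rule INF_lower2[where i = "\<lambda>_. {}"]) (use that in auto)
    also have "\<dots> = 0"
      using k by (simp add: zero_power)
    finally show ?thesis by simp
  qed
  then show ?thesis
    unfolding hausdorff_outer_def by (simp cong: SUP_cong_simp)
qed

lemma hausdorff_pre_UN_le:
  fixes A :: "nat \<Rightarrow> 'a::metric_space set"
  shows "hausdorff_pre k \<delta> (\<Union>n. A n) \<le> (\<Sum>n. hausdorff_pre k \<delta> (A n))"
proof (rule ennreal_le_epsilon)
  fix e :: real
  assume e: "0 < e" and fin: "(\<Sum>n. hausdorff_pre k \<delta> (A n)) < top"
  define c where "c U = ennreal (unit_ball_vol k * (diameter U / 2) ^ k)" for U :: "'a set"
  have "\<exists>U. A n \<subseteq> (\<Union>i. U i) \<and> (\<forall>i. bounded (U i) \<and> diameter (U i) \<le> \<delta>) \<and>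
      (\<Sum>i. c (U i)) \<le> hausdorff_pre k \<delta> (A n) + e * (1/2) ^ Suc n" for n
  proof -
    have "hausdorff_pre k \<delta> (A n) < top"
      using fin by (auto simp: less_top dest!: ennreal_suminf_lessD)
    then have "hausdorff_pre k \<delta> (A n) < hausdorff_pre k \<delta> (A n) + e * (1/2) ^ Suc n"
      using e by (auto simp: less_top)
    then show ?thesis
      unfolding hausdorff_pre_def[of k \<delta> "A n"] INF_less_iff c_def
      by (auto intro: less_imp_le)
  qed
  then obtain U where U: "\<And>n. A n \<subseteq> (\<Union>i. U n i)"
      "\<And>n i. bounded (U n i) \<and> diameter (U n i) \<le> \<delta>"
      "\<And>n. (\<Sum>i. c (U n i)) \<le> hausdorff_pre k \<delta> (A n) + e * (1/2) ^ Suc n"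
    by metis
  define W where "W = case_prod U \<circ> prod_decode"
  have "(\<Union>n. A n) \<subseteq> (\<Union>m. W m)"
    using U(1) by (auto simp: W_def subset_eq) (metis prod.case prod_encode_inverse)
  then have "hausdorff_pre k \<delta> (\<Union>n. A n) \<le> (\<Sum>m. c (W m))"
    unfolding hausdorff_pre_def c_def using U(2)
    by (intro INF_lower) (auto simp: W_def split: prod.split)
  also have "\<dots> = (\<Sum>m. (\<lambda>p. c (case_prod U p)) (prod_decode m))"
    by (simp add: W_def)
  also have "\<dots> = (\<Sum>n. \<Sum>i. c (U n i))"
    by (rule suminf_ennreal_2dimen) simp
  also have "\<dots> \<le> (\<Sum>n. hausdorff_pre k \<delta> (A n) + e * (1/2) ^ Suc n)"
    by (intro suminf_le U(3)) auto
  also have "\<dots> = (\<Sum>n. hausdorff_pre k \<delta> (A n)) + (\<Sum>n. ennreal e * ennreal ((1/2) ^ Suc n))"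
    using e by (subst suminf_add[symmetric])
      (auto simp del: ennreal_suminf_cmult simp add: ennreal_mult[symmetric])
  also have "\<dots> = (\<Sum>n. hausdorff_pre k \<delta> (A n)) + e"
    unfolding ennreal_suminf_cmult
    by (subst suminf_ennreal_eq[OF zero_le_power power_half_series]) auto
  finally show "hausdorff_pre k \<delta> (\<Union>n. A n) \<le> (\<Sum>n. hausdorff_pre k \<delta> (A n)) + e" .
qed

lemma hausdorff_outer_UN_le:
  "hausdorff_outer k (\<Union>n. A n) \<le> (\<Sum>n. hausdorff_outer k (A n))" for A :: "nat \<Rightarrow> _"
  unfolding hausdorff_outer_def[of k "\<Union>n. A n"]
proof (rule SUP_least)
  fix \<delta> :: real
  assume "\<delta> \<in> {0<..}"
  have "hausdorff_pre k \<delta> (\<Union>n. A n) \<le> (\<Sum>n. hausdorff_pre k \<delta> (A n))"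
    by (rule hausdorff_pre_UN_le)
  also have "\<dots> \<le> (\<Sum>n. hausdorff_outer k (A n))"
    using \<open>\<delta> \<in> _\<close> by (intro suminf_le hausdorff_pre_le_outer) auto
  finally show "hausdorff_pre k \<delta> (\<Union>n. A n) \<le> (\<Sum>n. hausdorff_outer k (A n))" .
qed

lemma hausdorff_outer_space:
  "k > 0 \<Longrightarrow> outer_measure_space (Pow UNIV) (hausdorff_outer k :: 'a::metric_space set \<Rightarrow> _)"
  unfolding outer_measure_space_def positive_def increasing_def countably_subadditive_def
  by (auto simp: hausdorff_outer_empty hausdorff_outer_UN_le intro: hausdorff_outer_mono)

lemma hausdorff_outer_Un_le:
  assumes "k > 0"
  shows "hausdorff_outer k (A \<union> B) \<le> hausdorff_outer k A + hausdorff_outer k B"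
proof -
  have "hausdorff_outer k (A \<union> B) = hausdorff_outer k (\<Union>n. binaryset A B n)"
    by (simp add: UN_binaryset_eq)
  also have "\<dots> \<le> (\<Sum>n. hausdorff_outer k (binaryset A B n))"
    by (rule hausdorff_outer_UN_le)
  also have "\<dots> = hausdorff_outer k A + hausdorff_outer k B"
    by (rule suminf_binaryset_eq) (simp add: hausdorff_outer_empty assms)
  finally show ?thesis .
qed

lemma hausdorff_pre_separated:
  assumes sep: "\<And>a b. a \<in> A \<Longrightarrow> b \<in> B \<Longrightarrow> e \<le> dist a b" and \<delta>: "0 < \<delta>" "\<delta> < e" and k: "k > 0"
  shows "hausdorff_pre k \<delta> A + hausdorff_pre k \<delta> B \<le> hausdorff_pre k \<delta> (A \<union> B)"
  unfolding hausdorff_pre_def[of k \<delta> "A \<union> B"]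
proof (rule INF_greatest)
  fix U :: "nat \<Rightarrow> 'a set"
  assume "U \<in> {U. A \<union> B \<subseteq> (\<Union>i. U i) \<and> (\<forall>i. bounded (U i) \<and> diameter (U i) \<le> \<delta>)}"
  then have U: "A \<union> B \<subseteq> (\<Union>i. U i)" "\<And>i. bounded (U i)" "\<And>i. diameter (U i) \<le> \<delta>"
    by auto
  define c where "c W = ennreal (unit_ball_vol k * (diameter W / 2) ^ k)" for W :: "'a set"
  define UA where "UA i = (if U i \<inter> A = {} then {} else U i)" for i
  define UB where "UB i = (if U i \<inter> B = {} then {} else U i)" for i
  have "hausdorff_pre k \<delta> A \<le> (\<Sum>i. c (UA i))"
    unfolding hausdorff_pre_def c_def using U \<delta>
    by (intro INF_lower) (auto simp: UA_def split: if_splits, blast)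
  moreover have "hausdorff_pre k \<delta> B \<le> (\<Sum>i. c (UB i))"
    unfolding hausdorff_pre_def c_def using U \<delta>
    by (intro INF_lower) (auto simp: UB_def split: if_splits, blast)
  ultimately have "hausdorff_pre k \<delta> A + hausdorff_pre k \<delta> B \<le> (\<Sum>i. c (UA i)) + (\<Sum>i. c (UB i))"
    by (rule add_mono)
  also have "\<dots> = (\<Sum>i. c (UA i) + c (UB i))"
    by (simp add: suminf_add)
  also have "\<dots> \<le> (\<Sum>i. c (U i))"
  proof (intro suminf_le)
    fix i
    have "U i \<inter> A = {} \<or> U i \<inter> B = {}"
    proof (rule ccontr)
      assume "\<not> ?thesis"
      then obtain a b where ab: "a \<in> U i" "a \<in> A" "b \<in> U i" "b \<in> B"
        by auto
      then have "dist a b \<le> \<delta>"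
        using diameter_bounded_bound[OF U(2)] U(3) order_trans by blast
      with sep[of a b] ab \<delta> show False by auto
    qed
    moreover have "c {} = 0"
      using k by (simp add: c_def)
    ultimately show "c (UA i) + c (UB i) \<le> c (U i)"
      by (auto simp: UA_def UB_def)
  qed auto
  finally show "hausdorff_pre k \<delta> A + hausdorff_pre k \<delta> B
      \<le> (\<Sum>i. ennreal (unit_ball_vol k * (diameter (U i) / 2) ^ k))"
    by (simp add: c_def)
qed

lemma hausdorff_outer_separated:
  assumes sep: "\<And>a b. a \<in> A \<Longrightarrow> b \<in> B \<Longrightarrow> e \<le> dist a b" and e: "0 < e" and k: "k > 0"
  shows "hausdorff_outer k A + hausdorff_outer k B \<le> hausdorff_outer k (A \<union> B)"
proof -
  have *: "hausdorff_pre k \<delta> A + hausdorff_pre k \<delta>' B \<le> hausdorff_outer k (A \<union> B)"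
    if "\<delta> > 0" "\<delta>' > 0" for \<delta> \<delta>'
  proof -
    define m where "m = min (min \<delta> \<delta>') (e / 2)"
    have m: "0 < m" "m < e" "m \<le> \<delta>" "m \<le> \<delta>'"
      using that e by (auto simp: m_def)
    have "hausdorff_pre k \<delta> A + hausdorff_pre k \<delta>' B \<le> hausdorff_pre k m A + hausdorff_pre k m B"
      using m by (intro add_mono hausdorff_pre_antimono) auto
    also have "\<dots> \<le> hausdorff_pre k m (A \<union> B)"
      using sep m k by (intro hausdorff_pre_separated[where e = e]) auto
    also have "\<dots> \<le> hausdorff_outer k (A \<union> B)"
      using m by (intro hausdorff_pre_le_outer)
    finally show ?thesis .
  qed
  have ne: "{0::real<..} \<noteq> {}"
    by auto
  have "hausdorff_outer k A + hausdorff_outer k B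
      = (SUP \<delta>'\<in>{0<..}. SUP \<delta>\<in>{0<..}. hausdorff_pre k \<delta> A + hausdorff_pre k \<delta>' B)"
    unfolding hausdorff_outer_def[of k A] hausdorff_outer_def[of k B]
    by (simp only: ennreal_SUP_add_left[OF ne, symmetric] ennreal_SUP_add_right[OF ne])
  also have "\<dots> \<le> hausdorff_outer k (A \<union> B)"
    using * by (intro SUP_least) auto
  finally show ?thesis .
qed

lemma hausdorff_outer_separated_sum:
  fixes R :: "nat \<Rightarrow> 'a::metric_space set"
  assumes sep: "\<And>i. \<exists>e>0. \<forall>j<i. \<forall>a \<in> R j. \<forall>b \<in> R i. e \<le> dist a b" and k: "k > 0"
  shows "(\<Sum>j<m. hausdorff_outer k (R j)) \<le> hausdorff_outer k (\<Union>j<m. R j)"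
proof (induction m)
  case (Suc m)
  obtain e where e: "e > 0" "\<And>j a b. j < m \<Longrightarrow> a \<in> R j \<Longrightarrow> b \<in> R m \<Longrightarrow> e \<le> dist a b"
    using sep[of m] by blast
  have "(\<Sum>j<Suc m. hausdorff_outer k (R j))
      \<le> hausdorff_outer k (\<Union>j<m. R j) + hausdorff_outer k (R m)"
    using Suc by (simp add: add_right_mono)
  also have "\<dots> \<le> hausdorff_outer k ((\<Union>j<m. R j) \<union> R m)"
    using e k by (intro hausdorff_outer_separated[where e = e]) auto
  also have "(\<Union>j<m. R j) \<union> R m = (\<Union>j<Suc m. R j)"
    by (auto simp: less_Suc_eq)
  finally show ?case .
qed simp

lemma hausdorff_outer_closed:
  fixes C :: "'a::metric_space set"
  assumes C: "closed C" and k: "k > 0"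
  shows "C \<in> lambda_system UNIV (Pow UNIV) (hausdorff_outer k)"
proof -
  have main: "hausdorff_outer k (X \<inter> C) + hausdorff_outer k (X - C) \<le> hausdorff_outer k X" for X
  proof (cases "C = {} \<or> hausdorff_outer k X = top")
    case True
    then show ?thesis
      using k by (auto simp: hausdorff_outer_empty top_greatest)
  next
    case False
    then have ne: "C \<noteq> {}" and fin: "hausdorff_outer k X < top"
      by (auto simp: less_top)
    define a where "a n = 1 / real (Suc n)" for n
    have a: "a n > 0" "a (Suc n) < a n" for n
      by (auto simp: a_def field_simps)
    have a_mono: "a n \<le> a m" if "m \<le> n" for m n
      using that by (auto simp: a_def field_simps)
    define A where "A n = {x \<in> X. a n \<le> infdist x C}" for n
    define R where "R n = {x \<in> X. a (Suc n) \<le> infdist x C \<and> infdist x C < a n}" for n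
    have R_sep: "a (Suc j) - a (Suc (Suc j)) \<le> dist x y"
      if "x \<in> R j" "y \<in> R l" "Suc (Suc j) \<le> l" for j l x y
    proof -
      have "a (Suc j) \<le> infdist x C" "infdist y C < a l"
        using that by (auto simp: R_def)
      moreover have "a l \<le> a (Suc (Suc j))"
        using that a_mono by auto
      moreover have "infdist x C \<le> infdist y C + dist x y"
        by (rule infdist_triangle)
      ultimately show ?thesis by linarith
    qed
    have sum_le: "(\<Sum>j<m. hausdorff_outer k (R (2 * j + p))) \<le> hausdorff_outer k X" for m p
    proof -
      have "(\<Sum>j<m. hausdorff_outer k (R (2 * j + p))) \<le> hausdorff_outer k (\<Union>j<m. R (2 * j + p))"
      proof (rule hausdorff_outer_separated_sum[OF _ k])
        fix i
        define e where "e = Min (insert 1 ((\<lambda>j. a (Suc (2*j+p)) - a (Suc (Suc (2*j+p)))) ` {..<i}))"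
        have "e > 0"
          using a by (auto simp: e_def)
        moreover have "e \<le> dist x y" if "j < i" "x \<in> R (2*j+p)" "y \<in> R (2*i+p)" for j x y
        proof -
          have "e \<le> a (Suc (2*j+p)) - a (Suc (Suc (2*j+p)))"
            using that by (auto simp: e_def intro!: Min_le)
          also have "\<dots> \<le> dist x y"
            using that by (intro R_sep) auto
          finally show ?thesis .
        qed
        ultimately show "\<exists>e>0. \<forall>j<i. \<forall>a \<in> R (2*j+p). \<forall>b \<in> R (2*i+p). e \<le> dist a b"
          by blast
      qed
      also have "\<dots> \<le> hausdorff_outer k X"
        by (rule hausdorff_outer_mono) (auto simp: R_def)
      finally show ?thesis .
    qed
    have even_odd: "(\<Sum>j<2*m. h j) = (\<Sum>j<m. h (2*j+0)) + (\<Sum>j<m. h (2*j+1))"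
      for h :: "nat \<Rightarrow> ennreal" and m
      by (induction m) (auto simp: algebra_simps)
    have part: "(\<Sum>j<m. hausdorff_outer k (R j)) \<le> 2 * hausdorff_outer k X" for m
    proof -
      have "(\<Sum>j<m. hausdorff_outer k (R j)) \<le> (\<Sum>j<2*m. hausdorff_outer k (R j))"
        by (intro sum_mono2) auto
      also have "\<dots> \<le> hausdorff_outer k X + hausdorff_outer k X"
        unfolding even_odd by (intro add_mono sum_le)
      finally show ?thesis by (simp add: mult_2)
    qed
    have sfin: "(\<Sum>j. hausdorff_outer k (R j)) < top"
    proof -
      have "(\<Sum>j. hausdorff_outer k (R j)) \<le> 2 * hausdorff_outer k X"
        using part by (intro suminf_le_const) auto
      also have "\<dots> < top"
        using fin by (simp add: ennreal_mult_less_top)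
      finally show ?thesis .
    qed
    have diff: "X - C \<subseteq> A n \<union> (\<Union>j. R (j + n))" for n
    proof
      fix x assume x: "x \<in> X - C"
      then have pos: "infdist x C > 0"
        using C ne by (simp add: infdist_pos_not_in_closed)
      show "x \<in> A n \<union> (\<Union>j. R (j + n))"
      proof (cases "a n \<le> infdist x C")
        case True
        then show ?thesis using x by (auto simp: A_def)
      next
        case nle: False
        obtain l where l: "a l \<le> infdist x C"
          using reals_Archimedean[OF pos] by (auto simp: a_def inverse_eq_divide intro: less_imp_le)
        define l0 where "l0 = (LEAST l. a l \<le> infdist x C)"
        have l0: "a l0 \<le> infdist x C"
          unfolding l0_def using l by (rule LeastI)
        have "n < l0"
          using nle l0 a_mono[of l0 n] by (meson le_less_trans not_le order_trans)
        then have "infdist x C < a (l0 - 1)"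
          unfolding l0_def using not_less_Least[of "l0 - 1" "\<lambda>l. a l \<le> infdist x C"]
          by (auto simp: l0_def[symmetric])
        then have "x \<in> R ((l0 - 1 - n) + n)"
          using \<open>n < l0\<close> l0 x by (auto simp: R_def)
        then show ?thesis by blast
      qed
    qed
    have bound: "hausdorff_outer k (X \<inter> C) + hausdorff_outer k (X - C)
        \<le> hausdorff_outer k X + (\<Sum>j. hausdorff_outer k (R (j + n)))" for n
    proof -
      have "hausdorff_outer k (X - C) \<le> hausdorff_outer k (A n \<union> (\<Union>j. R (j + n)))"
        by (rule hausdorff_outer_mono[OF diff])
      also have "\<dots> \<le> hausdorff_outer k (A n) + hausdorff_outer k (\<Union>j. R (j + n))"
        by (rule hausdorff_outer_Un_le[OF k])
      also have "\<dots> \<le> hausdorff_outer k (A n) + (\<Sum>j. hausdorff_outer k (R (j + n)))"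
        by (intro add_left_mono hausdorff_outer_UN_le)
      finally have "hausdorff_outer k (X \<inter> C) + hausdorff_outer k (X - C) \<le>
          hausdorff_outer k (X \<inter> C) + hausdorff_outer k (A n) + (\<Sum>j. hausdorff_outer k (R (j + n)))"
        by (simp add: add.assoc add_left_mono)
      also have "hausdorff_outer k (X \<inter> C) + hausdorff_outer k (A n)
          \<le> hausdorff_outer k ((X \<inter> C) \<union> A n)"
      proof (rule hausdorff_outer_separated[OF _ a(1)[of n] k])
        fix x y assume "x \<in> X \<inter> C" "y \<in> A n"
        then show "a n \<le> dist x y"
          using infdist_le[of x C y] by (auto simp: A_def dist_commute)
      qed
      also have "\<dots> \<le> hausdorff_outer k X"
        by (rule hausdorff_outer_mono) (auto simp: A_def)
      finally show ?thesis
        by (simp add: add_right_mono)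
    qed
    have "(\<lambda>n. \<Sum>j. hausdorff_outer k (R (j + n))) \<longlonglongrightarrow> 0"
    proof -
      define h where "h j = enn2real (hausdorff_outer k (R j))" for j
      have h: "hausdorff_outer k (R j) = ennreal (h j)" for j
      proof -
        have "hausdorff_outer k (R j) < top"
          using sfin by (auto simp: less_top dest!: ennreal_suminf_lessD)
        then show ?thesis by (simp add: h_def)
      qed
      have h0: "h j \<ge> 0" for j
        by (simp add: h_def)
      have sm: "summable h"
        using sfin h0 unfolding h by (intro summable_suminf_not_top) auto
      have "(\<Sum>j. hausdorff_outer k (R (j + n))) = ennreal (\<Sum>j. h (j + n))" for n
        unfolding h using sm h0 by (intro suminf_ennreal2) (auto simp: summable_iff_shift)
      moreover have "(\<lambda>n. ennreal (\<Sum>j. h (j + n))) \<longlonglongrightarrow> ennreal 0"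
        by (intro tendsto_ennrealI suminf_exist_split2 sm)
      ultimately show ?thesis by simp
    qed
    then have "(\<lambda>n. hausdorff_outer k X + (\<Sum>j. hausdorff_outer k (R (j + n))))
        \<longlonglongrightarrow> hausdorff_outer k X + 0"
      by (intro tendsto_add tendsto_const)
    then show ?thesis
      using bound by (intro LIMSEQ_le_const[of _ "hausdorff_outer k X"]) auto
  qed
  interpret sigma_algebra UNIV "Pow (UNIV :: 'a set)"
    by (rule sigma_algebra_Pow)
  show ?thesis
    unfolding lambda_system_eq
  proof (safe, simp)
    fix X :: "'a set"
    have "hausdorff_outer k X \<le> hausdorff_outer k (X \<inter> C) + hausdorff_outer k (X - C)"
      using hausdorff_outer_Un_le[OF k, of "X \<inter> C" "X - C"] by (simp add: Int_Diff_Un)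
    with main show "hausdorff_outer k (X \<inter> C) + hausdorff_outer k (X - C) = hausdorff_outer k X"
      by (intro antisym)
  qed
qed

lemma hausdorff_measure_space:
  assumes k: "k > 0"
  shows "measure_space UNIV (sets borel) (hausdorff_outer k :: 'a::metric_space set \<Rightarrow> _)"
proof -
  let ?L = "lambda_system UNIV (Pow UNIV) (hausdorff_outer k :: 'a set \<Rightarrow> _)"
  interpret sigma_algebra UNIV "Pow (UNIV :: 'a set)"
    by (rule sigma_algebra_Pow)
  have L: "measure_space UNIV ?L (hausdorff_outer k)"
    by (rule caratheodory_lemma[OF hausdorff_outer_space[OF k]])
  then interpret L: sigma_algebra UNIV ?L
    by (simp add: measure_space_def)
  have "sigma_sets UNIV {C :: 'a set. closed C} \<subseteq> ?L"
    using hausdorff_outer_closed[OF _ k] by (intro L.sigma_sets_subset subsetI) blast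
  then have "sets (borel :: 'a measure) \<subseteq> ?L"
    by (simp add: borel_eq_closed)
  then show ?thesis
    using L sets.sigma_algebra_axioms[of "borel :: 'a measure"]
    by (auto simp: measure_space_def countably_additive_def positive_def)
qed

lemma sets_hausdorff_measure [simp]: "sets (hausdorff_measure k) = sets borel"
  unfolding hausdorff_measure_def by (metis sets.sigma_sets_eq sets_measure_of sets.space_closed space_borel)

lemma emeasure_hausdorff_measure:
  "k > 0 \<Longrightarrow> A \<in> sets borel \<Longrightarrow> emeasure (hausdorff_measure k) A = hausdorff_outer k A"
  using hausdorff_measure_space[of k] unfolding hausdorff_measure_def
  by (intro emeasure_measure_of_sigma) (auto simp: measure_space_def)

definition surface_measure :: "(real^'n) measure" where
  "surface_measure = hausdorff_measure (CARD('n) - 1)"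


section \<open>Lipschitz domains\<close>

text \<open>
  Near each boundary point the set is the strict epigraph of a Lipschitz function in the
  direction of some unit vector \<open>e\<close>. The function is only evaluated on the hyperplane
  orthogonal to \<open>e\<close>.
\<close>

definition lipschitz_boundary :: "'a::euclidean_space set \<Rightarrow> bool" where
  "lipschitz_boundary \<Omega> \<longleftrightarrow>
     (\<forall>x \<in> frontier \<Omega>. \<exists>r>0. \<exists>e \<phi> L. norm e = 1 \<and> L-lipschitz_on UNIV \<phi> \<and>
        \<Omega> \<inter> ball x r = {y \<in> ball x r. \<phi> (y - (y \<bullet> e) *\<^sub>R e) < y \<bullet> e})"


section \<open>Lebesgue and Sobolev spaces\<close>

text \<open>
  Elements of function spaces are represented by functions; all conditions on them are
  invariant under changes on null sets. The norm of \<^typ>\<open>real^'n^'n\<close> is the Frobenius norm,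
  its inner product the Frobenius inner product.
\<close>

definition L2_space :: "'a measure \<Rightarrow> 'b::euclidean_space set \<Rightarrow> ('a \<Rightarrow> 'b) set" where
  "L2_space M S = {u \<in> borel_measurable M.
     (AE x in M. u x \<in> S) \<and> integrable M (\<lambda>x. (norm (u x))\<^sup>2)}"

definition L2_norm :: "'a measure \<Rightarrow> ('a \<Rightarrow> 'b::euclidean_space) \<Rightarrow> real" where
  "L2_norm M u = sqrt (\<integral>x. (norm (u x))\<^sup>2 \<partial>M)"

definition partial_deriv :: "'n \<Rightarrow> (real^'n \<Rightarrow> real) \<Rightarrow> real^'n \<Rightarrow> real" where
  "partial_deriv i \<phi> x = frechet_derivative \<phi> (at x) (axis i 1)"

primrec C_diff :: "nat \<Rightarrow> (real^'n \<Rightarrow> real) \<Rightarrow> bool" where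
  "C_diff 0 \<phi> \<longleftrightarrow> continuous_on UNIV \<phi>"
| "C_diff (Suc k) \<phi> \<longleftrightarrow> (\<forall>x. \<phi> differentiable at x) \<and> (\<forall>i. C_diff k (partial_deriv i \<phi>))"

definition smooth :: "(real^'n \<Rightarrow> real) \<Rightarrow> bool" where
  "smooth \<phi> \<longleftrightarrow> (\<forall>k. C_diff k \<phi>)"

definition test_function :: "(real^'n) set \<Rightarrow> (real^'n \<Rightarrow> real) \<Rightarrow> bool" where
  "test_function \<Omega> \<phi> \<longleftrightarrow> smooth \<phi> \<and> compact (closure {x. \<phi> x \<noteq> 0}) \<and> closure {x. \<phi> x \<noteq> 0} \<subseteq> \<Omega>"

text \<open>Row \<open>i\<close> of the gradient of \<open>v\<close> is the gradient of the \<open>i\<close>-th component of \<open>v\<close>.\<close>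

definition is_weak_grad ::
    "(real^'n) set \<Rightarrow> (real^'n \<Rightarrow> real^'n) \<Rightarrow> (real^'n \<Rightarrow> real^'n^'n) \<Rightarrow> bool" where
  "is_weak_grad \<Omega> v G \<longleftrightarrow>
     (\<forall>\<phi>. test_function \<Omega> \<phi> \<longrightarrow> (\<forall>i j.
        (\<integral>x. v x $ i * partial_deriv j \<phi> x \<partial>lebesgue_on \<Omega>) =
        - (\<integral>x. G x $ i $ j * \<phi> x \<partial>lebesgue_on \<Omega>)))"

definition H1_space :: "(real^'n) set \<Rightarrow> (real^'n \<Rightarrow> real^'n) set" where
  "H1_space \<Omega> = {v \<in> L2_space (lebesgue_on \<Omega>) UNIV.
     \<exists>G \<in> L2_space (lebesgue_on \<Omega>) UNIV. is_weak_grad \<Omega> v G}"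

definition weak_grad :: "(real^'n) set \<Rightarrow> (real^'n \<Rightarrow> real^'n) \<Rightarrow> real^'n \<Rightarrow> real^'n^'n" where
  "weak_grad \<Omega> v = (SOME G. G \<in> L2_space (lebesgue_on \<Omega>) UNIV \<and> is_weak_grad \<Omega> v G)"

text \<open>
  The trace operator is the continuous extension to \<open>H\<^sup>1\<close> of the restriction to the boundary of
  functions that are smooth up to the boundary; \<open>w\<close> is the trace of \<open>v\<close>.
\<close>

definition has_trace ::
    "(real^'n) set \<Rightarrow> (real^'n \<Rightarrow> real^'n) \<Rightarrow> (real^'n \<Rightarrow> real^'n) \<Rightarrow> bool" where
  "has_trace \<Omega> v w \<longleftrightarrow>
     w \<in> L2_space (restrict_space surface_measure (frontier \<Omega>)) UNIV \<and>
     (\<exists>u :: nat \<Rightarrow> real^'n \<Rightarrow> real^'n.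
        (\<forall>k i. smooth (\<lambda>x. u k x $ i)) \<and>
        (\<lambda>k. L2_norm (lebesgue_on \<Omega>) (\<lambda>x. u k x - v x)) \<longlonglongrightarrow> 0 \<and>
        (\<lambda>k. L2_norm (lebesgue_on \<Omega>)
               (\<lambda>x. matrix (frechet_derivative (u k) (at x)) - weak_grad \<Omega> v x)) \<longlonglongrightarrow> 0 \<and>
        (\<lambda>k. L2_norm (restrict_space surface_measure (frontier \<Omega>))
               (\<lambda>x. u k x - w x)) \<longlonglongrightarrow> 0)"

definition V_space :: "(real^'n) set \<Rightarrow> (real^'n) set \<Rightarrow> (real^'n \<Rightarrow> real^'n) set" where
  "V_space \<Omega> \<Gamma>D = {v \<in> H1_space \<Omega>.
     \<exists>w. has_trace \<Omega> v w \<and> (AE x in restrict_space surface_measure \<Gamma>D. w x = 0)}"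

definition sym_mats :: "(real^'n^'n) set" where
  "sym_mats = {q. \<forall>i j. q $ j $ i = q $ i $ j}"

definition sym_dev_mats :: "(real^'n^'n) set" where
  "sym_dev_mats = {q \<in> sym_mats. (\<Sum>j\<in>UNIV. q $ j $ j) = 0}"

definition Q_space :: "(real^'n) set \<Rightarrow> (real^'n \<Rightarrow> real^'n^'n) set" where
  "Q_space \<Omega> = L2_space (lebesgue_on \<Omega>) sym_dev_mats"

definition M_space :: "(real^'n) set \<Rightarrow> (real^'n \<Rightarrow> real) set" where
  "M_space \<Omega> = L2_space (lebesgue_on \<Omega>) UNIV"

type_synonym 'n state =
  "(real^'n \<Rightarrow> real^'n) \<times> (real^'n \<Rightarrow> real^'n^'n) \<times> (real^'n \<Rightarrow> real)"


section \<open>Elasticity tensor and stress\<close>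

text \<open>
  A fourth-order tensor is a linear map on matrices. Only its action on symmetric matrices is
  relevant, and constraints are imposed only there. Since the tensor is constant, the
  ellipticity condition for fields is the pointwise one.
\<close>

definition elasticity_tensor :: "(real^'n^'n \<Rightarrow> real^'n^'n) \<Rightarrow> real \<Rightarrow> bool" where
  "elasticity_tensor \<C> \<kappa> \<longleftrightarrow>
     linear \<C> \<and>
     (\<forall>\<tau> \<in> sym_mats. \<C> \<tau> \<in> sym_mats) \<and>
     (\<forall>\<tau> \<in> sym_mats. \<forall>\<mu> \<in> sym_mats. \<C> \<tau> \<bullet> \<mu> = \<tau> \<bullet> \<C> \<mu>) \<and>
     (\<forall>R. orthogonal_matrix R \<longrightarrow>
        (\<forall>\<tau> \<in> sym_mats. \<C> (R ** \<tau> ** transpose R) = R ** \<C> \<tau> ** transpose R)) \<and>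
     \<kappa> > 0 \<and> (\<forall>\<tau> \<in> sym_mats. \<kappa> * (norm \<tau>)\<^sup>2 \<le> \<C> \<tau> \<bullet> \<tau>)"

definition strain :: "(real^'n) set \<Rightarrow> (real^'n \<Rightarrow> real^'n) \<Rightarrow> real^'n \<Rightarrow> real^'n^'n" where
  "strain \<Omega> w x = (1/2) *\<^sub>R (weak_grad \<Omega> w x + transpose (weak_grad \<Omega> w x))"

definition stress :: "(real^'n^'n \<Rightarrow> real^'n^'n) \<Rightarrow> (real^'n) set \<Rightarrow>
    (real^'n \<Rightarrow> real^'n) \<Rightarrow> (real^'n \<Rightarrow> real^'n^'n) \<Rightarrow> real^'n \<Rightarrow> real^'n^'n" where
  "stress \<C> \<Omega> w p x = \<C> (strain \<Omega> w x - p x)"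

definition err_measure ::
    "(real^'n^'n \<Rightarrow> real^'n^'n) \<Rightarrow> (real^'n) set \<Rightarrow> 'n state \<Rightarrow> 'n state \<Rightarrow> real" where
  "err_measure \<C> \<Omega> = (\<lambda>(v, q, \<beta>) (v', q', \<beta>').
     L2_norm (lebesgue_on \<Omega>) (\<lambda>x. stress \<C> \<Omega> v q x - stress \<C> \<Omega> v' q' x))"


section \<open>Meshes and newest vertex bisection\<close>

text \<open>
  For \<open>d > 2\<close> the reference edges of an element and of all its descendants are encoded by an
  ordering \<open>[x\<^sub>0, \<dots>, x\<^sub>d]\<close> of its vertices and a type in \<open>{0, \<dots>, d - 1}\<close>; the reference edge
  joins \<open>x\<^sub>0\<close> and \<open>x\<^sub>d\<close>. For \<open>d = 2\<close> the type and the orientation of the reference edge have no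
  influence on the generated triangles and reference edges.
\<close>

type_synonym 'n tagged_simplex = "(real^'n) list \<times> nat"
type_synonym 'n mesh = "'n tagged_simplex set"

definition tagged_simplex :: "('n::finite) tagged_simplex \<Rightarrow> bool" where
  "tagged_simplex \<tau> \<longleftrightarrow> (case \<tau> of (xs, \<gamma>) \<Rightarrow>
     length xs = CARD('n) + 1 \<and> distinct xs \<and> \<not> affine_dependent (set xs) \<and> \<gamma> < CARD('n))"

definition verts :: "('n::finite) tagged_simplex \<Rightarrow> (real^'n) set" where
  "verts \<tau> = set (fst \<tau>)"

definition elt :: "('n::finite) tagged_simplex \<Rightarrow> (real^'n) set" where
  "elt \<tau> = convex hull (verts \<tau>)"

definition elements :: "('n::finite) mesh \<Rightarrow> (real^'n) set set" where
  "elements \<T> = elt ` \<T>"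

text \<open>
  The predicate \<^const>\<open>triangulation\<close> requires that any two elements intersect in a common face
  (possibly empty) of both.
\<close>

definition is_mesh :: "(real^'n) set \<Rightarrow> 'n mesh \<Rightarrow> bool" where
  "is_mesh \<Omega> \<T> \<longleftrightarrow> finite \<T> \<and> (\<forall>\<tau> \<in> \<T>. tagged_simplex \<tau>) \<and> inj_on elt \<T> \<and>
     triangulation (elements \<T>) \<and> \<Union> (elements \<T>) = closure \<Omega>"

text \<open>
  Bisection in Stevenson's formulation: with \<open>m\<close> the midpoint of \<open>x\<^sub>0\<close> and \<open>x\<^sub>d\<close>, an element
  \<open>[x\<^sub>0, \<dots>, x\<^sub>d]\<close> of type \<open>\<gamma>\<close> has the two children
  \<open>[x\<^sub>0, m, x\<^sub>1, \<dots>, x\<^sub>\<gamma>, x\<^sub>\<gamma>\<^sub>+\<^sub>1, \<dots>, x\<^sub>d\<^sub>-\<^sub>1]\<close> and \<open>[x\<^sub>d, m, x\<^sub>1, \<dots>, x\<^sub>\<gamma>, x\<^sub>d\<^sub>-\<^sub>1, \<dots>, x\<^sub>\<gamma>\<^sub>+\<^sub>1]\<close>,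
  both of type \<open>\<gamma> + 1\<close> modulo \<open>d\<close>. The reference edges of the children are opposite to \<open>m\<close>.
\<close>

definition bisect :: "('n::finite) tagged_simplex \<Rightarrow> 'n mesh" where
  "bisect \<tau> = (case \<tau> of (xs, \<gamma>) \<Rightarrow>
     let a = hd xs; b = last xs; m = midpoint a b; ys = butlast (tl xs);
         \<gamma>' = (\<gamma> + 1) mod CARD('n)
     in {(a # m # ys, \<gamma>'), (b # m # take \<gamma> ys @ rev (drop \<gamma> ys), \<gamma>')})"

definition bisect_marked :: "('n::finite) mesh \<Rightarrow> 'n mesh \<Rightarrow> 'n mesh" where
  "bisect_marked \<P> \<M> = (\<P> - \<M>) \<union> (\<Union>\<tau>\<in>\<M>. bisect \<tau>)"

definition with_hanging_node :: "('n::finite) mesh \<Rightarrow> 'n mesh" where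
  "with_hanging_node \<P> = {\<tau> \<in> \<P>. \<exists>a \<in> verts \<tau>. \<exists>b \<in> verts \<tau>. \<exists>\<tau>' \<in> \<P>. \<exists>x \<in> verts \<tau>'.
     a \<noteq> b \<and> x \<in> open_segment a b}"

text \<open>
  \<open>is_NVB \<T> \<M> \<T>'\<close> states that the bisection loop for the marked elements \<open>\<M>\<close> terminates with
  the result \<open>\<T>'\<close>. Iterations after the removal of all hanging nodes have no effect.
\<close>

definition is_NVB :: "('n::finite) mesh \<Rightarrow> 'n mesh \<Rightarrow> 'n mesh \<Rightarrow> bool" where
  "is_NVB \<T> \<M> \<T>' \<longleftrightarrow> with_hanging_node \<T>' = {} \<and>
     (\<exists>k. \<T>' = ((\<lambda>\<P>. bisect_marked \<P> (with_hanging_node \<P>)) ^^ k) (bisect_marked \<T> \<M>))"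

text \<open>
  In three dimensions, the absence of hanging nodes implies that the result is conforming only
  if the initial tags are compatible; hence conformity is required explicitly.
\<close>

inductive_set NVB_meshes :: "(real^'n) set \<Rightarrow> 'n mesh \<Rightarrow> 'n mesh set"
  for \<Omega> :: "(real^'n) set" and \<T> :: "'n mesh" where
  initial: "\<T> \<in> NVB_meshes \<Omega> \<T>"
| refine: "\<T>' \<in> NVB_meshes \<Omega> \<T> \<Longrightarrow> \<M> \<subseteq> \<T>' \<Longrightarrow> is_NVB \<T>' \<M> \<T>'' \<Longrightarrow> is_mesh \<Omega> \<T>'' \<Longrightarrow>
           \<T>'' \<in> NVB_meshes \<Omega> \<T>"

definition inradius :: "'a::metric_space set \<Rightarrow> real" where
  "inradius T = Sup {r. r \<ge> 0 \<and> (\<exists>x. cball x r \<subseteq> T)}"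

definition uniformly_shape_regular :: "('n::finite) mesh set \<Rightarrow> bool" where
  "uniformly_shape_regular \<TT> \<longleftrightarrow>
     (\<exists>c>0. \<forall>\<T> \<in> \<TT>. \<forall>T \<in> elements \<T>. diameter T \<le> c * inradius T)"

text \<open>The facets of an element are its edges for \<open>d = 2\<close> and its faces for \<open>d = 3\<close>.\<close>

definition sides :: "(real^'n) set \<Rightarrow> (real^'n) set set" where
  "sides T = {E. E facet_of T}"

definition unit_normals :: "'n mesh set \<Rightarrow> ((real^'n) set \<Rightarrow> real^'n) \<Rightarrow> bool" where
  "unit_normals \<TT> \<nu> \<longleftrightarrow> (\<forall>\<T> \<in> \<TT>. \<forall>T \<in> elements \<T>. \<forall>E \<in> sides T.
     norm (\<nu> E) = 1 \<and> (\<forall>x \<in> E. \<forall>y \<in> E. (x - y) \<bullet> \<nu> E = 0))"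


section \<open>Discrete spaces\<close>

text \<open>
  Functions are only given on the open set \<open>\<Omega>\<close>; this is why \<open>T \<inter> \<Omega>\<close> appears below. For an
  element \<open>T\<close>, the set \<open>T - \<Omega>\<close> is part of the boundary of \<open>T\<close> and has measure zero.
\<close>

definition V_discrete :: "(real^'n) set \<Rightarrow> (real^'n) set \<Rightarrow> 'n mesh \<Rightarrow> (real^'n \<Rightarrow> real^'n) set" where
  "V_discrete \<Omega> \<Gamma>D \<T> = {v \<in> V_space \<Omega> \<Gamma>D.
     \<forall>T \<in> elements \<T>. \<exists>A b. AE x in lebesgue_on (T \<inter> \<Omega>). v x = A *v x + b}"

definition Q_discrete :: "(real^'n) set \<Rightarrow> 'n mesh \<Rightarrow> (real^'n \<Rightarrow> real^'n^'n) set" where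
  "Q_discrete \<Omega> \<T> = {q \<in> Q_space \<Omega>.
     \<forall>T \<in> elements \<T>. \<exists>c. AE x in lebesgue_on (T \<inter> \<Omega>). q x = c}"

definition M_discrete :: "(real^'n) set \<Rightarrow> 'n mesh \<Rightarrow> (real^'n \<Rightarrow> real) set" where
  "M_discrete \<Omega> \<T> = {\<beta> \<in> M_space \<Omega>.
     \<forall>T \<in> elements \<T>. \<exists>c. AE x in lebesgue_on (T \<inter> \<Omega>). \<beta> x = c}"

definition X_discrete :: "(real^'n) set \<Rightarrow> (real^'n) set \<Rightarrow> 'n mesh \<Rightarrow> 'n state set" where
  "X_discrete \<Omega> \<Gamma>D \<T> = V_discrete \<Omega> \<Gamma>D \<T> \<times> Q_discrete \<Omega> \<T> \<times> M_discrete \<Omega> \<T>"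


section \<open>Error indicators\<close>

text \<open>The value on the element \<open>T\<close> of a field that is constant (almost everywhere) on \<open>T\<close>.\<close>

definition elt_value :: "(real^'n) set \<Rightarrow> (real^'n \<Rightarrow> 'b) \<Rightarrow> (real^'n) set \<Rightarrow> 'b" where
  "elt_value \<Omega> \<tau> T = (THE c. AE x in lebesgue_on (T \<inter> \<Omega>). \<tau> x = c)"

text \<open>The element with side \<open>E\<close> into which the normal \<open>n\<close> of \<open>E\<close> points.\<close>

definition elt_towards :: "'n mesh \<Rightarrow> (real^'n) set \<Rightarrow> real^'n \<Rightarrow> (real^'n) set" where
  "elt_towards \<T> E n =
     (THE T. T \<in> elements \<T> \<and> E \<in> sides T \<and> (\<forall>x \<in> T. \<forall>y \<in> E. 0 \<le> (x - y) \<bullet> n))"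

definition jump :: "(real^'n) set \<Rightarrow> 'n mesh \<Rightarrow> (real^'n \<Rightarrow> real^'n^'n) \<Rightarrow>
    (real^'n) set \<Rightarrow> real^'n \<Rightarrow> real^'n^'n" where
  "jump \<Omega> \<T> \<tau> E n =
     elt_value \<Omega> \<tau> (elt_towards \<T> E n) - elt_value \<Omega> \<tau> (elt_towards \<T> E (- n))"

definition boundary_elt :: "'n mesh \<Rightarrow> (real^'n) set \<Rightarrow> (real^'n) set" where
  "boundary_elt \<T> E = (THE T. T \<in> elements \<T> \<and> E \<in> sides T)"

text \<open>
  A boundary side on \<open>\<Gamma>\<^sub>N\<close> may meet \<open>\<Gamma>\<^sub>D\<close> in its relative boundary, where \<open>g\<close> is not given; thus
  the norm is taken over the part of the side in \<open>\<Gamma>\<^sub>N\<close>. This also covers meshes that do not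
  resolve the splitting of the boundary.
\<close>

definition side_residual :: "(real^'n) set \<Rightarrow> (real^'n) set \<Rightarrow> (real^'n \<Rightarrow> real^'n) \<Rightarrow>
    (real^'n^'n \<Rightarrow> real^'n^'n) \<Rightarrow> ((real^'n) set \<Rightarrow> real^'n) \<Rightarrow> 'n mesh \<Rightarrow> 'n state \<Rightarrow>
    (real^'n) set \<Rightarrow> real" where
  "side_residual \<Omega> \<Gamma>D g \<C> \<nu> \<T> z E = (case z of (v, q, \<beta>) \<Rightarrow>
     if \<not> E \<subseteq> frontier \<Omega> then
       L2_norm (restrict_space surface_measure E)
         (\<lambda>x. jump \<Omega> \<T> (stress \<C> \<Omega> v q) E (\<nu> E) *v \<nu> E)
     else if E \<subseteq> \<Gamma>D then 0
     else
       L2_norm (restrict_space surface_measure (E \<inter> (frontier \<Omega> - \<Gamma>D)))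
         (\<lambda>x. g x - elt_value \<Omega> (stress \<C> \<Omega> v q) (boundary_elt \<T> E) *v \<nu> E))"

text \<open>The square of the error indicator.\<close>

definition eta_sq :: "(real^'n) set \<Rightarrow> (real^'n) set \<Rightarrow> (real^'n \<Rightarrow> real^'n) \<Rightarrow>
    (real^'n \<Rightarrow> real^'n) \<Rightarrow> (real^'n^'n \<Rightarrow> real^'n^'n) \<Rightarrow> ((real^'n) set \<Rightarrow> real^'n) \<Rightarrow>
    'n mesh \<Rightarrow> 'n state \<Rightarrow> (real^'n) set \<Rightarrow> real" where
  "eta_sq \<Omega> \<Gamma>D f g \<C> \<nu> \<T> z T =
     measure lebesgue T * (L2_norm (lebesgue_on (T \<inter> \<Omega>)) f)\<^sup>2 +
     sqrt (measure lebesgue T) * (\<Sum>E \<in> sides T. (side_residual \<Omega> \<Gamma>D g \<C> \<nu> \<T> z E)\<^sup>2)"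

end

theory Submission
  imports Defs
begin

text \<open>
  The indicator on an element consists of the volume term, which is the same for both states,
  and of residuals on the sides. Seen as norms of vectors with one entry for each volume term
  and one for each pair of an element \<open>T \<in> S\<close> and a side \<open>E\<close> of \<open>T\<close>, the two estimators differ by
  at most the norm of the differences of the entries (\<open>sqrt_sum_estimators_diff\<close>). Thus only
  the differences of the residuals have to be bounded.

  Let \<open>\<delta>\<close> be the difference of the stresses. Since an element of the fine mesh lies in one of the
  coarse mesh, \<open>\<delta>\<close> is constant on every element \<open>K\<close> of the fine mesh. An element \<open>T\<close> of both meshes
  has the sides \<open>E\<close> in both; the fine neighbour of \<open>T\<close> across \<open>E\<close> may be smaller than the coarse one, but
  it is contained in it (\<open>elt_towards_subset\<close>), so the difference of the jumps across \<open>E\<close> is the jump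
  of \<open>\<delta>\<close> on the fine mesh. On a Neumann side, \<open>g\<close> cancels and \<open>\<delta>\<close> on \<open>T\<close> remains. Hence the square of the
  difference of the residuals is at most twice \<open>|E|\<close> times the sum of \<open>|\<delta>\<^sub>K|\<^sup>2\<close> over the fine elements \<open>K\<close> with
  side \<open>E\<close> (\<open>side_residual_diff\<close>). By shape regularity \<open>|T|\<^sup>1\<^sup>/\<^sup>2 |E| \<le> C |K|\<close> for these \<open>K\<close>
  (\<open>shape_regular_scaling\<close>): with \<open>h\<close> the diameter of \<open>E\<close>, the left-hand side is of order \<open>h\<^sup>d\<^sup>/\<^sup>2 h\<^sup>d\<^sup>-\<^sup>1\<close>
  and the right-hand side of order \<open>h\<^sup>d\<close>, while \<open>h\<^sup>d\<^sup>/\<^sup>2\<^sup>-\<^sup>1\<close> is bounded. As \<open>|K| |\<delta>\<^sub>K|\<^sup>2\<close> is the integral of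
  \<open>|\<delta>|\<^sup>2\<close> over \<open>K\<close>, and a side belongs to at most two elements and an element has at most \<open>d + 1\<close> sides,
  summation gives the squared error measure.

  Three facts behind this need work. First, stresses of discrete states are piecewise constant although
  the gradient is only a weak one: the weak gradient of a function that is affine on an open set is
  the matrix of that function there (\<open>weak_grad_eq_AE_of_affine\<close>), which requires test functions and the
  fundamental lemma of the calculus of variations. Second, the elements on both sides of an interior
  side, and the single element at a boundary side, are determined uniquely: near a relative
  interior point of a facet, a simplex fills one side of the facet. For boundary sides this uses that a
  Lipschitz domain does not lie on both sides of its boundary. Third, the Hausdorff measure of a
  side is bounded by its diameter to the power \<open>d - 1\<close>.
\<close>

section \<open>Smooth approximations of boxes\<close>

text \<open>
  The functions \<open>exp (- 1 / t) / t ^ k\<close>, extended by zero, form a family that is closed under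
  differentiation up to linear combinations.
\<close>

definition flat :: "nat \<Rightarrow> real \<Rightarrow> real" where
  "flat k t = (if t > 0 then exp (- 1 / t) / t ^ k else 0)"

lemma flat_nonneg: "0 \<le> flat k t"
  by (simp add: flat_def)

lemma power_le_fact_exp:
  fixes y :: real
  assumes "0 \<le> y"
  shows "y ^ m \<le> fact m * exp y"
proof -
  have "inverse (fact m) * y ^ m \<le> (\<Sum>n. inverse (fact n) * y ^ n)"
    using sum_le_suminf[OF summable_exp[of y], of "{m}"] assms by simp
  also have "\<dots> = exp y"
    by (simp add: exp_def scaleR_conv_of_real)
  finally show ?thesis
    by (simp add: field_simps)
qed

text \<open>
  The quadratic bound makes the derivative at zero vanish.
\<close>

lemma flat_le_square: "flat k t \<le> fact (k + 2) * t\<^sup>2"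
proof (cases "t > 0")
  case True
  have "(1 / t) ^ (k + 2) \<le> fact (k + 2) * exp (1 / t)"
    by (rule power_le_fact_exp) (use True in simp)
  then have "1 \<le> fact (k + 2) * exp (1 / t) * t ^ (k + 2)"
    using True by (simp add: power_one_over field_simps)
  then have "exp (- 1 / t) \<le> fact (k + 2) * t ^ (k + 2)"
    by (simp add: exp_minus field_simps)
  then show ?thesis
    using True by (simp add: flat_def field_simps power_add power2_eq_square)
qed (simp add: flat_def)

lemma flat_has_real_derivative:
  "(flat k has_real_derivative flat (k + 2) t - real k * flat (k + 1) t) (at t)"
proof (cases t "0::real" rule: linorder_cases)
  case less
  have "((\<lambda>_. 0) has_real_derivative 0) (at t)" by simp
  then have "(flat k has_real_derivative 0) (at t)"
    by (rule has_field_derivative_transform_within_open[where S = "{..<0}"])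
      (use less in \<open>auto simp: flat_def\<close>)
  then show ?thesis using less by (simp add: flat_def)
next
  case equal
  have "(\<lambda>h. flat k h / h) \<midarrow>0\<rightarrow> 0"
  proof (rule Lim_null_comparison)
    show "\<forall>\<^sub>F h in at 0. norm (flat k h / h) \<le> fact (k + 2) * \<bar>h\<bar>"
    proof (intro always_eventually allI)
      fix h :: real
      have "norm (flat k h / h) = flat k h / \<bar>h\<bar>"
        by (simp add: abs_mult abs_divide flat_nonneg)
      also have "\<dots> \<le> fact (k + 2) * h\<^sup>2 / \<bar>h\<bar>"
        by (intro divide_right_mono flat_le_square) simp
      also have "\<dots> \<le> fact (k + 2) * \<bar>h\<bar>"
        by (cases "h = 0") (auto simp: power2_eq_square abs_if)
      finally show "norm (flat k h / h) \<le> fact (k + 2) * \<bar>h\<bar>" .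
    qed
    show "(\<lambda>h. fact (k + 2) * \<bar>h\<bar>) \<midarrow>0\<rightarrow> (0::real)"
      by (rule tendsto_eq_intros refl | simp)+
  qed
  then show ?thesis
    unfolding equal by (simp add: DERIV_def flat_def)
next
  case greater
  have "((\<lambda>t. exp (- 1 / t) / t ^ k) has_real_derivative
      flat (k + 2) t - real k * flat (k + 1) t) (at t)"
    using greater
    apply (auto intro!: derivative_eq_intros simp: flat_def)
    apply (cases k)
     apply (auto simp: field_simps power2_eq_square)
    done
  then show ?thesis
    by (rule has_field_derivative_transform_within_open[where S = "{0<..}"])
      (use greater in \<open>auto simp: flat_def\<close>)
qed

text \<open>
  An algebra of functions that is closed under partial derivatives; its members are therefore smooth.
\<close>

inductive_set bump_algebra :: "(real^'n \<Rightarrow> real) set" where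
  coord: "(\<lambda>x. flat k (c * x $ i + d)) \<in> bump_algebra"
| const: "(\<lambda>x. c) \<in> bump_algebra"
| add: "\<phi> \<in> bump_algebra \<Longrightarrow> \<psi> \<in> bump_algebra \<Longrightarrow> (\<lambda>x. \<phi> x + \<psi> x) \<in> bump_algebra"
| mult: "\<phi> \<in> bump_algebra \<Longrightarrow> \<psi> \<in> bump_algebra \<Longrightarrow> (\<lambda>x. \<phi> x * \<psi> x) \<in> bump_algebra"

lemma bump_algebra_partials:
  assumes "\<phi> \<in> bump_algebra"
  shows "\<exists>D. (\<forall>i. D i \<in> bump_algebra) \<and> (\<forall>x. (\<phi> has_derivative (\<lambda>h. \<Sum>i\<in>UNIV. h $ i * D i x)) (at x))"
  using assms
proof induction
  case (coord k c i d)
  define e where "e x = c * flat (k + 2) (c * x $ i + d) + (- c * real k) * flat (k + 1) (c * x $ i + d)"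
    for x :: "real^'a"
  define D where "D j = (if j = i then e else (\<lambda>x. 0))" for j
  have "e \<in> bump_algebra"
    unfolding e_def by (intro bump_algebra.intros)
  then have "\<forall>j. D j \<in> bump_algebra"
    by (auto simp: D_def bump_algebra.const)
  moreover have "((\<lambda>x. flat k (c * x $ i + d)) has_derivative (\<lambda>h. \<Sum>j\<in>UNIV. h $ j * D j x)) (at x)" for x
  proof -
    have "((\<lambda>x. c * x $ i + d) has_derivative (\<lambda>h. c * h $ i)) (at x)"
      by (auto intro!: derivative_eq_intros bounded_linear.has_derivative[OF bounded_linear_vec_nth])
    from has_derivative_compose[OF this flat_has_real_derivative[unfolded has_field_derivative_def]]
    have "((\<lambda>x. flat k (c * x $ i + d)) has_derivative (\<lambda>h. h $ i * e x)) (at x)"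
      by (rule has_derivative_eq_rhs) (simp add: e_def algebra_simps)
    moreover have "(\<Sum>j\<in>UNIV. h $ j * D j x) = h $ i * e x" for h
      by (simp add: D_def if_distrib[of "\<lambda>f. f _"] if_distrib[of "\<lambda>r. _ * r"] cong: if_cong)
    ultimately show ?thesis by simp
  qed
  ultimately show ?case by blast
next
  case (const c)
  show ?case
    by (rule exI[of _ "\<lambda>_ _. 0"]) (auto intro: bump_algebra.const)
next
  case (add \<phi> \<psi>)
  then obtain D D' where "\<forall>i. D i \<in> bump_algebra" "\<forall>i. D' i \<in> bump_algebra"
    "\<And>x. (\<phi> has_derivative (\<lambda>h. \<Sum>i\<in>UNIV. h $ i * D i x)) (at x)"
    "\<And>x. (\<psi> has_derivative (\<lambda>h. \<Sum>i\<in>UNIV. h $ i * D' i x)) (at x)"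
    by blast
  then show ?case
    by (intro exI[of _ "\<lambda>i x. D i x + D' i x"] conjI allI bump_algebra.intros)
      (auto intro!: derivative_eq_intros simp: algebra_simps sum.distrib)
next
  case (mult \<phi> \<psi>)
  then obtain D D' where "\<forall>i. D i \<in> bump_algebra" "\<forall>i. D' i \<in> bump_algebra"
    "\<And>x. (\<phi> has_derivative (\<lambda>h. \<Sum>i\<in>UNIV. h $ i * D i x)) (at x)"
    "\<And>x. (\<psi> has_derivative (\<lambda>h. \<Sum>i\<in>UNIV. h $ i * D' i x)) (at x)"
    by blast
  then show ?case
    by (intro exI[of _ "\<lambda>i x. \<phi> x * D' i x + D i x * \<psi> x"] conjI allI bump_algebra.intros mult)
      (auto intro!: derivative_eq_intros simp: algebra_simps sum.distrib sum_distrib_left)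
qed

lemma bump_algebra_partial_deriv:
  assumes "\<phi> \<in> bump_algebra"
  shows "\<phi> differentiable at x" "partial_deriv i \<phi> \<in> bump_algebra"
    "(\<phi> has_derivative (\<lambda>h. \<Sum>i\<in>UNIV. h $ i * partial_deriv i \<phi> x)) (at x)"
proof -
  obtain D where D: "\<And>i. D i \<in> bump_algebra"
    "\<And>x. (\<phi> has_derivative (\<lambda>h. \<Sum>i\<in>UNIV. h $ i * D i x)) (at x)"
    using bump_algebra_partials[OF assms] by blast
  have "frechet_derivative \<phi> (at x) = (\<lambda>h. \<Sum>i\<in>UNIV. h $ i * D i x)" for x
    by (rule frechet_derivative_at[OF D(2), symmetric])
  then have eq: "partial_deriv i \<phi> = D i" for i
    by (intro ext) (simp add: partial_deriv_def axis_def of_bool_def if_distrib[of "\<lambda>r. r * _"] cong: if_cong)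
  show "\<phi> differentiable at x" "partial_deriv i \<phi> \<in> bump_algebra"
    "(\<phi> has_derivative (\<lambda>h. \<Sum>i\<in>UNIV. h $ i * partial_deriv i \<phi> x)) (at x)"
    unfolding eq differentiable_def using D by blast+
qed

lemma bump_algebra_continuous: "\<phi> \<in> bump_algebra \<Longrightarrow> continuous_on UNIV \<phi>"
  by (intro continuous_at_imp_continuous_on ballI differentiable_imp_continuous_within
      bump_algebra_partial_deriv(1))

text \<open>
  In a class of differentiable functions that contains the partial derivatives of its members, the order
  of differentiability can be raised by induction.
\<close>

lemma bump_algebra_smooth: "\<phi> \<in> bump_algebra \<Longrightarrow> smooth \<phi>"
proof -
  have "\<forall>\<phi> \<in> bump_algebra. C_diff k \<phi>" for k
    by (induction k) (auto simp: bump_algebra_continuous bump_algebra_partial_deriv)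
  then show "\<phi> \<in> bump_algebra \<Longrightarrow> smooth \<phi>"
    by (auto simp: smooth_def)
qed

text \<open>
  The factors are positive exactly on the open box and tend to one there as \<open>m\<close> grows.
\<close>

definition box_bump :: "nat \<Rightarrow> real^'n \<Rightarrow> real^'n \<Rightarrow> real^'n \<Rightarrow> real" where
  "box_bump m a b x =
     (\<Prod>i\<in>UNIV. flat 0 (real (Suc m) * (x $ i - a $ i)) * flat 0 (real (Suc m) * (b $ i - x $ i)))"

lemma bump_algebra_prod:
  assumes "finite I" "\<And>i. i \<in> I \<Longrightarrow> F i \<in> bump_algebra"
  shows "(\<lambda>x. \<Prod>i\<in>I. F i x) \<in> bump_algebra"
  using assms
proof (induction I)
  case empty
  then show ?case by (simp add: bump_algebra.const)
next
  case (insert j I)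
  then have "(\<lambda>x. F j x * (\<Prod>i\<in>I. F i x)) \<in> bump_algebra"
    by (intro bump_algebra.mult) auto
  with insert show ?case by simp
qed

lemma box_bump_in_algebra:
  fixes a b :: "real^'n"
  shows "box_bump m a b \<in> bump_algebra"
proof -
  have "(\<lambda>x :: real^'n. flat 0 (real (Suc m) * x $ i + (- real (Suc m) * a $ i))
      * flat 0 (- real (Suc m) * x $ i + real (Suc m) * b $ i)) \<in> bump_algebra" for i
    by (intro bump_algebra.intros)
  moreover have "real (Suc m) * x $ i + (- real (Suc m) * a $ i) = real (Suc m) * (x $ i - a $ i)"
    "- real (Suc m) * x $ i + real (Suc m) * b $ i = real (Suc m) * (b $ i - x $ i)" for x :: "real^'n" and i
    by (simp_all add: algebra_simps)
  ultimately show ?thesis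
    unfolding box_bump_def by (intro bump_algebra_prod) auto
qed

lemma flat_0: "flat 0 t = (if t > 0 then exp (- 1 / t) else 0)"
  by (simp add: flat_def)

lemma box_bump_nonzero_iff: "box_bump m a b x \<noteq> 0 \<longleftrightarrow> x \<in> box a b"
proof -
  have "flat 0 t \<noteq> 0 \<longleftrightarrow> 0 < t" for t
    by (simp add: flat_0)
  moreover have "0 < real (Suc m) * t \<longleftrightarrow> 0 < t" for t
    by (simp add: zero_less_mult_iff)
  ultimately show ?thesis
    unfolding box_bump_def by (auto simp: mem_box_cart simp del: of_nat_Suc)
qed

lemma box_bump_bounds: "0 \<le> box_bump m a b x" "box_bump m a b x \<le> 1"
proof -
  have "0 \<le> flat 0 s * flat 0 t" "flat 0 s * flat 0 t \<le> 1" for s t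
    by (auto simp: flat_0 intro: mult_le_one)
  then show "0 \<le> box_bump m a b x" "box_bump m a b x \<le> 1"
    unfolding box_bump_def by (auto intro: prod_nonneg prod_le_1)
qed

lemma box_bump_tendsto:
  fixes a b :: "real^'n"
  shows "(\<lambda>m. box_bump m a b x) \<longlonglongrightarrow> indicator (box a b) x"
proof (cases "x \<in> box a b")
  case True
  have "(\<lambda>m. flat 0 (real (Suc m) * t)) \<longlonglongrightarrow> 1" if "t > 0" for t
  proof -
    have "(\<lambda>m. exp (- (1 / t) * inverse (real (Suc m)))) \<longlonglongrightarrow> exp (- (1 / t) * 0)"
      by (intro tendsto_intros LIMSEQ_inverse_real_of_nat)
    then show ?thesis
      using that by (simp add: flat_0 zero_less_mult_iff divide_simps mult.commute)
  qed
  then have "(\<lambda>m. box_bump m a b x) \<longlonglongrightarrow> (\<Prod>i\<in>(UNIV :: 'n set). 1 * 1)"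
    unfolding box_bump_def using True by (intro tendsto_intros) (auto simp: mem_box_cart)
  then show ?thesis using True by simp
next
  case False
  then have "box_bump m a b x = 0" for m
    using box_bump_nonzero_iff by blast
  then show ?thesis using False by simp
qed

lemma box_bump_test_function:
  assumes "cbox a b \<subseteq> \<Omega>"
  shows "test_function \<Omega> (box_bump m a b)"
proof -
  have "closure {x. box_bump m a b x \<noteq> 0} \<subseteq> cbox a b"
    by (intro closure_minimal) (auto simp: box_bump_nonzero_iff intro: subsetD[OF box_subset_cbox])
  then show ?thesis
    using assms unfolding test_function_def
    by (auto simp: bump_algebra_smooth box_bump_in_algebra compact_eq_bounded_closed
      intro: bounded_subset[OF bounded_cbox])
qed

section \<open>Weak gradients of locally affine functions\<close>

lemma integrable_lborel_if_zero_off_cbox: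
  fixes h :: "'a::euclidean_space \<Rightarrow> real"
  assumes "continuous_on UNIV h" "\<And>x. x \<notin> cbox a b \<Longrightarrow> h x = 0"
  shows "integrable lborel h"
proof -
  have "integrable lborel (\<lambda>x. indicator (cbox a b) x *\<^sub>R h x)"
    by (intro borel_integrable_compact continuous_on_subset[OF assms(1)]) auto
  also have "(\<lambda>x. indicator (cbox a b) x *\<^sub>R h x) = h"
    using assms(2) by (auto simp: fun_eq_iff indicator_def)
  finally show ?thesis .
qed

text \<open>
  The integral of a translate of \<open>\<psi>\<close> does not depend on the translation. Hence the difference quotients in
  the direction \<open>e\<close> have integral zero; they are bounded and vanish outside a common ball, so that
  dominated convergence applies.
\<close>

lemma integral_directional_derivative_eq_0:
  fixes \<psi> :: "'a::euclidean_space \<Rightarrow> real"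
  assumes der: "\<And>x. (\<psi> has_derivative D x) (at x)"
    and cont: "continuous_on UNIV (\<lambda>x. D x e)"
    and supp: "\<And>x. x \<notin> cbox a b \<Longrightarrow> \<psi> x = 0" "\<And>x. x \<notin> cbox a b \<Longrightarrow> D x e = 0"
  shows "(\<integral>x. D x e \<partial>lborel) = 0"
proof -
  have line: "((\<lambda>t. \<psi> (x + t *\<^sub>R e)) has_real_derivative D (x + t *\<^sub>R e) e) (at t)" for x t
  proof -
    have "((\<lambda>t. x + t *\<^sub>R e) has_derivative (\<lambda>h. h *\<^sub>R e)) (at t)"
      by (auto intro!: derivative_eq_intros)
    from has_derivative_compose[OF this der]
    have "((\<lambda>t. \<psi> (x + t *\<^sub>R e)) has_derivative (\<lambda>h. D (x + t *\<^sub>R e) (h *\<^sub>R e))) (at t)" .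
    moreover have "D y (h *\<^sub>R e) = D y e * h" for y h
      using linear_scale[OF has_derivative_linear[OF der], of y h e] by (simp add: mult.commute)
    ultimately show ?thesis
      by (simp add: has_field_derivative_def mult.commute[of _ "D _ e"])
  qed
  define q where "q n x = real (Suc n) * (\<psi> (x + (1 / real (Suc n)) *\<^sub>R e) - \<psi> x)" for n x
  have "compact ((\<lambda>x. D x e) ` cbox a b)"
    by (intro compact_continuous_image continuous_on_subset[OF cont]) auto
  then obtain B0 where "\<forall>y \<in> (\<lambda>x. D x e) ` cbox a b. norm y \<le> B0"
    using compact_imp_bounded bounded_iff by blast
  then have B0: "\<And>x. x \<in> cbox a b \<Longrightarrow> \<bar>D x e\<bar> \<le> B0"
    by simp
  define B where "B = max B0 0"
  have B: "\<bar>D x e\<bar> \<le> B" for x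
    using B0[of x] supp(2)[of x] by (cases "x \<in> cbox a b") (auto simp: B_def)
  obtain R0 where R0: "\<And>x. x \<in> cbox a b \<Longrightarrow> norm x \<le> R0"
    using bounded_cbox[of a b] by (auto simp: bounded_iff)
  define R where "R = R0 + norm e"
  have q_bound: "norm (q n x) \<le> B * indicator (cball 0 R) x" for n x
  proof (cases "x \<in> cball 0 R")
    case True
    obtain z where "\<psi> (x + (1 / real (Suc n)) *\<^sub>R e) - \<psi> (x + 0 *\<^sub>R e) = (1 / real (Suc n) - 0) * D (x + z *\<^sub>R e) e"
      using MVT2[of 0 "1 / real (Suc n)" "\<lambda>t. \<psi> (x + t *\<^sub>R e)" "\<lambda>t. D (x + t *\<^sub>R e) e"] line by auto
    then have "q n x = D (x + z *\<^sub>R e) e"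
      by (simp add: q_def)
    then show ?thesis using True B by simp
  next
    case False
    then have "x \<notin> cbox a b"
      using R0[of x] norm_ge_zero[of e] by (auto simp: R_def)
    moreover have "x + (1 / real (Suc n)) *\<^sub>R e \<notin> cbox a b"
    proof
      assume "x + (1 / real (Suc n)) *\<^sub>R e \<in> cbox a b"
      then have "norm (x + (1 / real (Suc n)) *\<^sub>R e) \<le> R0" by (rule R0)
      moreover have "norm ((1 / real (Suc n)) *\<^sub>R e) \<le> norm e"
        by (simp add: field_simps)
      moreover have "norm x \<le> norm (x + (1 / real (Suc n)) *\<^sub>R e) + norm ((1 / real (Suc n)) *\<^sub>R e)"
        using norm_triangle_ineq4[of "x + (1 / real (Suc n)) *\<^sub>R e" "(1 / real (Suc n)) *\<^sub>R e"]
        by (simp add: algebra_simps)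
      ultimately show False using False by (auto simp: R_def)
    qed
    ultimately show ?thesis using False supp(1) by (simp add: q_def)
  qed
  have cont_psi: "continuous_on UNIV \<psi>"
    by (intro continuous_at_imp_continuous_on ballI has_derivative_continuous[OF der])
  then have [measurable]: "\<psi> \<in> borel_measurable borel"
    by (rule borel_measurable_continuous_onI)
  have dm [measurable]: "(\<lambda>x. D x e) \<in> borel_measurable borel"
    by (rule borel_measurable_continuous_onI[OF cont])
  have int_cball: "integrable lborel (\<lambda>x. C * indicator (cball 0 r) x)" for C r :: real
    by (intro integrable_mult_right integrable_real_indicator) (use emeasure_bounded_finite[OF bounded_cball, of 0 r] in auto)
  have "(\<lambda>n. \<integral>x. q n x \<partial>lborel) \<longlonglongrightarrow> (\<integral>x. D x e \<partial>lborel)"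
  proof (rule integral_dominated_convergence[OF _ _ int_cball[of B R]])
    show "AE x in lborel. (\<lambda>n. q n x) \<longlonglongrightarrow> D x e"
    proof (rule AE_I2)
      fix x
      have "((\<lambda>h. (\<psi> (x + h *\<^sub>R e) - \<psi> x) / h) \<longlongrightarrow> D x e) (at 0)"
        using line[of x 0] by (simp add: DERIV_def)
      moreover have "filterlim (\<lambda>n. 1 / real (Suc n)) (at 0) sequentially"
        unfolding filterlim_at using LIMSEQ_inverse_real_of_nat by (simp add: inverse_eq_divide)
      ultimately have "(\<lambda>n. (\<psi> (x + (1 / real (Suc n)) *\<^sub>R e) - \<psi> x) / (1 / real (Suc n))) \<longlonglongrightarrow> D x e"
        by (rule filterlim_compose)
      then show "(\<lambda>n. q n x) \<longlonglongrightarrow> D x e"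
        by (simp add: q_def mult.commute)
    qed
    show "q n \<in> borel_measurable lborel" for n
      unfolding q_def by measurable
    show "(\<lambda>x. D x e) \<in> borel_measurable lborel" using dm by simp
    show "AE x in lborel. norm (q n x) \<le> B * indicator (cball 0 R) x" for n
      using q_bound by simp
  qed
  moreover have "(\<integral>x. q n x \<partial>lborel) = 0" for n
  proof -
    have psi_int: "integrable lborel \<psi>"
      by (rule integrable_lborel_if_zero_off_cbox[OF cont_psi supp(1)])
    let ?c = "(1 / real (Suc n)) *\<^sub>R e"
    have d: "distr lborel borel ((+) ?c) = lborel"
      by (rule lborel_distr_plus)
    have "integrable (distr lborel borel ((+) ?c)) \<psi>"
      unfolding d by (rule psi_int)
    then have i: "integrable lborel (\<lambda>x. \<psi> (x + ?c))"
      by (subst (asm) integrable_distr_eq) (auto simp: add.commute)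
    have "(\<integral>x. \<psi> x \<partial>lborel) = (\<integral>x. \<psi> x \<partial>distr lborel borel ((+) ?c))"
      unfolding d ..
    also have "\<dots> = (\<integral>x. \<psi> (x + ?c) \<partial>lborel)"
      by (subst integral_distr) (auto simp: add.commute)
    finally show ?thesis
      using i psi_int unfolding q_def by simp
  qed
  ultimately show ?thesis
    using LIMSEQ_unique[of "\<lambda>n. 0" "\<integral>x. D x e \<partial>lborel" 0] by simp
qed

text \<open>
  By Lebesgue differentiation, almost every value of \<open>g\<close> is a limit of averages over small cubes.
\<close>

lemma AE_eq_0_if_box_integrals_eq_0:
  fixes g :: "'a::euclidean_space \<Rightarrow> real"
  assumes "open U" "integrable lebesgue g"
    and box: "\<And>a b. cbox a b \<subseteq> U \<Longrightarrow> (\<integral>x. indicator (box a b) x * g x \<partial>lebesgue) = 0"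
  shows "AE x in lebesgue. x \<in> U \<longrightarrow> g x = 0"
proof -
  have gi: "g integrable_on UNIV"
    by (rule integrable_on_lebesgue[OF assms(2)])
  have zero: "integral (cbox a b) g = 0" if "cbox a b \<subseteq> U" for a b
  proof -
    have "integrable lebesgue (\<lambda>x. indicator (box a b) x *\<^sub>R g x)"
      by (rule integrable_mult_indicator[OF _ assms(2)]) simp
    then have "integrable (lebesgue_on (box a b)) g"
      by (subst integrable_restrict_space) auto
    then have "integral (box a b) g = integral\<^sup>L (lebesgue_on (box a b)) g"
      by (subst lebesgue_integral_eq_integral) auto
    also have "\<dots> = 0"
      using box[OF that] by (subst integral_restrict_space) auto
    finally show ?thesis
      by (simp add: integral_open_interval)
  qed
  obtain N where N: "negligible N"
    "\<And>x e. \<lbrakk>x \<notin> N; 0 < e\<rbrakk> \<Longrightarrow> \<exists>d>0. \<forall>h. 0 < h \<and> h < d \<longrightarrow>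
        norm (integral (cbox x (x + h *\<^sub>R One)) g /\<^sub>R h ^ DIM('a) - g x) < e"
    using integrable_ccontinuous_explicit[of g] gi integrable_on_subcbox[OF gi] by blast
  have "g x = 0" if x: "x \<in> U" "x \<notin> N" for x
  proof (rule ccontr)
    assume "g x \<noteq> 0"
    then obtain d where d: "d > 0" "\<And>h. 0 < h \<Longrightarrow> h < d \<Longrightarrow>
        norm (integral (cbox x (x + h *\<^sub>R One)) g /\<^sub>R h ^ DIM('a) - g x) < norm (g x)"
      using N(2)[OF x(2), of "norm (g x)"] by auto
    obtain r where r: "r > 0" "ball x r \<subseteq> U"
      using \<open>open U\<close> x(1) open_contains_ball by blast
    define K where "K = norm (One :: 'a) + 1"
    define h where "h = min (d / 2) (r / (2 * K))"
    have K: "K > 0" by (simp add: K_def add_nonneg_pos)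
    have h: "0 < h" "h < d" "h * K < r"
    proof -
      show "0 < h" "h < d" using d(1) r(1) K by (auto simp: h_def)
      have "h * K \<le> r / (2 * K) * K"
        using K by (intro mult_right_mono) (auto simp: h_def)
      also have "\<dots> < r" using K r by (simp add: field_simps)
      finally show "h * K < r" .
    qed
    have "cbox x (x + h *\<^sub>R One) \<subseteq> ball x r"
    proof
      fix y assume y: "y \<in> cbox x (x + h *\<^sub>R One)"
      have "norm (y - x) \<le> norm (h *\<^sub>R One :: 'a)"
        by (rule norm_le_componentwise)
          (use y h in \<open>auto simp: mem_box inner_diff_left inner_add_left algebra_simps\<close>)
      also have "\<dots> \<le> h * K"
        using h by (simp add: K_def mult_left_mono)
      finally show "y \<in> ball x r"
        using h by (simp add: dist_norm norm_minus_commute)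
    qed
    then have "integral (cbox x (x + h *\<^sub>R One)) g = 0"
      using r by (intro zero) auto
    with d(2)[OF h(1,2)] show False by simp
  qed
  then have "{x. \<not> (x \<in> U \<longrightarrow> g x = 0)} \<subseteq> N"
    by auto
  moreover have "N \<in> null_sets lebesgue"
    using N(1) by (simp add: negligible_iff_null_sets)
  ultimately show ?thesis
    by (intro AE_I'[of N]) auto
qed

lemma has_derivative_row:
  fixes A :: "real^'n^'m"
  shows "((\<lambda>x. (A *v x + c) $ i) has_derivative (\<lambda>h. (A *v h) $ i)) F"
  by (auto intro!: derivative_eq_intros bounded_linear.has_derivative[OF bounded_linear_vec_nth]
    bounded_linear.has_derivative[OF matrix_vector_mul_bounded_linear] simp: vector_add_component)

text \<open>
  Integration by parts against a box bump: the product of the affine component and the bump has compact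
  support, so the integral of its partial derivative is zero.
\<close>

lemma integral_affine_mult_partial_deriv:
  fixes A :: "real^'n^'m" and a b :: "real^'n" and m :: nat
  defines "\<phi> \<equiv> box_bump m a b"
  shows "(\<integral>x. (A *v x + c) $ i * partial_deriv j \<phi> x \<partial>lebesgue) = - (A $ i $ j * (\<integral>x. \<phi> x \<partial>lebesgue))"
    and "integrable lebesgue \<phi>" and "x \<notin> box a b \<Longrightarrow> partial_deriv j \<phi> x = 0"
    and "continuous_on UNIV (partial_deriv j \<phi>)" "continuous_on UNIV \<phi>"
proof -
  have alg: "\<phi> \<in> bump_algebra"
    by (simp add: \<phi>_def box_bump_in_algebra)
  then have palg: "partial_deriv j \<phi> \<in> bump_algebra" for j
    by (rule bump_algebra_partial_deriv)
  note cont = bump_algebra_continuous[OF alg] bump_algebra_continuous[OF palg]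
  then show "continuous_on UNIV (partial_deriv j \<phi>)" "continuous_on UNIV \<phi>" by auto
  have zero: "\<phi> x = 0" if "x \<notin> box a b" for x
    using that box_bump_nonzero_iff by (auto simp: \<phi>_def)
  show pzero: "partial_deriv j \<phi> x = 0" if "x \<notin> box a b" for x j
  proof -
    \<comment> \<open>The nonnegative function attains its minimum at all its zeros.\<close>
    let ?D = "\<lambda>h. \<Sum>i\<in>UNIV. h $ i * partial_deriv i \<phi> x"
    have "?D = (\<lambda>v. 0)"
      by (rule differential_zero_maxmin[of x UNIV \<phi>, OF _ _ bump_algebra_partial_deriv(3)[OF alg]])
        (use zero[OF that] box_bump_bounds in \<open>auto simp: \<phi>_def\<close>)
    then have "?D (axis j 1) = 0" by metis
    then show ?thesis
      by (simp add: axis_def if_distrib[of "\<lambda>r. r * _"] cong: if_cong)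
  qed
  have int: "integrable lborel h" if "continuous_on UNIV h" "\<And>x. x \<notin> box a b \<Longrightarrow> h x = 0" for h :: "real^'n \<Rightarrow> real"
    using that box_subset_cbox[of a b] by (intro integrable_lborel_if_zero_off_cbox[of h a b]) auto
  have contA: "continuous_on UNIV (\<lambda>x. (A *v x + c) $ i)"
    by (intro continuous_at_imp_continuous_on ballI has_derivative_continuous[OF has_derivative_row])
  let ?l = "\<lambda>x. (A *v x + c) $ i * partial_deriv j \<phi> x" and ?r = "\<lambda>x. A $ i $ j * \<phi> x"
  have cl: "continuous_on UNIV ?l" and cr: "continuous_on UNIV ?r"
    by (intro continuous_intros contA cont)+
  have il: "integrable lborel ?l" and ir: "integrable lborel ?r" and ip: "integrable lborel \<phi>"
    by (rule int[OF cl] int[OF cr] int[OF cont(1)]; simp add: zero pzero)+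
  show "integrable lebesgue \<phi>"
    using ip integrable_completion[of \<phi> lborel] by (simp add: borel_measurable_continuous_onI cont)
  have "(\<integral>x. ?l x + ?r x \<partial>lborel) = 0"
  proof -
    let ?D = "\<lambda>x h. (A *v x + c) $ i * (\<Sum>i\<in>UNIV. h $ i * partial_deriv i \<phi> x) + (A *v h) $ i * \<phi> x"
    have D: "?D x (axis j 1) = ?l x + ?r x" for x
      by (simp add: axis_def if_distrib[of "\<lambda>r. r * _"] if_distrib[of "\<lambda>r. _ * r"]
        matrix_vector_mult_def cong: if_cong)
    have "(\<integral>x. ?D x (axis j 1) \<partial>lborel) = 0"
    proof (rule integral_directional_derivative_eq_0)
      show "((\<lambda>x. (A *v x + c) $ i * \<phi> x) has_derivative ?D x) (at x)" for x
        by (rule has_derivative_mult[OF has_derivative_row bump_algebra_partial_deriv(3)[OF alg]])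
      show "continuous_on UNIV (\<lambda>x. ?D x (axis j 1))"
        unfolding D by (intro continuous_intros cl cr)
      show "(A *v x + c) $ i * \<phi> x = 0" if "x \<notin> cbox a b" for x
        using that zero[of x] box_subset_cbox[of a b] by auto
      show "?D x (axis j 1) = 0" if "x \<notin> cbox a b" for x
      proof -
        have "x \<notin> box a b" using that box_subset_cbox by blast
        then show ?thesis unfolding D by (simp add: zero pzero)
      qed
    qed
    then show ?thesis unfolding D .
  qed
  then have "(\<integral>x. ?l x \<partial>lborel) = - (A $ i $ j * (\<integral>x. \<phi> x \<partial>lborel))"
    using il ir by simp
  then show "(\<integral>x. ?l x \<partial>lebesgue) = - (A $ i $ j * (\<integral>x. \<phi> x \<partial>lebesgue))"
    using integral_completion[of ?l lborel] integral_completion[of \<phi> lborel]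
      cl[THEN borel_measurable_continuous_onI] cont(1)[THEN borel_measurable_continuous_onI]
    by simp
qed

lemma borel_measurable_lebesgue_if_continuous:
  "continuous_on UNIV f \<Longrightarrow> f \<in> borel_measurable lebesgue"
  by (intro measurable_completion) (simp add: borel_measurable_continuous_onI)

lemma borel_measurable_vec_nth: "(\<lambda>x :: real^'n. x $ i) \<in> borel_measurable borel"
  by (intro borel_measurable_continuous_onI linear_continuous_on bounded_linear_vec_nth)

text \<open>
  Testing with box bumps and passing to the limit shows that \<open>G - A\<close> has integral zero over each box in \<open>U\<close>;
  this is the fundamental lemma of the calculus of variations with boxes in place of general test functions.
\<close>

lemma weak_grad_eq_AE_of_affine:
  fixes A :: "real^'n^'n"
  assumes grad: "is_weak_grad \<Omega> v G"
    and \<Omega>: "open \<Omega>" and U: "open U" "bounded U" "U \<subseteq> \<Omega>"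
    and affine: "AE x in lebesgue. x \<in> U \<longrightarrow> v x = A *v x + c"
    and int: "\<And>i j. integrable (lebesgue_on \<Omega>) (\<lambda>x. G x $ i $ j)"
    and vm: "v \<in> borel_measurable (lebesgue_on \<Omega>)"
  shows "AE x in lebesgue. x \<in> U \<longrightarrow> G x = A"
proof -
  have sets [measurable]: "\<Omega> \<in> sets lebesgue" "U \<in> sets lebesgue"
    using \<Omega> U by auto
  have intG: "integrable lebesgue (\<lambda>x. indicator \<Omega> x * G x $ i $ j)" for i j
    using int[of i j] by (subst (asm) integrable_restrict_space) auto
  have key: "(\<integral>x. indicator (box a b) x * (indicator \<Omega> x * G x $ i $ j) \<partial>lebesgue)
      = A $ i $ j * (\<integral>x. indicator (box a b) x \<partial>lebesgue)"
    if ab: "cbox a b \<subseteq> U" for a b i j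
  proof -
    have eq: "(\<integral>x. box_bump m a b x * (indicator \<Omega> x * G x $ i $ j) \<partial>lebesgue)
        = A $ i $ j * (\<integral>x. box_bump m a b x \<partial>lebesgue)" for m
    proof -
      let ?\<phi> = "box_bump m a b"
      note aff = integral_affine_mult_partial_deriv[where m = m and a = a and b = b]
      have zero: "?\<phi> x = 0" "partial_deriv j ?\<phi> x = 0" if "x \<notin> U" for x
        using aff(3)[of x j] box_bump_nonzero_iff[of m a b x] ab that box_subset_cbox[of a b] by auto
      have bm: "partial_deriv j ?\<phi> \<in> borel_measurable lebesgue" "?\<phi> \<in> borel_measurable lebesgue"
        by (rule aff(4,5)[THEN borel_measurable_lebesgue_if_continuous])+
      have ivm: "(\<lambda>x. indicator \<Omega> x *\<^sub>R v x) \<in> borel_measurable lebesgue"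
        using vm by (subst (asm) borel_measurable_restrict_space_iff) auto
      have m1: "(\<lambda>x. indicator \<Omega> x * (v x $ i * partial_deriv j ?\<phi> x)) \<in> borel_measurable lebesgue"
      proof -
        have "(\<lambda>x. (indicator \<Omega> x *\<^sub>R v x) $ i * partial_deriv j ?\<phi> x) \<in> borel_measurable lebesgue"
          by (intro borel_measurable_times bm measurable_compose[OF ivm borel_measurable_vec_nth])
        then show ?thesis by (simp add: mult.assoc)
      qed
      have m2: "(\<lambda>x. (A *v x + c) $ i) \<in> borel_measurable lebesgue"
        by (intro borel_measurable_lebesgue_if_continuous continuous_at_imp_continuous_on ballI
          has_derivative_continuous[OF has_derivative_row])
      have "- (A $ i $ j * (\<integral>x. ?\<phi> x \<partial>lebesgue)) = (\<integral>x. (A *v x + c) $ i * partial_deriv j ?\<phi> x \<partial>lebesgue)"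
        by (rule aff(1)[symmetric])
      also have "\<dots> = (\<integral>x. indicator \<Omega> x *\<^sub>R (v x $ i * partial_deriv j ?\<phi> x) \<partial>lebesgue)"
      proof (rule integral_cong_AE)
        show "AE x in lebesgue. (A *v x + c) $ i * partial_deriv j ?\<phi> x
            = indicator \<Omega> x *\<^sub>R (v x $ i * partial_deriv j ?\<phi> x)"
          using affine
        proof eventually_elim
          case (elim x)
          then show ?case
            using zero(2)[of x] U(3) by (cases "x \<in> U") auto
        qed
      qed (use m1 m2 bm in auto)
      also have "\<dots> = (\<integral>x. v x $ i * partial_deriv j ?\<phi> x \<partial>lebesgue_on \<Omega>)"
        by (subst integral_restrict_space) auto
      also have "\<dots> = - (\<integral>x. G x $ i $ j * ?\<phi> x \<partial>lebesgue_on \<Omega>)"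
        using grad box_bump_test_function[of a b \<Omega> m] ab U(3) unfolding is_weak_grad_def by blast
      also have "(\<integral>x. G x $ i $ j * ?\<phi> x \<partial>lebesgue_on \<Omega>)
          = (\<integral>x. ?\<phi> x * (indicator \<Omega> x * G x $ i $ j) \<partial>lebesgue)"
        by (subst integral_restrict_space) (auto simp: ac_simps)
      finally show ?thesis by simp
    qed
    have lim: "(\<lambda>m. \<integral>x. box_bump m a b x * h x \<partial>lebesgue) \<longlonglongrightarrow> (\<integral>x. indicator (box a b) x * h x \<partial>lebesgue)"
      if h: "integrable lebesgue h" for h :: "real^'n \<Rightarrow> real"
    proof (rule integral_dominated_convergence[where w = "\<lambda>x. norm (h x)"])
      have "box_bump m a b \<in> borel_measurable lebesgue" for m
        by (rule integral_affine_mult_partial_deriv(5)[THEN borel_measurable_lebesgue_if_continuous])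
      then show "(\<lambda>x. indicator (box a b) x * h x) \<in> borel_measurable lebesgue"
        "(\<lambda>x. box_bump m a b x * h x) \<in> borel_measurable lebesgue" for m
        using h by (auto intro!: borel_measurable_times borel_measurable_indicator)
      show "integrable lebesgue (\<lambda>x. norm (h x))" using h by simp
      show "AE x in lebesgue. (\<lambda>m. box_bump m a b x * h x) \<longlonglongrightarrow> indicator (box a b) x * h x"
        by (intro AE_I2 tendsto_intros box_bump_tendsto)
      show "AE x in lebesgue. norm (box_bump m a b x * h x) \<le> norm (h x)" for m
        using box_bump_bounds[of m a b] by (intro AE_I2) (simp add: abs_mult mult_left_le_one_le)
    qed
    have "(\<lambda>m. \<integral>x. box_bump m a b x * (indicator \<Omega> x * G x $ i $ j) \<partial>lebesgue)
        \<longlonglongrightarrow> A $ i $ j * (\<integral>x. indicator (box a b) x \<partial>lebesgue)"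
    proof -
      have ib: "integrable lebesgue (indicator (cbox a b) :: _ \<Rightarrow> real)"
        by (intro integrable_real_indicator) (use emeasure_bounded_finite[of "cbox a b"] emeasure_bounded_finite[of "box a b"] in auto)
      have ob: "indicator (box a b) x * indicator (cbox a b) x = (indicator (box a b) x :: real)"
        "box_bump m a b x * indicator (cbox a b) x = box_bump m a b x" for x m
        using box_subset_cbox[of a b] box_bump_nonzero_iff[of m a b x] by (auto simp: indicator_def)
      show ?thesis
        unfolding eq using lim[OF ib] unfolding ob by (intro tendsto_intros)
    qed
    with lim[OF intG[of i j]] show ?thesis
      by (rule LIMSEQ_unique)
  qed
  have comp: "AE x in lebesgue. x \<in> U \<longrightarrow> G x $ i $ j = A $ i $ j" for i j
  proof -
    define g where "g x = indicator U x * (G x $ i $ j) - A $ i $ j * indicator U x" for x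
    have U_fin: "emeasure lebesgue U < \<infinity>"
      using emeasure_bounded_finite[OF U(2)] U(1) by (simp add: emeasure_completion)
    have gG: "integrable lebesgue (\<lambda>x. indicator U x * (G x $ i $ j))"
    proof -
      have "integrable lebesgue (\<lambda>x. indicator U x *\<^sub>R (indicator \<Omega> x * G x $ i $ j))"
        by (rule integrable_mult_indicator[OF sets(2) intG])
      also have "(\<lambda>x. indicator U x *\<^sub>R (indicator \<Omega> x * G x $ i $ j)) = (\<lambda>x. indicator U x * (G x $ i $ j))"
        using U(3) by (auto simp: indicator_def fun_eq_iff)
      finally show ?thesis .
    qed
    have iU: "integrable lebesgue (\<lambda>x. A $ i $ j * indicator U x)"
      using U_fin by (intro integrable_mult_right integrable_real_indicator) auto
    have gi: "integrable lebesgue g"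
      unfolding g_def by (rule Bochner_Integration.integrable_diff[OF gG iU])
    have "AE x in lebesgue. x \<in> U \<longrightarrow> g x = 0"
    proof (rule AE_eq_0_if_box_integrals_eq_0[OF U(1) gi])
      fix a b assume ab: "cbox a b \<subseteq> U"
      have "indicator (box a b) x * g x
          = indicator (box a b) x * (indicator \<Omega> x * G x $ i $ j) - A $ i $ j * indicator (box a b) x" for x
        using ab U(3) box_subset_cbox[of a b] by (auto simp: g_def indicator_def)
      moreover have "integrable lebesgue (\<lambda>x. indicator (box a b) x *\<^sub>R (indicator \<Omega> x * G x $ i $ j))"
        by (rule integrable_mult_indicator[OF _ intG]) simp
      moreover have "integrable lebesgue (\<lambda>x. A $ i $ j * indicator (box a b) x)"
        by (intro integrable_mult_right integrable_real_indicator) (use emeasure_bounded_finite[of "cbox a b"] emeasure_bounded_finite[of "box a b"] in auto)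
      ultimately show "(\<integral>x. indicator (box a b) x * g x \<partial>lebesgue) = 0"
        using key[OF ab, of i j] by simp
    qed
    then show ?thesis
      by eventually_elim (auto simp: g_def)
  qed
  have "AE x in lebesgue. \<forall>i j. x \<in> U \<longrightarrow> G x $ i $ j = A $ i $ j"
    unfolding AE_all_countable using comp by blast
  then show ?thesis
    by eventually_elim (auto simp: vec_eq_iff)
qed

section \<open>Facets of simplices\<close>

definition full_simplex :: "'a::euclidean_space set \<Rightarrow> bool" where
  "full_simplex T \<longleftrightarrow> int DIM('a) simplex T"

definition normal_to :: "'a::euclidean_space \<Rightarrow> 'a set \<Rightarrow> bool" where
  "normal_to n E \<longleftrightarrow> norm n = 1 \<and> (\<forall>x \<in> E. \<forall>y \<in> E. (x - y) \<bullet> n = 0)"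

text \<open>
  The condition on the side of \<open>E\<close> by which \<^const>\<open>elt_towards\<close> selects an element.
\<close>

definition towards :: "'a::euclidean_space set \<Rightarrow> 'a set \<Rightarrow> 'a \<Rightarrow> bool" where
  "towards T E n \<longleftrightarrow> (\<forall>x \<in> T. \<forall>y \<in> E. 0 \<le> (x - y) \<bullet> n)"

lemma normal_to_minus: "normal_to n E \<Longrightarrow> normal_to (- n) E"
  by (simp add: normal_to_def)

lemma full_simplex_basics:
  fixes T :: "'a::euclidean_space set"
  assumes "full_simplex T"
  shows "convex T" "compact T" "T \<noteq> {}" "aff_dim T = int DIM('a)" "interior T \<noteq> {}"
proof -
  obtain S where S: "\<not> affine_dependent S" "int (card S) = int DIM('a) + 1" "T = convex hull S"
    using assms by (auto simp: full_simplex_def simplex_def)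
  have "finite S" using S(1) aff_independent_finite by blast
  then show "convex T" "compact T" "T \<noteq> {}"
    using S by (auto intro: compact_convex_hull finite_imp_compact)
  show d: "aff_dim T = int DIM('a)"
    using S by (simp add: aff_dim_convex_hull aff_dim_affine_independent)
  show "interior T \<noteq> {}"
    using interior_rel_interior_gen[of T] rel_interior_eq_empty[OF \<open>convex T\<close>] \<open>T \<noteq> {}\<close> d by simp
qed

lemma facet_aff_dim:
  assumes "full_simplex T" "E facet_of T"
  shows "aff_dim (E :: 'a::euclidean_space set) = int DIM('a) - 1" "convex E" "compact E" "E \<noteq> {}" "E \<subseteq> T"
    "E face_of T"
  using assms full_simplex_basics[OF assms(1)]
  by (auto simp: facet_of_def dest: face_of_imp_subset face_of_imp_convex intro: face_of_imp_compact)

text \<open>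
  The remaining vertex is not in the hyperplane of the facet, since otherwise the simplex would be
  contained in that hyperplane.
\<close>

lemma facet_apex:
  fixes T :: "'a::euclidean_space set"
  assumes T: "full_simplex T" and E: "E facet_of T" and n: "normal_to n E"
  obtains a where "a \<in> T" "T = convex hull (insert a E)" "\<And>y. y \<in> E \<Longrightarrow> (a - y) \<bullet> n \<noteq> 0"
proof -
  obtain S where S: "\<not> affine_dependent S" "int (card S) = int DIM('a) + 1" "T = convex hull S"
    using assms by (auto simp: full_simplex_def simplex_def)
  obtain a where a: "a \<in> S" "E = convex hull (S - {a})"
    using E unfolding S(3) facet_of_convex_hull_affine_independent[OF S(1)] by blast
  have TE: "T = convex hull (insert a E)"
  proof -
    have "convex hull (insert a E) = convex hull (insert a (S - {a}))"
      unfolding a(2) by (metis hull_insert)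
    then show ?thesis using a(1) by (simp add: S(3) insert_absorb)
  qed
  show ?thesis
  proof
    show "a \<in> T" using a S by (simp add: hull_inc)
    show "T = convex hull (insert a E)" by (rule TE)
    fix y assume y: "y \<in> E"
    show "(a - y) \<bullet> n \<noteq> 0"
    proof
      assume 0: "(a - y) \<bullet> n = 0"
      have "n \<bullet> z = n \<bullet> y" if "z \<in> insert a E" for z
      proof -
        have "(z - y) \<bullet> n = 0"
          using n y 0 that unfolding normal_to_def by blast
        then show ?thesis
          by (simp add: inner_diff_left inner_commute[of n])
      qed
      then have "insert a E \<subseteq> {x. n \<bullet> x = n \<bullet> y}"
        by blast
      then have "T \<subseteq> {x. n \<bullet> x = n \<bullet> y}"
        unfolding TE by (intro hull_minimal convex_hyperplane)
      then have "aff_dim T \<le> aff_dim {x. n \<bullet> x = n \<bullet> y}"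
        by (rule aff_dim_subset)
      also have "\<dots> = int DIM('a) - 1"
        using n by (subst aff_dim_hyperplane) (auto simp: normal_to_def of_nat_diff Suc_leI)
      finally show False
        using full_simplex_basics(4)[OF T] by simp
    qed
  qed
qed

text \<open>
  A simplex is the cone over a facet. The distance to the hyperplane of the facet is proportional to
  the weight of the apex.
\<close>

lemma facet_cone_coordinates:
  fixes T :: "'a::euclidean_space set"
  assumes TE: "T = convex hull (insert a E)" and E: "convex E" "E \<noteq> {}" and n: "normal_to n E"
    and x: "x \<in> T"
  obtains u b where "0 \<le> u" "u \<le> 1" "b \<in> E" "x = u *\<^sub>R a + (1 - u) *\<^sub>R b"
    "\<And>y. y \<in> E \<Longrightarrow> (x - y) \<bullet> n = u * ((a - y) \<bullet> n)"
proof -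
  obtain u v b where uv: "0 \<le> u" "0 \<le> v" "u + v = 1" "b \<in> E" "x = u *\<^sub>R a + v *\<^sub>R b"
    using x unfolding TE convex_hull_insert[OF E(2)] convex_hull_eq[THEN iffD2, OF E(1)] by blast
  have v: "v = 1 - u" using uv(3) by simp
  have level: "(x - y) \<bullet> n = u * ((a - y) \<bullet> n)" if "y \<in> E" for y
  proof -
    have "x - y = u *\<^sub>R (a - y) + (1 - u) *\<^sub>R (b - y)"
      unfolding uv(5) v by (simp add: algebra_simps)
    moreover have "(b - y) \<bullet> n = 0"
      using n uv(4) that by (simp add: normal_to_def)
    ultimately show ?thesis by (simp add: inner_add_left)
  qed
  then show ?thesis
    using that[of u b, OF _ _ uv(4) _ level] uv(1,2,5) v by simp
qed

lemma facet_towards_apex: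
  fixes T :: "'a::euclidean_space set"
  assumes T: "full_simplex T" "E facet_of T" and n: "normal_to n E"
    and a: "a \<in> T" "T = convex hull (insert a E)" and y: "y \<in> E"
  shows "towards T E n \<longleftrightarrow> 0 \<le> (a - y) \<bullet> n"
proof
  assume "towards T E n" then show "0 \<le> (a - y) \<bullet> n"
    using a y by (auto simp: towards_def)
next
  assume 0: "0 \<le> (a - y) \<bullet> n"
  note E = facet_aff_dim[OF T]
  show "towards T E n"
    unfolding towards_def
  proof (intro ballI)
    fix x z assume x: "x \<in> T" and z: "z \<in> E"
    obtain u b where u: "0 \<le> u" "u \<le> 1" "b \<in> E" "x = u *\<^sub>R a + (1 - u) *\<^sub>R b"
      "\<And>y. y \<in> E \<Longrightarrow> (x - y) \<bullet> n = u * ((a - y) \<bullet> n)"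
      using facet_cone_coordinates[OF a(2) E(2,4) n x] by blast
    have "(x - z) \<bullet> n = (x - y) \<bullet> n"
    proof -
      have "(y - z) \<bullet> n = 0" using n y z by (simp add: normal_to_def)
      then show ?thesis by (simp add: inner_diff_left)
    qed
    then show "0 \<le> (x - z) \<bullet> n"
      using u(1) u(5)[OF y] 0 by simp
  qed
qed

lemma towards_or:
  fixes T :: "'a::euclidean_space set"
  assumes "full_simplex T" "E facet_of T" "normal_to n E"
  shows "towards T E n \<noteq> towards T E (- n)"
proof -
  obtain a where a: "a \<in> T" "T = convex hull (insert a E)" "\<And>y. y \<in> E \<Longrightarrow> (a - y) \<bullet> n \<noteq> 0"
    using facet_apex[OF assms] by blast
  obtain y where y: "y \<in> E" using facet_aff_dim[OF assms(1,2)] by blast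
  show ?thesis
    unfolding facet_towards_apex[OF assms a(1,2) y]
      facet_towards_apex[OF assms(1,2) normal_to_minus[OF assms(3)] a(1,2) y]
    using a(3)[OF y] by auto
qed

lemma facet_rel_interior_tangent:
  fixes T :: "'a::euclidean_space set"
  assumes T: "full_simplex T" "E facet_of T" and n: "normal_to n E"
    and x: "x \<in> rel_interior E"
  obtains r where "r > 0" "\<And>w. w \<bullet> n = 0 \<Longrightarrow> norm w \<le> r \<Longrightarrow> x + w \<in> E"
proof -
  note E = facet_aff_dim[OF T]
  have xE: "x \<in> E" using x rel_interior_subset by blast
  let ?H = "{z. n \<bullet> z = n \<bullet> x}"
  have "n \<bullet> z = n \<bullet> x" if "z \<in> E" for z
  proof -
    have "(z - x) \<bullet> n = 0"
      using n xE that unfolding normal_to_def by blast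
    then show ?thesis
      by (simp add: inner_diff_left inner_commute[of n])
  qed
  then have "E \<subseteq> ?H"
    by blast
  moreover have "aff_dim ?H = int DIM('a) - 1"
    using n by (subst aff_dim_hyperplane) (auto simp: normal_to_def of_nat_diff Suc_leI)
  ultimately have "affine hull E = affine hull ?H"
    using aff_dim_eq_full_gen[of E ?H] E(1) by simp
  also have "\<dots> = ?H" by (simp add: affine_hull_eq affine_hyperplane)
  finally have aff: "affine hull E = ?H" .
  obtain r where r: "r > 0" "cball x r \<inter> affine hull E \<subseteq> E"
    using x by (auto simp: mem_rel_interior_cball)
  show ?thesis
  proof (rule that[OF r(1)])
    fix w assume "w \<bullet> n = 0" "norm w \<le> r"
    then have "x + w \<in> cball x r \<inter> affine hull E"
      unfolding aff by (auto simp: dist_norm inner_add_left inner_commute[of n])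
    then show "x + w \<in> E" using r by blast
  qed
qed

text \<open>
  From a relative interior point of a facet, one can move a little in each direction that does not point
  away from the simplex: split the direction into a multiple of the direction to the apex and a part
  tangential to the facet.
\<close>

lemma facet_rel_interior_inward:
  fixes T :: "'a::euclidean_space set"
  assumes T: "full_simplex T" "E facet_of T" and n: "normal_to n E"
    and tw: "towards T E n" and x: "x \<in> rel_interior E" and w: "0 \<le> w \<bullet> n"
  obtains \<delta> where "\<delta> > 0" "\<And>t. 0 \<le> t \<Longrightarrow> t \<le> \<delta> \<Longrightarrow> x + t *\<^sub>R w \<in> T"
proof -
  note E = facet_aff_dim[OF T]
  have xE: "x \<in> E" using x rel_interior_subset by blast
  obtain a where a: "a \<in> T" "T = convex hull (insert a E)" "\<And>y. y \<in> E \<Longrightarrow> (a - y) \<bullet> n \<noteq> 0"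
    using facet_apex[OF T n] by blast
  have pos: "(a - x) \<bullet> n > 0"
    using tw a xE by (force simp: towards_def order_le_less)
  define c where "c = (w \<bullet> n) / ((a - x) \<bullet> n)"
  define u where "u = w - c *\<^sub>R (a - x)"
  have c: "c \<ge> 0" using pos w by (simp add: c_def)
  have un: "u \<bullet> n = 0"
    using pos by (simp add: u_def c_def inner_diff_left[of w])
  obtain r where r: "r > 0" "\<And>w. w \<bullet> n = 0 \<Longrightarrow> norm w \<le> r \<Longrightarrow> x + w \<in> E"
    using facet_rel_interior_tangent[OF T n x] by blast
  \<comment> \<open>The first bound keeps the weight of the apex below 1/2, the second one keeps the tangential shift below \<open>r\<close>.\<close>
  define \<delta> where "\<delta> = min (1 / (2 * (c + 1))) (r / (2 * (norm u + 1)))"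
  show ?thesis
  proof
    show "\<delta> > 0" using c r(1) norm_ge_zero[of u] by (simp add: \<delta>_def add_nonneg_pos)
    fix t assume t: "0 \<le> t" "t \<le> \<delta>"
    have tc: "t * c \<le> 1 / 2"
    proof -
      have "t * c \<le> 1 / (2 * (c + 1)) * c"
        using t c by (intro mult_right_mono) (auto simp: \<delta>_def)
      also have "\<dots> \<le> 1 / 2" using c by (simp add: field_simps)
      finally show ?thesis .
    qed
    have tu: "2 * t * norm u \<le> r"
    proof -
      have "2 * t * norm u \<le> 2 * (r / (2 * (norm u + 1))) * norm u"
        using t by (intro mult_right_mono) (auto simp: \<delta>_def)
      also have "\<dots> \<le> r" using r(1) norm_ge_zero[of u] by (simp add: field_simps add_pos_nonneg)
      finally show ?thesis .
    qed
    define s where "s = t / (1 - t * c)"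
    have s: "0 \<le> s" "s \<le> 2 * t" "(1 - t * c) * s = t"
      using tc t mult_left_mono[OF tc t(1)] by (auto simp: s_def field_simps)
    have "x + s *\<^sub>R u \<in> E"
    proof (rule r(2))
      show "s *\<^sub>R u \<bullet> n = 0" using un by simp
      have "norm (s *\<^sub>R u) \<le> 2 * t * norm u"
        using s by (simp add: mult_right_mono)
      then show "norm (s *\<^sub>R u) \<le> r" using tu by linarith
    qed
    then have "x + s *\<^sub>R u \<in> T" using E by blast
    then have "(1 - t * c) *\<^sub>R (x + s *\<^sub>R u) + (t * c) *\<^sub>R a \<in> T"
      using tc t c a(1) by (intro convexD[OF full_simplex_basics(1)[OF T(1)]]) auto
    moreover have "(1 - t * c) *\<^sub>R (x + s *\<^sub>R u) + (t * c) *\<^sub>R a = x + t *\<^sub>R w"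
    proof -
      have "(1 - t * c) *\<^sub>R (x + s *\<^sub>R u) = (1 - t * c) *\<^sub>R x + t *\<^sub>R u"
        using s(3) by (simp add: scaleR_add_right)
      then show ?thesis by (simp add: u_def algebra_simps)
    qed
    ultimately show "x + t *\<^sub>R w \<in> T" by simp
  qed
qed

text \<open>
  The intersection is a face that contains \<open>E\<close> and, as both simplices fill the same side of \<open>E\<close> near a
  relative interior point, a point outside of \<open>E\<close>. So it has full dimension and is not a proper face.
\<close>

lemma same_side_unique:
  fixes T1 T2 :: "'a::euclidean_space set"
  assumes T1: "full_simplex T1" "E facet_of T1" "towards T1 E n"
    and T2: "full_simplex T2" "E facet_of T2" "towards T2 E n"
    and n: "normal_to n E"
    and faces: "(T1 \<inter> T2) face_of T1" "(T1 \<inter> T2) face_of T2"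
  shows "T1 = T2"
proof -
  note E = facet_aff_dim[OF T1(1,2)] and E2 = facet_aff_dim[OF T2(1,2)]
  have cT: "convex T1" "convex T2" using T1 T2 full_simplex_basics by auto
  obtain x where x: "x \<in> rel_interior E"
    using E rel_interior_eq_empty[of E] by blast
  then have xE: "x \<in> E" using rel_interior_subset by blast
  have n1: "n \<bullet> n = 1" using n by (simp add: normal_to_def norm_eq_1)
  obtain d1 where d1: "d1 > 0" "\<And>t. 0 \<le> t \<Longrightarrow> t \<le> d1 \<Longrightarrow> x + t *\<^sub>R n \<in> T1"
    using facet_rel_interior_inward[OF T1(1,2) n T1(3) x, of n] n1 by auto
  obtain d2 where d2: "d2 > 0" "\<And>t. 0 \<le> t \<Longrightarrow> t \<le> d2 \<Longrightarrow> x + t *\<^sub>R n \<in> T2"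
    using facet_rel_interior_inward[OF T2(1,2) n T2(3) x, of n] n1 by auto
  define p where "p = x + (min d1 d2) *\<^sub>R n"
  have "p \<in> T1 \<inter> T2" using d1 d2 by (auto simp: p_def)
  moreover have "p \<notin> E"
  proof
    assume "p \<in> E"
    then have "(p - x) \<bullet> n = 0" using n xE by (simp add: normal_to_def)
    then show False using n1 d1 d2 by (simp add: p_def min_def split: if_splits)
  qed
  ultimately have ne: "E \<noteq> T1 \<inter> T2" by blast
  have "E face_of (T1 \<inter> T2)"
    by (rule face_of_subset[OF E(6)]) (use E E2 in auto)
  then have "aff_dim E < aff_dim (T1 \<inter> T2)"
    using ne cT by (intro face_of_aff_dim_lt) (auto intro: convex_Int)
  then have dim: "aff_dim (T1 \<inter> T2) \<ge> int DIM('a)"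
    using E by simp
  have "T1 \<inter> T2 = T1"
    using face_of_aff_dim_lt[OF cT(1) faces(1)] full_simplex_basics(4)[OF T1(1)] dim by linarith
  moreover have "T1 \<inter> T2 = T2"
    using face_of_aff_dim_lt[OF cT(2) faces(2)] full_simplex_basics(4)[OF T2(1)] dim by linarith
  ultimately show ?thesis by simp
qed

text \<open>
  The common face contains a relative interior point of \<open>E\<close> and thus all of \<open>E\<close>. It is a proper face, so its
  dimension leaves no other possibility than \<open>E\<close> itself.
\<close>

lemma facet_of_neighbour:
  fixes T K :: "'a::euclidean_space set"
  assumes T: "full_simplex T" "E facet_of T" and K: "full_simplex K" "K \<noteq> T"
    and faces: "(T \<inter> K) face_of T" "(T \<inter> K) face_of K"
    and x: "x \<in> rel_interior E" "x \<in> K"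
  shows "E facet_of K"
proof -
  note E = facet_aff_dim[OF T]
  have cT: "convex T" "convex K" using T K full_simplex_basics by auto
  have xE: "x \<in> E" using x rel_interior_subset by blast
  have sub: "E \<subseteq> T \<inter> K"
    by (rule subset_of_face_of[OF faces(1) E(5)]) (use x xE E in auto)
  have "T \<inter> K \<noteq> T"
  proof
    assume eq: "T \<inter> K = T"
    then have "T face_of K" using faces by simp
    then show False
      using face_of_aff_dim_lt[of K T] cT full_simplex_basics(4)[OF T(1)]
        full_simplex_basics(4)[OF K(1)] K(2) by auto
  qed
  then have lt: "aff_dim (T \<inter> K) < int DIM('a)"
    using face_of_aff_dim_lt[OF cT(1) faces(1)] full_simplex_basics(4)[OF T(1)] by simp
  have "E face_of (T \<inter> K)"
    by (rule face_of_subset[OF E(6)]) (use sub in auto)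
  then have "E = T \<inter> K"
    using face_of_aff_dim_lt[of "T \<inter> K" E] lt E(1) cT by (force intro: convex_Int)
  then have "E face_of K" using faces by simp
  then show ?thesis
    using E full_simplex_basics(4)[OF K(1)] by (simp add: facet_of_def)
qed

text \<open>
  Points of \<open>\<Omega>\<close> on the other side of \<open>E\<close> that converge to a relative interior point of \<open>E\<close> are covered by
  finitely many elements, so one element contains infinitely many of them and their limit.
\<close>

lemma neighbour_exists:
  fixes T :: "'a::euclidean_space set"
  assumes fin: "finite \<K>" and simp: "\<And>K. K \<in> \<K> \<Longrightarrow> full_simplex K"
    and faces: "\<And>K K'. K \<in> \<K> \<Longrightarrow> K' \<in> \<K> \<Longrightarrow> (K \<inter> K') face_of K"
    and cover: "\<Union> \<K> = closure \<Omega>" and \<Omega>: "open \<Omega>"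
    and T: "T \<in> \<K>" "E facet_of T" and n: "normal_to n E" "towards T E n"
    and E_int: "\<not> E \<subseteq> frontier \<Omega>"
  shows "\<exists>K \<in> \<K>. E facet_of K \<and> towards K E (- n)"
proof -
  note E = facet_aff_dim[OF simp[OF T(1)] T(2)]
  have "\<not> rel_interior E \<subseteq> frontier \<Omega>"
  proof
    assume "rel_interior E \<subseteq> frontier \<Omega>"
    then have "closure (rel_interior E) \<subseteq> frontier \<Omega>"
      by (intro closure_minimal) auto
    then show False
      using E_int convex_closure_rel_interior[OF E(2)] closure_subset[of E] by blast
  qed
  then obtain x where x: "x \<in> rel_interior E" "x \<notin> frontier \<Omega>" by blast
  then have xE: "x \<in> E" using rel_interior_subset by blast
  then have "x \<in> closure \<Omega>" using E T cover by blast
  then have x\<Omega>: "x \<in> \<Omega>" using x(2) \<Omega> by (simp add: frontier_def interior_open)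
  have n1: "n \<bullet> n = 1" "norm n = 1" using n by (simp_all add: normal_to_def norm_eq_1)
  obtain r where r: "r > 0" "ball x r \<subseteq> \<Omega>" using \<Omega> x\<Omega> open_contains_ball by blast
  define y where "y k = x - (r / real (k + 2)) *\<^sub>R n" for k
  have y_in: "y k \<in> \<Union> \<K>" for k
  proof -
    have "dist x (y k) < r"
      using r n1 by (simp add: y_def dist_norm field_simps add_pos_nonneg)
    then show ?thesis using r cover closure_subset[of \<Omega>] by auto
  qed
  have lim: "y \<longlonglongrightarrow> x"
  proof -
    have "(\<lambda>k. x - (r / real (k + 2)) *\<^sub>R n) \<longlonglongrightarrow> x - 0 *\<^sub>R n"
      by (intro tendsto_intros real_tendsto_divide_at_top[OF tendsto_const]
        filterlim_compose[OF filterlim_real_sequentially filterlim_add_const_nat_at_top])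
    then show ?thesis by (simp add: y_def[abs_def])
  qed
  have "infinite (\<Union>K \<in> \<K>. {k. y k \<in> K})"
  proof -
    have "(\<Union>K \<in> \<K>. {k. y k \<in> K}) = UNIV" using y_in by auto
    then show ?thesis by simp
  qed
  then obtain K where K: "K \<in> \<K>" "infinite {k. y k \<in> K}"
    using fin by auto
  have clK: "closed K" using simp[OF K(1)] full_simplex_basics(2) compact_imp_closed by blast
  have "x \<in> K"
  proof (rule ccontr)
    assume "x \<notin> K"
    then have "\<forall>\<^sub>F k in sequentially. y k \<in> - K"
      using lim clK by (intro topological_tendstoD) auto
    then have "finite {k. y k \<in> K}"
      by (simp add: eventually_cofinite flip: cofinite_eq_sequentially)
    with K show False by simp
  qed
  obtain k where k: "y k \<in> K" using K(2) by (metis finite.emptyI empty_Collect_eq)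
  have neg: "(y k - x) \<bullet> n < 0" using r n1 by (simp add: y_def)
  then have "K \<noteq> T" using k n(2) xE unfolding towards_def by force
  have facet: "E facet_of K"
    by (rule facet_of_neighbour[OF simp[OF T(1)] T(2) simp[OF K(1)] \<open>K \<noteq> T\<close> faces[OF T(1) K(1)] _ x(1) \<open>x \<in> K\<close>])
      (use faces[OF K(1) T(1)] in \<open>simp add: Int_commute\<close>)
  have "\<not> towards K E n" using k neg xE unfolding towards_def by force
  then show ?thesis
    using towards_or[OF simp[OF K(1)] facet n(1)] K facet by blast
qed

section \<open>Lipschitz boundaries\<close>

text \<open>
  Below the graph of the Lipschitz function, and near the boundary point, there are no points of \<open>\<Omega>\<close>.
\<close>

lemma lipschitz_boundary_exterior:
  fixes \<Omega> :: "'a::euclidean_space set"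
  assumes lip: "lipschitz_boundary \<Omega>" and \<Omega>: "open \<Omega>" and x: "x \<in> frontier \<Omega>"
  obtains r e where "r > 0" "\<And>s. 0 < s \<Longrightarrow> s < r \<Longrightarrow> x - s *\<^sub>R e \<notin> closure \<Omega>"
proof -
  obtain r e \<phi> L where r: "r > 0" and e: "norm e = 1" and \<phi>: "L-lipschitz_on UNIV \<phi>"
    and eq: "\<Omega> \<inter> ball x r = {y \<in> ball x r. \<phi> (y - (y \<bullet> e) *\<^sub>R e) < y \<bullet> e}"
    using lip x unfolding lipschitz_boundary_def by blast
  have mem: "y \<in> \<Omega> \<longleftrightarrow> \<phi> (y - (y \<bullet> e) *\<^sub>R e) < y \<bullet> e" if "y \<in> ball x r" for y
    using eq that by blast
  have ee: "e \<bullet> e = 1" using e by (simp add: norm_eq_1)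
  have "x \<notin> \<Omega>" using x \<Omega> by (simp add: frontier_def interior_open)
  then have x_low: "x \<bullet> e \<le> \<phi> (x - (x \<bullet> e) *\<^sub>R e)"
    using mem[of x] r by simp
  have cont: "continuous_on UNIV (\<lambda>y. \<phi> (y - (y \<bullet> e) *\<^sub>R e))"
    by (rule continuous_on_compose2[OF lipschitz_on_continuous_on[OF \<phi>]])
      (auto intro!: continuous_intros)
  \<comment> \<open>The open region below the graph; it is disjoint from \<open>\<Omega>\<close> and hence from its closure.\<close>
  define W where "W = ball x r \<inter> {y. y \<bullet> e < \<phi> (y - (y \<bullet> e) *\<^sub>R e)}"
  have "open W"
    unfolding W_def by (intro open_Int open_ball open_Collect_less continuous_intros cont)
  moreover have "W \<inter> \<Omega> = {}"
  proof -
    have "y \<notin> \<Omega>" if "y \<in> W" for y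
      using that mem[of y] by (simp add: W_def)
    then show ?thesis by blast
  qed
  ultimately have "W \<inter> closure \<Omega> = {}"
    by (simp add: open_Int_closure_eq_empty)
  moreover have "x - s *\<^sub>R e \<in> W" if s: "0 < s" "s < r" for s
  proof -
    have level: "(x - s *\<^sub>R e) - ((x - s *\<^sub>R e) \<bullet> e) *\<^sub>R e = x - (x \<bullet> e) *\<^sub>R e"
      by (simp add: inner_diff_left ee algebra_simps)
    have "(x - s *\<^sub>R e) \<bullet> e < x \<bullet> e"
      using s by (simp add: inner_diff_left ee)
    then have "(x - s *\<^sub>R e) \<bullet> e < \<phi> ((x - s *\<^sub>R e) - ((x - s *\<^sub>R e) \<bullet> e) *\<^sub>R e)"
      unfolding level using x_low by linarith
    moreover have "x - s *\<^sub>R e \<in> ball x r"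
      using s e by (simp add: dist_norm)
    ultimately show ?thesis
      unfolding W_def by blast
  qed
  ultimately show ?thesis using that[OF r, of e] by blast
qed

lemma lipschitz_boundary_interior_closure:
  fixes \<Omega> :: "'a::euclidean_space set"
  assumes "lipschitz_boundary \<Omega>" "open \<Omega>"
  shows "interior (closure \<Omega>) \<subseteq> \<Omega>"
proof
  fix x assume x: "x \<in> interior (closure \<Omega>)"
  show "x \<in> \<Omega>"
  proof (rule ccontr)
    assume "x \<notin> \<Omega>"
    then have "x \<in> frontier \<Omega>"
      using x interior_subset assms(2) by (auto simp: frontier_def interior_open)
    then obtain r e where r: "r > 0" "\<And>s. 0 < s \<Longrightarrow> s < r \<Longrightarrow> x - s *\<^sub>R e \<notin> closure \<Omega>"
      using lipschitz_boundary_exterior[OF assms] by blast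
    obtain d where d: "d > 0" "cball x d \<subseteq> closure \<Omega>"
      using x mem_interior_cball by blast
    define s where "s = min (r / 2) (d / (norm e + 1))"
    have s: "0 < s" "s < r"
      using r(1) d(1) norm_ge_zero[of e] by (auto simp: s_def add_nonneg_pos)
    have "s * norm e \<le> d / (norm e + 1) * norm e"
      by (intro mult_right_mono) (auto simp: s_def)
    also have "\<dots> \<le> d" using d(1) norm_ge_zero[of e] by (simp add: field_simps add_pos_nonneg)
    finally have "x - s *\<^sub>R e \<in> cball x d"
      using s by (simp add: dist_norm)
    then show False using r(2)[OF s] d by blast
  qed
qed

text \<open>
  Two simplices on opposite sides of \<open>E\<close> would cover all directions from a relative interior point of \<open>E\<close>,
  including the one that leaves the closure of \<open>\<Omega>\<close>.
\<close>

lemma boundary_facet_unique: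
  fixes T1 T2 :: "'a::euclidean_space set"
  assumes lip: "lipschitz_boundary \<Omega>" and \<Omega>: "open \<Omega>" and E: "E \<subseteq> frontier \<Omega>" and n: "normal_to n E"
    and T1: "full_simplex T1" "E facet_of T1" "T1 \<subseteq> closure \<Omega>"
    and T2: "full_simplex T2" "E facet_of T2" "T2 \<subseteq> closure \<Omega>"
    and faces: "(T1 \<inter> T2) face_of T1" "(T1 \<inter> T2) face_of T2"
  shows "T1 = T2"
proof -
  obtain x where x: "x \<in> rel_interior E"
    using facet_aff_dim[OF T1(1,2)] rel_interior_eq_empty[of E] by blast
  then have "x \<in> frontier \<Omega>" using rel_interior_subset E by blast
  then obtain r e where r: "r > 0" "\<And>s. 0 < s \<Longrightarrow> s < r \<Longrightarrow> x - s *\<^sub>R e \<notin> closure \<Omega>"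
    using lipschitz_boundary_exterior[OF lip \<Omega>] by blast
  have *: "\<not> 0 \<le> (- e) \<bullet> m"
    if T: "full_simplex T" "E facet_of T" "T \<subseteq> closure \<Omega>" and m: "normal_to m E" "towards T E m" for T m
  proof
    assume "0 \<le> (- e) \<bullet> m"
    then obtain \<delta> where \<delta>: "\<delta> > 0" "\<And>t. 0 \<le> t \<Longrightarrow> t \<le> \<delta> \<Longrightarrow> x + t *\<^sub>R (- e) \<in> T"
      using facet_rel_interior_inward[OF T(1,2) m x] by blast
    define s where "s = min \<delta> (r / 2)"
    have "0 < s" "s < r" "s \<le> \<delta>" using \<delta> r by (auto simp: s_def)
    then show False using r(2)[of s] \<delta>(2)[of s] T(3) by auto
  qed
  have side: "towards T1 E m \<Longrightarrow> towards T2 E m" if m: "normal_to m E" for m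
  proof (rule ccontr)
    assume t: "towards T1 E m" "\<not> towards T2 E m"
    then have "towards T2 E (- m)" using towards_or[OF T2(1,2) m] by blast
    then show False
      using *[OF T1 m t(1)] *[OF T2 normal_to_minus[OF m]] by auto
  qed
  show ?thesis
  proof (cases "towards T1 E n")
    case True
    then show ?thesis
      using same_side_unique[OF T1(1,2) True T2(1,2) side[OF n True] n faces] by blast
  next
    case False
    then have t: "towards T1 E (- n)" using towards_or[OF T1(1,2) n] by blast
    note m = normal_to_minus[OF n]
    show ?thesis
      using same_side_unique[OF T1(1,2) t T2(1,2) side[OF m t] m faces] by blast
  qed
qed

section \<open>Meshes and their refinements\<close>

lemma is_mesh_elements:
  fixes \<T> :: "('n::finite) mesh"
  assumes "is_mesh \<Omega> \<T>"
  shows "finite (elements \<T>)" "T \<in> elements \<T> \<Longrightarrow> full_simplex T"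
    "K \<in> elements \<T> \<Longrightarrow> K' \<in> elements \<T> \<Longrightarrow> (K \<inter> K') face_of K"
    "K \<in> elements \<T> \<Longrightarrow> K' \<in> elements \<T> \<Longrightarrow> (K' \<inter> K) face_of K"
    "\<Union> (elements \<T>) = closure \<Omega>" "T \<in> elements \<T> \<Longrightarrow> T \<subseteq> closure \<Omega>"
proof -
  show "finite (elements \<T>)" "\<Union> (elements \<T>) = closure \<Omega>"
    using assms by (auto simp: is_mesh_def elements_def)
  then show "T \<in> elements \<T> \<Longrightarrow> T \<subseteq> closure \<Omega>" by blast
  show f: "(K \<inter> K') face_of K" if "K \<in> elements \<T>" "K' \<in> elements \<T>" for K K'
    using assms that by (auto simp: is_mesh_def triangulation_def)
  show "(K' \<inter> K) face_of K" if "K \<in> elements \<T>" "K' \<in> elements \<T>"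
    using f[OF that] by (simp add: Int_commute)
  show "full_simplex T" if "T \<in> elements \<T>"
  proof -
    obtain \<tau> where "\<tau> \<in> \<T>" "T = elt \<tau>"
      using \<open>T \<in> elements \<T>\<close> unfolding elements_def by blast
    moreover obtain xs \<gamma> where "\<tau> = (xs, \<gamma>)"
      by fastforce
    ultimately have \<tau>: "(xs, \<gamma>) \<in> \<T>" "T = elt (xs, \<gamma>)"
      by simp_all
    then have "tagged_simplex (xs, \<gamma>)" using assms by (auto simp: is_mesh_def)
    then have "\<not> affine_dependent (set xs)" "card (set xs) = CARD('n) + 1"
      by (auto simp: tagged_simplex_def distinct_card)
    then show ?thesis
      unfolding full_simplex_def simplex_def \<tau>(2) elt_def verts_def
      by (intro exI[of _ "set xs"]) simp
  qed
qed

lemma finite_card_sides: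
  fixes T :: "(real^'n) set"
  assumes "full_simplex T"
  shows "finite (sides T)" "card (sides T) \<le> CARD('n) + 1"
proof -
  obtain S where S: "\<not> affine_dependent S" "int (card S) = int CARD('n) + 1" "T = convex hull S"
    using assms by (auto simp: full_simplex_def simplex_def)
  have fS: "finite S" using S(1) aff_independent_finite by blast
  have sub: "sides T \<subseteq> (\<lambda>u. convex hull (S - {u})) ` S"
    unfolding sides_def S(3) using facet_of_convex_hull_affine_independent[OF S(1)] by blast
  then show "finite (sides T)" using fS finite_subset by blast
  have "card (sides T) \<le> card S"
    using card_mono[OF _ sub] card_image_le[OF fS] fS by (meson finite_imageI order_trans)
  then show "card (sides T) \<le> CARD('n) + 1" using S(2) by linarith
qed

lemma elt_towards_unique:
  fixes \<T> :: "('n::finite) mesh"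
  assumes "is_mesh \<Omega> \<T>" "normal_to n E"
    and K: "K \<in> elements \<T>" "E \<in> sides K" "towards K E n"
  shows "elt_towards \<T> E n = K"
  unfolding elt_towards_def towards_def[symmetric]
proof (rule the_equality)
  show "K \<in> elements \<T> \<and> E \<in> sides K \<and> towards K E n" using K by blast
  fix K' assume K': "K' \<in> elements \<T> \<and> E \<in> sides K' \<and> towards K' E n"
  show "K' = K"
    by (rule same_side_unique[of K' E n K])
      (use K K' assms(2) is_mesh_elements[OF assms(1)] in \<open>auto simp: sides_def\<close>)
qed

lemma elt_towards_interior:
  fixes \<T> :: "('n::finite) mesh"
  assumes mesh: "is_mesh \<Omega> \<T>" "open \<Omega>" and n: "normal_to n E"
    and T: "T \<in> elements \<T>" "E \<in> sides T" and E: "\<not> E \<subseteq> frontier \<Omega>"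
  shows "elt_towards \<T> E n \<in> elements \<T> \<and> E \<in> sides (elt_towards \<T> E n)
    \<and> towards (elt_towards \<T> E n) E n"
proof -
  note m = is_mesh_elements[OF mesh(1)]
  have "\<exists>K \<in> elements \<T>. E \<in> sides K \<and> towards K E n"
  proof (cases "towards T E n")
    case False
    then have t: "towards T E (- n)" using T towards_or[OF m(2)] n by (auto simp: sides_def)
    have "\<exists>K \<in> elements \<T>. E facet_of K \<and> towards K E (- (- n))"
      by (rule neighbour_exists[OF m(1,2,3,5) mesh(2) T(1) _ normal_to_minus[OF n] t E])
        (use T(2) in \<open>auto simp: sides_def\<close>)
    then show ?thesis by (auto simp: sides_def)
  qed (use T in blast)
  then show ?thesis using elt_towards_unique[OF mesh(1) n] by blast
qed

lemma elt_towards_cases: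
  fixes \<T> :: "('n::finite) mesh"
  assumes "is_mesh \<Omega> \<T>" "normal_to n E" "T \<in> elements \<T>" "E \<in> sides T"
  shows "T = elt_towards \<T> E n \<or> T = elt_towards \<T> E (- n)"
  using towards_or[OF is_mesh_elements(2)[OF assms(1,3)] _ assms(2)] assms
    elt_towards_unique[OF assms(1) _ assms(3,4)] normal_to_minus
  unfolding sides_def by blast

lemma boundary_elt_eq:
  fixes \<T> :: "('n::finite) mesh"
  assumes "is_mesh \<Omega> \<T>" "open \<Omega>" "lipschitz_boundary \<Omega>" "normal_to n E"
    and T: "T \<in> elements \<T>" "E \<in> sides T" and E: "E \<subseteq> frontier \<Omega>"
  shows "boundary_elt \<T> E = T"
  unfolding boundary_elt_def
proof (rule the_equality)
  show "T \<in> elements \<T> \<and> E \<in> sides T" using T by blast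
  fix K assume K: "K \<in> elements \<T> \<and> E \<in> sides K"
  note m = is_mesh_elements[OF assms(1)]
  show "K = T"
    by (rule boundary_facet_unique[OF assms(3,2) E assms(4)])
      (use K T m(2,3,4,6) in \<open>auto simp: sides_def\<close>)
qed

lemma length_bisect: "\<sigma> \<in> bisect \<tau> \<Longrightarrow> 2 \<le> length (fst \<sigma>)"
  by (auto simp: bisect_def Let_def split: prod.splits)

lemma elt_bisect_subset:
  assumes "2 \<le> length (fst \<tau>)" "\<sigma> \<in> bisect \<tau>"
  shows "elt \<sigma> \<subseteq> elt \<tau>"
proof -
  obtain xs \<gamma> where \<tau>: "\<tau> = (xs, \<gamma>)" by fastforce
  let ?m = "midpoint (hd xs) (last xs)" and ?ys = "butlast (tl xs)"
  have ne: "xs \<noteq> []" using assms(1) \<tau> by auto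
  then have ends: "hd xs \<in> set xs" "last xs \<in> set xs" by auto
  then have hl: "hd xs \<in> convex hull (set xs)" "last xs \<in> convex hull (set xs)"
    by (simp_all add: hull_inc)
  then have mid: "?m \<in> convex hull (set xs)"
    using closed_segment_subset[OF hl convex_convex_hull] midpoint_in_closed_segment by blast
  have "set ?ys \<subseteq> set xs"
    by (meson in_set_butlastD list.set_sel(2) ne subsetI)
  then have ys: "set ?ys \<subseteq> convex hull (set xs)"
    using hull_subset[of "set xs" convex] by blast
  have "set (take \<gamma> ?ys @ rev (drop \<gamma> ?ys)) = set ?ys"
    by (metis append_take_drop_id set_append set_rev)
  then have "verts \<sigma> \<subseteq> convex hull (set xs)"
    using assms(2) hl mid ys unfolding \<tau> bisect_def Let_def verts_def by auto
  then show ?thesis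
    unfolding elt_def by (intro hull_minimal) (auto simp: \<tau> verts_def)
qed

text \<open>
  The length bound is part of the invariant because \<^const>\<open>bisect\<close> only has a meaning for lists with
  a first and a last vertex.
\<close>

lemma bisect_marked_refines:
  fixes \<P> \<T> :: "('n::finite) mesh"
  assumes "\<forall>\<tau> \<in> \<P>. 2 \<le> length (fst \<tau>) \<and> (\<exists>T \<in> elements \<T>. elt \<tau> \<subseteq> T)" "\<M> \<subseteq> \<P>"
  shows "\<forall>\<tau> \<in> bisect_marked \<P> \<M>. 2 \<le> length (fst \<tau>) \<and> (\<exists>T \<in> elements \<T>. elt \<tau> \<subseteq> T)"
proof
  fix \<tau> assume "\<tau> \<in> bisect_marked \<P> \<M>"
  then consider "\<tau> \<in> \<P>" | \<sigma> where "\<sigma> \<in> \<M>" "\<tau> \<in> bisect \<sigma>"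
    by (auto simp: bisect_marked_def)
  then show "2 \<le> length (fst \<tau>) \<and> (\<exists>T \<in> elements \<T>. elt \<tau> \<subseteq> T)"
  proof cases
    case 2
    then show ?thesis
      using assms length_bisect elt_bisect_subset by (meson subset_iff)
  qed (use assms in blast)
qed

lemma NVB_meshes_refines:
  fixes \<T> :: "('n::finite) mesh"
  assumes "\<T>' \<in> NVB_meshes \<Omega> \<T>" "is_mesh \<Omega> \<T>"
  shows "\<forall>\<tau> \<in> \<T>'. 2 \<le> length (fst \<tau>) \<and> (\<exists>T \<in> elements \<T>. elt \<tau> \<subseteq> T)"
  using assms(1)
proof induction
  case initial
  have "2 \<le> length (fst \<tau>)" if "\<tau> \<in> \<T>" for \<tau>
  proof -
    have "tagged_simplex \<tau>" using assms(2) that by (auto simp: is_mesh_def)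
    then have "length (fst \<tau>) = CARD('n) + 1"
      by (auto simp: tagged_simplex_def split: prod.splits)
    moreover have "0 < CARD('n)" by simp
    ultimately show ?thesis by linarith
  qed
  then show ?case by (auto simp: elements_def)
next
  case (refine \<T>' \<M> \<T>'')
  let ?Q = "\<lambda>\<P>. \<forall>\<tau> \<in> \<P>. 2 \<le> length (fst \<tau>) \<and> (\<exists>T \<in> elements \<T>. elt \<tau> \<subseteq> T)"
  let ?step = "\<lambda>\<P> :: 'n mesh. bisect_marked \<P> (with_hanging_node \<P>)"
  have "?Q ((?step ^^ k) (bisect_marked \<T>' \<M>))" for k
  proof (induction k)
    case 0
    show ?case using bisect_marked_refines[OF refine.IH refine.hyps(2)] by simp
  next
    case (Suc k)
    show ?case
      using bisect_marked_refines[OF Suc, of "with_hanging_node ((?step ^^ k) (bisect_marked \<T>' \<M>))"]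
      by (simp add: with_hanging_node_def)
  qed
  then show ?case using refine.hyps(3) unfolding is_NVB_def by metis
qed

lemma NVB_meshes_is_mesh: "\<T>' \<in> NVB_meshes \<Omega> \<T> \<Longrightarrow> is_mesh \<Omega> \<T> \<Longrightarrow> is_mesh \<Omega> \<T>'"
  by (induction rule: NVB_meshes.induct) auto

lemma NVB_meshes_trans:
  assumes "\<T>'' \<in> NVB_meshes \<Omega> \<T>'" "\<T>' \<in> NVB_meshes \<Omega> \<T>"
  shows "\<T>'' \<in> NVB_meshes \<Omega> \<T>"
  using assms by induction (auto intro: NVB_meshes.intros)

lemma NVB_meshes_element_subset:
  fixes \<T> :: "('n::finite) mesh"
  assumes "\<T>' \<in> NVB_meshes \<Omega> \<T>" "is_mesh \<Omega> \<T>" "K \<in> elements \<T>'"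
  shows "\<exists>T \<in> elements \<T>. K \<subseteq> T"
proof -
  obtain \<tau> where "\<tau> \<in> \<T>'" "K = elt \<tau>"
    using assms(3) by (auto simp: elements_def)
  then show ?thesis
    using bspec[OF NVB_meshes_refines[OF assms(1,2)]] by simp
qed

text \<open>
  The coarse element that contains the fine neighbour of \<open>T\<close> across \<open>E\<close> also contains \<open>E\<close>. It is different
  from \<open>T\<close>, hence it has \<open>E\<close> as a side and is the coarse neighbour.
\<close>

lemma elt_towards_subset:
  fixes \<T> \<T>' :: "('n::finite) mesh"
  assumes m: "is_mesh \<Omega> \<T>" "is_mesh \<Omega> \<T>'" and \<Omega>: "open \<Omega>" and n: "normal_to n E"
    and refines: "\<And>K. K \<in> elements \<T>' \<Longrightarrow> \<exists>K0 \<in> elements \<T>. K \<subseteq> K0"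
    and T: "T \<in> elements \<T>" "T \<in> elements \<T>'" "E \<in> sides T" and E: "\<not> E \<subseteq> frontier \<Omega>"
  shows "elt_towards \<T>' E n \<subseteq> elt_towards \<T> E n"
proof (cases "towards T E n")
  case True
  then show ?thesis
    using elt_towards_unique[OF m(1) n T(1,3)] elt_towards_unique[OF m(2) n T(2,3)] by simp
next
  case False
  note m1 = is_mesh_elements[OF m(1)] and m2 = is_mesh_elements[OF m(2)]
  define K' where "K' = elt_towards \<T>' E n"
  have K': "K' \<in> elements \<T>'" "E \<in> sides K'" "towards K' E n"
    using elt_towards_interior[OF m(2) \<Omega> n T(2,3) E] by (auto simp: K'_def)
  obtain K where K: "K \<in> elements \<T>" "K' \<subseteq> K" using refines[OF K'(1)] by blast
  have not_opposite: "\<not> towards K E (- n)"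
  proof
    assume "towards K E (- n)"
    then have "towards K' E (- n)" using K(2) unfolding towards_def by blast
    then show False
      using towards_or[OF m2(2)[OF K'(1)] _ n] K'(2,3) by (auto simp: sides_def)
  qed
  have "towards T E (- n)"
    using False towards_or[OF m1(2)[OF T(1)] _ n] T(3) by (auto simp: sides_def)
  then have "K \<noteq> T" using not_opposite by blast
  have facets: "E facet_of T" "E facet_of K'" using T K' by (auto simp: sides_def)
  obtain x where x: "x \<in> rel_interior E"
    using facet_aff_dim[OF m1(2)[OF T(1)] facets(1)] rel_interior_eq_empty[of E] by blast
  then have "x \<in> K"
    using rel_interior_subset facet_aff_dim(5)[OF m2(2)[OF K'(1)] facets(2)] K(2) by blast
  then have EK: "E facet_of K"
    by (intro facet_of_neighbour[OF m1(2)[OF T(1)] facets(1) m1(2)[OF K(1)] \<open>K \<noteq> T\<close>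
        m1(3)[OF T(1) K(1)] m1(4)[OF K(1) T(1)] x])
  then have "towards K E n"
    using towards_or[OF m1(2)[OF K(1)] EK n] not_opposite by blast
  then have "elt_towards \<T> E n = K"
    using elt_towards_unique[OF m(1) n K(1)] EK by (simp add: sides_def)
  then show ?thesis using K(2) by (simp add: K'_def)
qed

section \<open>Sizes of sides and elements\<close>

lemma hausdorff_pre_finite_cover:
  fixes A :: "'a::metric_space set"
  assumes I: "finite I" and A: "A \<subseteq> (\<Union>i\<in>I. U i)" and k: "k > 0"
    and U: "\<And>i. i \<in> I \<Longrightarrow> bounded (U i)" "\<And>i. i \<in> I \<Longrightarrow> diameter (U i) \<le> \<rho>"
    and \<rho>: "0 \<le> \<rho>" "\<rho> \<le> \<delta>"
  shows "hausdorff_pre k \<delta> A \<le> ennreal (real (card I) * (unit_ball_vol k * (\<rho> / 2) ^ k))"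
proof -
  obtain h where h: "bij_betw h {0..<card I} I"
    using ex_bij_betw_nat_finite[OF I] by blast
  define W where "W m = (if m < card I then U (h m) else {})" for m
  define c where "c m = ennreal (unit_ball_vol k * (diameter (W m) / 2) ^ k)" for m
  have hI: "h m \<in> I" if "m < card I" for m
    using bij_betw_apply[OF h] that by simp
  have "A \<subseteq> (\<Union>m. W m)"
  proof
    fix x assume "x \<in> A"
    then obtain i where i: "i \<in> I" "x \<in> U i" using A by blast
    then have "i \<in> h ` {0..<card I}"
      using bij_betw_imp_surj_on[OF h] by simp
    then obtain m where "m < card I" "h m = i"
      by auto
    then have "x \<in> W m" using i by (simp add: W_def)
    then show "x \<in> (\<Union>m. W m)" by blast
  qed
  moreover have "bounded (W m) \<and> diameter (W m) \<le> \<delta>" for m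
    using U[OF hI] \<rho> by (auto simp: W_def intro: order_trans)
  ultimately have "hausdorff_pre k \<delta> A \<le> (\<Sum>m. c m)"
    unfolding hausdorff_pre_def c_def by (intro INF_lower) auto
  also have "\<dots> = (\<Sum>m<card I. c m)"
    by (rule suminf_finite) (use k in \<open>auto simp: c_def W_def\<close>)
  also have "\<dots> \<le> (\<Sum>m<card I. ennreal (unit_ball_vol k * (\<rho> / 2) ^ k))"
  proof (rule sum_mono)
    fix m assume m: "m \<in> {..<card I}"
    then have "diameter (W m) \<le> \<rho>" "0 \<le> diameter (W m)"
      using U[OF hI] diameter_ge_0 by (auto simp: W_def)
    then show "c m \<le> ennreal (unit_ball_vol k * (\<rho> / 2) ^ k)"
      unfolding c_def by (intro ennreal_leI mult_left_mono power_mono) auto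
  qed
  also have "\<dots> = ennreal (real (card I) * (unit_ball_vol k * (\<rho> / 2) ^ k))"
    using \<rho> by (simp add: ennreal_mult ennreal_of_nat_eq_real_of_nat)
  finally show ?thesis .
qed

text \<open>
  In the hyperplane orthogonal to \<open>n\<close>, the coordinate in which \<open>n\<close> is largest is controlled by the others.
  This makes the projection along that coordinate bi-Lipschitz.
\<close>

lemma hyperplane_max_coordinate:
  fixes n :: "real^'n"
  assumes "n \<noteq> 0"
  obtains i where "\<And>w. w \<bullet> n = 0 \<Longrightarrow> norm w \<le> 2 * (\<Sum>j\<in>UNIV - {i}. \<bar>w $ j\<bar>)"
proof -
  obtain i where i: "\<And>j. \<bar>n $ j\<bar> \<le> \<bar>n $ i\<bar>"
  proof -
    have "Max (range (\<lambda>j. \<bar>n $ j\<bar>)) \<in> range (\<lambda>j. \<bar>n $ j\<bar>)"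
      by (rule Max_in) auto
    then obtain i where "Max (range (\<lambda>j. \<bar>n $ j\<bar>)) = \<bar>n $ i\<bar>" by blast
    moreover have "\<bar>n $ j\<bar> \<le> Max (range (\<lambda>j. \<bar>n $ j\<bar>))" for j
      by (rule Max_ge) auto
    ultimately show ?thesis using that[of i] by simp
  qed
  have ni: "\<bar>n $ i\<bar> > 0"
  proof (rule ccontr)
    assume "\<not> ?thesis"
    then have "n $ j = 0" for j using i[of j] by simp
    then show False using assms by (simp add: vec_eq_iff)
  qed
  show ?thesis
  proof
    fix w :: "real^'n" assume w: "w \<bullet> n = 0"
    let ?s = "\<Sum>j\<in>UNIV - {i}. \<bar>w $ j\<bar>"
    have "w $ i * n $ i = - (\<Sum>j\<in>UNIV - {i}. w $ j * n $ j)"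
      using w by (simp add: inner_vec_def sum.remove[of UNIV i])
    then have "\<bar>w $ i\<bar> * \<bar>n $ i\<bar> = \<bar>\<Sum>j\<in>UNIV - {i}. w $ j * n $ j\<bar>"
      by (metis abs_minus_cancel abs_mult)
    also have "\<dots> \<le> (\<Sum>j\<in>UNIV - {i}. \<bar>w $ j\<bar> * \<bar>n $ i\<bar>)"
      by (rule order_trans[OF sum_abs]) (auto simp: abs_mult intro!: sum_mono mult_left_mono i)
    also have "\<dots> = ?s * \<bar>n $ i\<bar>" by (simp add: sum_distrib_right)
    finally have "\<bar>w $ i\<bar> \<le> ?s" using ni by simp
    moreover have "norm w \<le> \<bar>w $ i\<bar> + ?s"
      using norm_le_l1_cart[of w] by (simp add: sum.remove[of UNIV i])
    ultimately show "norm w \<le> 2 * ?s" by linarith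
  qed
qed

text \<open>
  The set is cut into cells according to a grid of mesh size \<open>M / N\<close> in all coordinates but the one from
  \<open>hyperplane_max_coordinate\<close>. There are at most \<open>(2 N + 1) ^ k\<close> cells, of diameter at most \<open>2 k M / N\<close>, so
  their total contribution is bounded independently of \<open>N\<close>.
\<close>

lemma hausdorff_outer_hyperplane_le:
  fixes E :: "(real^'n) set"
  assumes n: "normal_to n E" and bE: "bounded E" and M: "M > 0" "diameter E \<le> M"
    and k: "k = CARD('n) - 1" "k > 0"
  shows "hausdorff_outer k E \<le> ennreal (unit_ball_vol k * (3 * real k * M) ^ k)"
proof (cases "E = {}")
  case False
  then obtain x0 where x0: "x0 \<in> E" by blast
  have "n \<noteq> 0" using n by (auto simp: normal_to_def)
  then obtain i where i: "\<And>w. w \<bullet> n = 0 \<Longrightarrow> norm w \<le> 2 * (\<Sum>j\<in>UNIV - {i}. \<bar>w $ j\<bar>)"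
    using hyperplane_max_coordinate by blast
  define J where "J = UNIV - {i}"
  have J: "finite J" "card J = k" by (auto simp: J_def k)
  show ?thesis
    unfolding hausdorff_outer_def
  proof (rule SUP_least)
    fix \<delta> :: real assume "\<delta> \<in> {0<..}"
    then have \<delta>: "\<delta> > 0" by simp
    obtain N0 :: nat where N0: "2 * real k * M / \<delta> < real N0"
      using reals_Archimedean2 by blast
    define N where "N = Suc N0"
    have N: "N \<ge> 1" "2 * real k * M / real N \<le> \<delta>"
    proof -
      have "2 * real k * M < real N0 * \<delta>" using N0 \<delta> by (simp add: field_simps)
      also have "\<dots> \<le> real N * \<delta>" using \<delta> by (simp add: N_def)
      finally show "2 * real k * M / real N \<le> \<delta>" by (simp add: N_def field_simps)
    qed (simp add: N_def)
    define \<rho> where "\<rho> = 2 * real k * M / real N"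
    define cell where "cell x = restrict (\<lambda>j. \<lfloor>real N * (x $ j - x0 $ j) / M\<rfloor>) J" for x
    define I where "I = PiE J (\<lambda>_. {- int N..int N})"
    define U where "U z = {x \<in> E. cell x = z}" for z
    have close: "\<bar>x $ j - y $ j\<bar> \<le> M" if "x \<in> E" "y \<in> E" for x y j
    proof -
      have "\<bar>x $ j - y $ j\<bar> \<le> norm (x - y)" using component_le_norm_cart[of "x - y" j] by simp
      also have "\<dots> \<le> diameter E" using diameter_bounded_bound[OF bE that] by (simp add: dist_norm)
      finally show ?thesis using M by simp
    qed
    have in_I: "cell x \<in> I" if "x \<in> E" for x
    proof -
      have "\<lfloor>real N * (x $ j - x0 $ j) / M\<rfloor> \<in> {- int N..int N}" for j
      proof -
        have "\<bar>real N * (x $ j - x0 $ j)\<bar> \<le> real N * M"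
          unfolding abs_mult using close[OF that x0, of j] by (simp add: mult_left_mono)
        then have "- real N \<le> real N * (x $ j - x0 $ j) / M \<and> real N * (x $ j - x0 $ j) / M \<le> real N"
          using M unfolding abs_le_iff by (auto simp: pos_divide_le_eq pos_le_divide_eq)
        then show ?thesis by (auto simp: le_floor_iff floor_le_iff simp del: times_divide_eq_right)
      qed
      then show ?thesis by (auto simp: I_def cell_def)
    qed
    have "hausdorff_pre k \<delta> E \<le> ennreal (real (card I) * (unit_ball_vol k * (\<rho> / 2) ^ k))"
    proof (rule hausdorff_pre_finite_cover)
      show "finite I" unfolding I_def using J by (intro finite_PiE) auto
      show "E \<subseteq> (\<Union>z\<in>I. U z)" using in_I by (auto simp: U_def)
      show "bounded (U z)" for z by (rule bounded_subset[OF bE]) (auto simp: U_def)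
      show "0 \<le> \<rho>" "\<rho> \<le> \<delta>" using M N by (auto simp: \<rho>_def)
      show "diameter (U z) \<le> \<rho>" for z
      proof (rule diameter_le)
        show "U z \<noteq> {} \<or> 0 \<le> \<rho>" using M by (simp add: \<rho>_def)
        fix x y assume xy: "x \<in> U z" "y \<in> U z"
        then have E: "x \<in> E" "y \<in> E" and c: "cell x = cell y" by (auto simp: U_def)
        have cj: "\<bar>(x - y) $ j\<bar> \<le> M / real N" if j: "j \<in> J" for j
        proof -
          have "\<lfloor>real N * (x $ j - x0 $ j) / M\<rfloor> = \<lfloor>real N * (y $ j - x0 $ j) / M\<rfloor>"
            using fun_cong[OF c, of j] j by (simp add: cell_def)
          then have "\<bar>real N * (x $ j - x0 $ j) / M - real N * (y $ j - x0 $ j) / M\<bar> \<le> 1"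
            by linarith
          moreover have "real N * (x $ j - x0 $ j) / M - real N * (y $ j - x0 $ j) / M
              = (real N / M) * (x - y) $ j"
            by (simp add: diff_divide_distrib[symmetric] right_diff_distrib)
          ultimately have "(real N / M) * \<bar>(x - y) $ j\<bar> \<le> 1"
            using M by (simp add: abs_mult)
          then show ?thesis using M N(1) by (simp add: field_simps)
        qed
        have "norm (x - y) \<le> 2 * (\<Sum>j\<in>J. \<bar>(x - y) $ j\<bar>)"
          unfolding J_def using n E by (intro i) (auto simp: normal_to_def)
        also have "\<dots> \<le> 2 * (\<Sum>j\<in>J. M / real N)"
          by (intro mult_left_mono sum_mono cj) auto
        also have "\<dots> = \<rho>" using J by (simp add: \<rho>_def)
        finally show "norm (x - y) \<le> \<rho>" .
      qed
    qed (use k in auto)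
    also have "\<dots> \<le> ennreal (unit_ball_vol k * (3 * real k * M) ^ k)"
    proof (rule ennreal_leI)
      have "card I = (2 * N + 1) ^ k"
        using J by (simp add: I_def card_PiE nat_add_distrib nat_mult_distrib)
      then have "real (card I) * (unit_ball_vol k * (\<rho> / 2) ^ k)
          = unit_ball_vol k * (real (2 * N + 1) * (\<rho> / 2)) ^ k"
        by (simp only: of_nat_power power_mult_distrib ac_simps)
      also have "\<dots> \<le> unit_ball_vol k * (3 * real k * M) ^ k"
      proof (intro mult_left_mono power_mono)
        have "real (2 * N + 1) * (\<rho> / 2) = (real (2 * N + 1) / real N) * (real k * M)"
          by (simp add: \<rho>_def)
        also have "\<dots> \<le> 3 * (real k * M)"
          using N(1) M by (intro mult_right_mono) (auto simp: field_simps)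
        finally show "real (2 * N + 1) * (\<rho> / 2) \<le> 3 * real k * M" by simp
        show "0 \<le> real (2 * N + 1) * (\<rho> / 2)" using M by (simp add: \<rho>_def)
      qed simp
      finally show "real (card I) * (unit_ball_vol k * (\<rho> / 2) ^ k) \<le> unit_ball_vol k * (3 * real k * M) ^ k" .
    qed
    finally show "hausdorff_pre k \<delta> E \<le> ennreal (unit_ball_vol k * (3 * real k * M) ^ k)" .
  qed
next
  case True
  show ?thesis
    unfolding True hausdorff_outer_empty[OF k(2)] by simp
qed

text \<open>
  Take a diameter of the ball parallel to the facet. Its end points have the same distance to the
  facet, so in cone coordinates they have the same weight of the apex, and their difference is a
  multiple, by a factor of at most one, of a difference of points of the facet.
\<close>

lemma cball_subset_simplex_le_diameter_facet:
  fixes T :: "'a::euclidean_space set"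
  assumes T: "full_simplex T" "E facet_of T" and n: "normal_to n E" and dim: "2 \<le> DIM('a)"
    and ball: "cball x r \<subseteq> T" "0 \<le> r"
  shows "2 * r \<le> diameter E"
proof -
  note E = facet_aff_dim[OF T]
  obtain a where a: "a \<in> T" "T = convex hull (insert a E)" "\<And>y. y \<in> E \<Longrightarrow> (a - y) \<bullet> n \<noteq> 0"
    using facet_apex[OF T n] by blast
  obtain y where y: "y \<in> E" using E by blast
  obtain u0 where u0: "u0 \<noteq> 0" "orthogonal n u0"
    using orthogonal_to_vector_exists[OF dim] by blast
  define u where "u = u0 /\<^sub>R norm u0"
  have u: "norm u = 1" "u \<bullet> n = 0"
    using u0 by (simp_all add: u_def orthogonal_def inner_commute)
  have p: "x + r *\<^sub>R u \<in> T" "x - r *\<^sub>R u \<in> T"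
    using ball u by (auto intro!: subsetD[OF ball(1)] simp: dist_norm)
  obtain s b where s: "0 \<le> s" "s \<le> 1" "b \<in> E" "x + r *\<^sub>R u = s *\<^sub>R a + (1 - s) *\<^sub>R b"
      "\<And>y. y \<in> E \<Longrightarrow> (x + r *\<^sub>R u - y) \<bullet> n = s * ((a - y) \<bullet> n)"
    using facet_cone_coordinates[OF a(2) E(2,4) n p(1)] by blast
  obtain t c where t: "0 \<le> t" "t \<le> 1" "c \<in> E" "x - r *\<^sub>R u = t *\<^sub>R a + (1 - t) *\<^sub>R c"
      "\<And>y. y \<in> E \<Longrightarrow> (x - r *\<^sub>R u - y) \<bullet> n = t * ((a - y) \<bullet> n)"
    using facet_cone_coordinates[OF a(2) E(2,4) n p(2)] by blast
  have "s * ((a - y) \<bullet> n) = t * ((a - y) \<bullet> n)"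
    unfolding s(5)[OF y, symmetric] t(5)[OF y, symmetric]
    using u(2) by (simp add: inner_diff_left inner_add_left)
  then have st: "s = t" using a(3)[OF y] by simp
  have "(2 * r) *\<^sub>R u = (x + r *\<^sub>R u) - (x - r *\<^sub>R u)"
    by (simp add: scaleR_2[symmetric])
  also have "\<dots> = (1 - t) *\<^sub>R (b - c)"
    unfolding s(4) t(4) st by (simp add: algebra_simps)
  finally have "norm ((2 * r) *\<^sub>R u) = norm ((1 - t) *\<^sub>R (b - c))" by simp
  then have "2 * r = (1 - t) * dist b c"
    using u(1) ball(2) t(2) by (simp add: dist_norm)
  also have "\<dots> \<le> dist b c" using t(1,2) by (simp add: mult_left_le_one_le)
  also have "\<dots> \<le> diameter E"
    by (rule diameter_bounded_bound[OF compact_imp_bounded[OF E(3)] s(3) t(3)])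
  finally show ?thesis .
qed

lemma inradius_le_diameter_facet:
  fixes T :: "'a::euclidean_space set"
  assumes T: "full_simplex T" "E facet_of T" and n: "normal_to n E" and dim: "2 \<le> DIM('a)"
  shows "2 * inradius T \<le> diameter E"
proof -
  obtain y where "y \<in> T" using full_simplex_basics(3)[OF T(1)] by blast
  then have "0 \<in> {r. r \<ge> 0 \<and> (\<exists>x. cball x r \<subseteq> T)}"
    by (auto intro!: exI[of _ y])
  then have "{r. r \<ge> 0 \<and> (\<exists>x. cball x r \<subseteq> T)} \<noteq> {}"
    by blast
  moreover have "r \<le> diameter E / 2" if "r \<in> {r. r \<ge> 0 \<and> (\<exists>x. cball x r \<subseteq> T)}" for r
    using cball_subset_simplex_le_diameter_facet[OF assms] that by force
  ultimately have "inradius T \<le> diameter E / 2"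
    unfolding inradius_def by (rule cSup_least)
  then show ?thesis by simp
qed

lemma measure_simplex_ge_inradius:
  fixes T :: "'a::euclidean_space set"
  assumes T: "full_simplex T" and s: "0 < s" "s < inradius T"
  shows "unit_ball_vol DIM('a) * s ^ DIM('a) \<le> measure lebesgue T"
proof -
  obtain y where "y \<in> T" using full_simplex_basics(3)[OF T(1)] by blast
  then have "0 \<in> {r. r \<ge> 0 \<and> (\<exists>x. cball x r \<subseteq> T)}"
    by (auto intro!: exI[of _ y])
  then have ne: "{r. r \<ge> 0 \<and> (\<exists>x. cball x r \<subseteq> T)} \<noteq> {}"
    by blast
  obtain r x where r: "s < r" "cball x r \<subseteq> T"
    using less_cSupE[OF s(2)[unfolded inradius_def] ne] by blast
  then have sub: "cball x s \<subseteq> T" using subset_cball[of s r x] by auto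
  have "unit_ball_vol DIM('a) * s ^ DIM('a) = measure lebesgue (cball x s)"
    using s by (simp add: content_cball)
  also have "\<dots> \<le> measure lebesgue T"
    using full_simplex_basics(2)[OF T] by (intro measure_mono_fmeasurable[OF sub]) (auto intro: lmeasurable_compact)
  finally show ?thesis .
qed

lemma measure_le_diameter:
  fixes T :: "'a::euclidean_space set"
  assumes "compact T" "x \<in> T"
  shows "measure lebesgue T \<le> unit_ball_vol DIM('a) * diameter T ^ DIM('a)"
proof -
  have b: "bounded T" using assms compact_imp_bounded by blast
  have "T \<subseteq> cball x (diameter T)"
    using diameter_bounded_bound[OF b assms(2)] by auto
  then have "measure lebesgue T \<le> measure lebesgue (cball x (diameter T))"
    using assms by (intro measure_mono_fmeasurable) (auto intro: lmeasurable_compact fmeasurableD)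
  also have "\<dots> = unit_ball_vol DIM('a) * diameter T ^ DIM('a)"
    using diameter_ge_0[OF b] by (simp add: content_cball)
  finally show ?thesis .
qed

lemma surface_measure_facet:
  fixes E :: "(real^'n) set"
  assumes "normal_to n E" "compact E" "M > 0" "diameter E \<le> M" "2 \<le> CARD('n)"
  shows "emeasure surface_measure E < \<infinity>"
    "measure surface_measure E \<le> unit_ball_vol (real (CARD('n) - 1)) * (3 * real (CARD('n) - 1) * M) ^ (CARD('n) - 1)"
proof -
  let ?k = "CARD('n) - 1"
  have k: "?k > 0" using assms(5) by simp
  have "emeasure surface_measure E = hausdorff_outer ?k E"
    unfolding surface_measure_def using assms(2) k
    by (intro emeasure_hausdorff_measure) (auto intro: borel_compact)
  also have "\<dots> \<le> ennreal (unit_ball_vol ?k * (3 * real ?k * M) ^ ?k)"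
    using hausdorff_outer_hyperplane_le[OF assms(1) compact_imp_bounded[OF assms(2)] assms(3,4) refl k] .
  finally have le: "emeasure surface_measure E \<le> ennreal (unit_ball_vol ?k * (3 * real ?k * M) ^ ?k)" .
  then show "emeasure surface_measure E < \<infinity>"
    using le_less_trans by fastforce
  show "measure surface_measure E \<le> unit_ball_vol ?k * (3 * real ?k * M) ^ ?k"
    unfolding measure_def using le assms(3) by (intro enn2real_leI) auto
qed

text \<open>
  All sizes are compared with the diameter \<open>D\<close> of the common facet. For \<open>K\<close>, use that \<open>D\<close> is at most the
  diameter and hence a multiple of the inradius. For \<open>T\<close>, use that the inradius, and hence a multiple of
  the diameter, is at most \<open>D / 2\<close>. The left-hand side is then of order \<open>D powr (d / 2 + d - 1)\<close>, and
  the excess power of \<open>D\<close> over \<open>D ^ d\<close> is bounded by the corresponding power of \<open>M\<close>.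
\<close>

lemma shape_regular_scaling:
  fixes c M :: real
  assumes c: "c > 0" and M: "M > 0" and dim: "2 \<le> CARD('n::finite)"
  obtains C where "C > 0" "\<And>(T :: (real^'n) set) K E n. full_simplex T \<Longrightarrow> full_simplex K \<Longrightarrow>
      E facet_of T \<Longrightarrow> E facet_of K \<Longrightarrow> normal_to n E \<Longrightarrow> diameter E \<le> M \<Longrightarrow>
      diameter T \<le> c * inradius T \<Longrightarrow> diameter K \<le> c * inradius K \<Longrightarrow>
      sqrt (measure lebesgue T) * measure surface_measure E \<le> C * measure lebesgue K"
proof -
  let ?d = "CARD('n)" and ?k = "CARD('n) - 1"
  define V where "V = unit_ball_vol (real ?d)"
  define H where "H = unit_ball_vol (real ?k) * (3 * real ?k) ^ ?k"
  define C where "C = sqrt (V * (c / 2) ^ ?d) * sqrt (M ^ (?d - 2)) * H * (2 * c) ^ ?d / V"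
  have V: "V > 0" by (simp add: V_def)
  have H: "H > 0" using dim by (simp add: H_def)
  have "C > 0" using V H c M by (simp add: C_def)
  moreover have "sqrt (measure lebesgue T) * measure surface_measure E \<le> C * measure lebesgue K"
    if T: "full_simplex T" and K: "full_simplex K" and E: "E facet_of T" "E facet_of K"
      and n: "normal_to n E" and EM: "diameter E \<le> M"
      and rT: "diameter T \<le> c * inradius T" and rK: "diameter K \<le> c * inradius K"
    for T K E :: "(real^'n) set" and n
  proof -
    define D where "D = diameter E"
    note FE = facet_aff_dim[OF T E(1)] and FK = facet_aff_dim[OF K E(2)]
    have "inradius K > 0"
    proof -
      obtain z r where zr: "r > 0" "cball z r \<subseteq> K"
        using full_simplex_basics(5)[OF K] mem_interior_cball by blast
      have bK: "bounded K" using full_simplex_basics(2)[OF K] compact_imp_bounded by blast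
      obtain w :: "real^'n" where w: "norm w = r" using vector_choose_size[of r] zr by auto
      have "dist z (z + w) \<le> diameter K"
        by (rule diameter_bounded_bound[OF bK]) (use zr w in \<open>auto simp: dist_norm intro!: subsetD[OF zr(2)]\<close>)
      then have "0 < c * inradius K" using w zr(1) rK by (simp add: dist_norm)
      then show ?thesis using c by (simp add: zero_less_mult_iff)
    qed
    then have D: "D > 0"
      using inradius_le_diameter_facet[OF K E(2) n] dim by (simp add: D_def)
    have DK: "D / c \<le> inradius K"
    proof -
      have "D \<le> diameter K"
        unfolding D_def
        by (rule diameter_subset[OF FK(5) compact_imp_bounded[OF full_simplex_basics(2)[OF K]]])
      then show ?thesis using rK c by (simp add: field_simps)
    qed
    have volK: "V * (D / (2 * c)) ^ ?d \<le> measure lebesgue K"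
      using measure_simplex_ge_inradius[OF K, of "D / (2 * c)"] D c DK
      by (simp add: V_def field_simps)
    have volT: "measure lebesgue T \<le> V * (c / 2) ^ ?d * D ^ ?d"
    proof -
      obtain x where "x \<in> T" using full_simplex_basics(3)[OF T] by blast
      then have "measure lebesgue T \<le> V * diameter T ^ ?d"
        using measure_le_diameter[OF full_simplex_basics(2)[OF T]] by (simp add: V_def)
      also have "\<dots> \<le> V * (c / 2 * D) ^ ?d"
      proof (intro mult_left_mono power_mono)
        have "2 * inradius T \<le> D"
          using inradius_le_diameter_facet[OF T E(1) n] dim by (simp add: D_def)
        then have "c * (2 * inradius T) \<le> c * D" using c by (intro mult_left_mono) auto
        then show "diameter T \<le> c / 2 * D" using rT by simp
        show "0 \<le> diameter T"
          by (rule diameter_ge_0[OF compact_imp_bounded[OF full_simplex_basics(2)[OF T]]])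
      qed (use V in simp)
      finally show ?thesis unfolding power_mult_distrib by (simp only: mult.assoc)
    qed
    have surf: "measure surface_measure E \<le> H * D ^ ?k"
      using surface_measure_facet(2)[OF n FE(3) D[unfolded D_def] order_refl dim]
      by (simp add: H_def D_def power_mult_distrib mult.assoc)
    have pow: "D ^ ?d = D\<^sup>2 * D ^ (?d - 2)"
      using dim by (metis le_add_diff_inverse power_add)
    have "sqrt (measure lebesgue T) \<le> sqrt (V * (c / 2) ^ ?d) * (D * sqrt (M ^ (?d - 2)))"
    proof -
      have "sqrt (measure lebesgue T) \<le> sqrt (V * (c / 2) ^ ?d * (D\<^sup>2 * M ^ (?d - 2)))"
      proof (rule real_sqrt_le_mono)
        have "D ^ (?d - 2) \<le> M ^ (?d - 2)"
          using D EM by (intro power_mono) (auto simp: D_def)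
        then have "V * (c / 2) ^ ?d * (D\<^sup>2 * D ^ (?d - 2)) \<le> V * (c / 2) ^ ?d * (D\<^sup>2 * M ^ (?d - 2))"
          using V c by (intro mult_left_mono) auto
        then show "measure lebesgue T \<le> V * (c / 2) ^ ?d * (D\<^sup>2 * M ^ (?d - 2))"
          using volT unfolding pow by linarith
      qed
      then show ?thesis using D by (simp add: real_sqrt_mult)
    qed
    then have "sqrt (measure lebesgue T) * measure surface_measure E
        \<le> (sqrt (V * (c / 2) ^ ?d) * (D * sqrt (M ^ (?d - 2)))) * (H * D ^ ?k)"
      using V c D M by (intro mult_mono surf) auto
    also have "\<dots> = C * (V * (D / (2 * c)) ^ ?d)"
    proof -
      have "D * D ^ ?k = D ^ ?d" using dim by (simp flip: power_Suc)
      then show ?thesis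
        using V c by (simp add: C_def power_divide field_simps)
    qed
    also have "\<dots> \<le> C * measure lebesgue K"
      using \<open>C > 0\<close> by (intro mult_left_mono volK) auto
    finally show ?thesis .
  qed
  ultimately show ?thesis using that by blast
qed

section \<open>The space of square integrable functions\<close>

lemma norm_sum_square_le:
  fixes a b :: "'a::real_normed_vector"
  shows "(norm (a + b))\<^sup>2 \<le> 2 * (norm a)\<^sup>2 + 2 * (norm b)\<^sup>2"
proof -
  have "(norm (a + b))\<^sup>2 \<le> (norm a + norm b)\<^sup>2"
    by (intro power_mono norm_triangle_ineq) simp
  also have "\<dots> \<le> 2 * (norm a)\<^sup>2 + 2 * (norm b)\<^sup>2"
    using sum_squares_bound[of "norm a" "norm b"] by (simp add: power2_sum)
  finally show ?thesis .
qed

lemma L2_space_add: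
  assumes u: "u \<in> L2_space M UNIV" and w: "w \<in> L2_space M UNIV"
  shows "(\<lambda>x. u x + w x) \<in> L2_space M (UNIV :: 'b::euclidean_space set)"
proof -
  have [measurable]: "u \<in> borel_measurable M" "w \<in> borel_measurable M"
    and i: "integrable M (\<lambda>x. (norm (u x))\<^sup>2)" "integrable M (\<lambda>x. (norm (w x))\<^sup>2)"
    using u w by (auto simp: L2_space_def)
  have "integrable M (\<lambda>x. (norm (u x + w x))\<^sup>2)"
  proof (rule Bochner_Integration.integrable_bound)
    show "integrable M (\<lambda>x. 2 * (norm (u x))\<^sup>2 + 2 * (norm (w x))\<^sup>2)" using i by simp
    show "AE x in M. norm ((norm (u x + w x))\<^sup>2) \<le> norm (2 * (norm (u x))\<^sup>2 + 2 * (norm (w x))\<^sup>2)"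
      using norm_sum_square_le[of "u _" "w _"] by (intro AE_I2) simp
  qed measurable
  then show ?thesis by (simp add: L2_space_def)
qed

lemma L2_space_linear:
  fixes L :: "'b::euclidean_space \<Rightarrow> 'c::euclidean_space"
  assumes L: "linear L" and u: "u \<in> L2_space M UNIV"
  shows "(\<lambda>x. L (u x)) \<in> L2_space M UNIV"
proof -
  have bl: "bounded_linear L" using L linear_conv_bounded_linear by blast
  obtain B where B: "\<And>x. norm (L x) \<le> norm x * B"
    using bounded_linear.bounded[OF bl] by blast
  have um: "u \<in> borel_measurable M" and i: "integrable M (\<lambda>x. (norm (u x))\<^sup>2)"
    using u by (auto simp: L2_space_def)
  have "L \<in> borel_measurable borel"
    by (intro borel_measurable_continuous_onI linear_continuous_on bl)
  then have m: "(\<lambda>x. L (u x)) \<in> borel_measurable M"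
    using measurable_compose[OF um] by blast
  have "integrable M (\<lambda>x. (norm (L (u x)))\<^sup>2)"
  proof (rule Bochner_Integration.integrable_bound)
    show "integrable M (\<lambda>x. B\<^sup>2 * (norm (u x))\<^sup>2)" using i by simp
    show "AE x in M. norm ((norm (L (u x)))\<^sup>2) \<le> norm (B\<^sup>2 * (norm (u x))\<^sup>2)"
    proof (rule AE_I2)
      fix x
      have "(norm (L (u x)))\<^sup>2 \<le> (norm (u x) * B)\<^sup>2"
        by (intro power_mono B) simp
      then show "norm ((norm (L (u x)))\<^sup>2) \<le> norm (B\<^sup>2 * (norm (u x))\<^sup>2)"
        by (simp add: power_mult_distrib mult.commute)
    qed
  qed (use m in measurable)
  then show ?thesis using m by (simp add: L2_space_def)
qed

lemma L2_space_const:
  fixes c :: "'b::euclidean_space"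
  assumes "finite_measure M"
  shows "(\<lambda>x. c) \<in> L2_space M UNIV"
  using assms by (simp add: L2_space_def finite_measure.integrable_const)

lemma L2_norm_nonneg: "0 \<le> L2_norm M u"
  by (simp add: L2_norm_def)

lemma L2_norm_square: "(L2_norm M u)\<^sup>2 = (\<integral>x. (norm (u x))\<^sup>2 \<partial>M)"
  by (simp add: L2_norm_def)

text \<open>
  The weighted inequality \<open>(p + q)\<^sup>2 \<le> (1 + s) p\<^sup>2 + (1 + 1 / s) q\<^sup>2\<close> is integrated and then optimised over the
  weight \<open>s\<close>.
\<close>

lemma L2_norm_triangle:
  fixes u w :: "'a \<Rightarrow> 'b::euclidean_space"
  assumes u: "u \<in> L2_space M UNIV" and w: "w \<in> L2_space M UNIV"
  shows "L2_norm M (\<lambda>x. u x + w x) \<le> L2_norm M u + L2_norm M w"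
proof -
  define a where "a = L2_norm M u"
  define b where "b = L2_norm M w"
  have a: "a \<ge> 0" "a\<^sup>2 = (\<integral>x. (norm (u x))\<^sup>2 \<partial>M)" and b: "b \<ge> 0" "b\<^sup>2 = (\<integral>x. (norm (w x))\<^sup>2 \<partial>M)"
    by (simp_all add: a_def b_def L2_norm_nonneg L2_norm_square)
  have i: "integrable M (\<lambda>x. (norm (u x))\<^sup>2)" "integrable M (\<lambda>x. (norm (w x))\<^sup>2)"
    "integrable M (\<lambda>x. (norm (u x + w x))\<^sup>2)"
    using u w L2_space_add[OF u w] by (auto simp: L2_space_def)
  have bound: "(\<integral>x. (norm (u x + w x))\<^sup>2 \<partial>M) \<le> (1 + s) * a\<^sup>2 + (1 + 1 / s) * b\<^sup>2" if s: "s > 0" for s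
  proof -
    have pt: "(norm (u x + w x))\<^sup>2 \<le> (1 + s) * (norm (u x))\<^sup>2 + (1 + 1 / s) * (norm (w x))\<^sup>2" for x
    proof -
      let ?p = "norm (u x)" and ?q = "norm (w x)"
      have "0 \<le> (s * ?p - ?q)\<^sup>2 / s" using s by simp
      also have "\<dots> = s * ?p\<^sup>2 + ?q\<^sup>2 / s - 2 * ?p * ?q"
        using s by (simp add: power2_eq_square field_simps)
      finally have "2 * ?p * ?q \<le> s * ?p\<^sup>2 + ?q\<^sup>2 / s" by simp
      moreover have "(norm (u x + w x))\<^sup>2 \<le> (?p + ?q)\<^sup>2"
        by (intro power_mono norm_triangle_ineq) simp
      ultimately show ?thesis by (simp add: power2_sum algebra_simps)
    qed
    have "(\<integral>x. (norm (u x + w x))\<^sup>2 \<partial>M)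
        \<le> (\<integral>x. (1 + s) * (norm (u x))\<^sup>2 + (1 + 1 / s) * (norm (w x))\<^sup>2 \<partial>M)"
      using i pt by (intro integral_mono) auto
    then show ?thesis using i by (simp add: a b)
  qed
  have "(\<integral>x. (norm (u x + w x))\<^sup>2 \<partial>M) \<le> (a + b)\<^sup>2 + e * (a + b)" if e: "e > 0" for e
  proof -
    \<comment> \<open>The optimal weight is \<open>b / a\<close>; the shift by \<open>e\<close> keeps it positive and finite.\<close>
    let ?s = "(b + e) / (a + e)"
    have "(\<integral>x. (norm (u x + w x))\<^sup>2 \<partial>M) \<le> (1 + ?s) * a\<^sup>2 + (1 + 1 / ?s) * b\<^sup>2"
      using a b e by (intro bound) auto
    also have "\<dots> = a\<^sup>2 + b\<^sup>2 + (b + e) * (a\<^sup>2 / (a + e)) + (a + e) * (b\<^sup>2 / (b + e))"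
      by (simp add: algebra_simps)
    also have "\<dots> \<le> a\<^sup>2 + b\<^sup>2 + (b + e) * a + (a + e) * b"
    proof -
      have le: "a\<^sup>2 / (a + e) \<le> a" "b\<^sup>2 / (b + e) \<le> b"
        using a(1) b(1) e by (auto simp: power2_eq_square field_simps)
      have "(b + e) * (a\<^sup>2 / (a + e)) \<le> (b + e) * a"
        by (rule mult_left_mono[OF le(1)]) (use b(1) e in simp)
      moreover have "(a + e) * (b\<^sup>2 / (b + e)) \<le> (a + e) * b"
        by (rule mult_left_mono[OF le(2)]) (use a(1) e in simp)
      ultimately show ?thesis by linarith
    qed
    also have "\<dots> = (a + b)\<^sup>2 + e * (a + b)"
      by (simp add: power2_eq_square algebra_simps)
    finally show ?thesis .
  qed
  note eps = this
  have "(\<integral>x. (norm (u x + w x))\<^sup>2 \<partial>M) \<le> (a + b)\<^sup>2"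
  proof (rule field_le_epsilon)
    fix e :: real assume e: "e > 0"
    have "e / (a + b + 1) * (a + b) \<le> e"
      using a b e by (simp add: field_simps)
    then show "(\<integral>x. (norm (u x + w x))\<^sup>2 \<partial>M) \<le> (a + b)\<^sup>2 + e"
      using eps[of "e / (a + b + 1)"] a b e by (auto simp: add_nonneg_pos)
  qed
  then show ?thesis
    using a b by (simp add: L2_norm_def[of M "\<lambda>x. u x + w x"] a_def[symmetric] b_def[symmetric] real_le_lsqrt)
qed

lemma L2_norm_const:
  fixes c :: "'b::euclidean_space"
  assumes "A \<in> sets M" "emeasure M A < \<infinity>"
  shows "L2_norm (restrict_space M A) (\<lambda>x. c) = norm c * sqrt (measure M A)"
proof -
  have "measure (restrict_space M A) (space (restrict_space M A)) = measure M A"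
    using assms sets.sets_into_space[OF assms(1)]
    by (simp add: measure_restrict_space space_restrict_space Int_absorb2)
  then show ?thesis
    by (simp add: L2_norm_def real_sqrt_mult mult.commute)
qed

lemma L2_norm_const_residual_diff:
  fixes g :: "'a \<Rightarrow> 'b::euclidean_space"
  assumes A: "A \<in> sets M" "emeasure M A < \<infinity>" and g: "g \<in> L2_space (restrict_space M A) UNIV"
  shows "\<bar>L2_norm (restrict_space M A) (\<lambda>x. g x - c) - L2_norm (restrict_space M A) (\<lambda>x. g x - c')\<bar>
    \<le> norm (c - c') * sqrt (measure M A)"
proof -
  let ?R = "restrict_space M A"
  have "finite_measure ?R"
    using A sets.sets_into_space[OF A(1)]
    by (intro finite_measureI) (simp add: emeasure_restrict_space space_restrict_space Int_absorb2)
  note const = L2_space_const[OF this]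
  have "L2_norm ?R (\<lambda>x. g x - b) \<le> L2_norm ?R (\<lambda>x. g x - b') + norm (b - b') * sqrt (measure M A)" for b b'
  proof -
    have "(\<lambda>x. g x + (- b')) \<in> L2_space ?R UNIV"
      by (rule L2_space_add[OF g const])
    from L2_norm_triangle[OF this const[of "b' - b"]]
    show ?thesis
      unfolding L2_norm_const[OF A] by (simp add: norm_minus_commute)
  qed
  from this[of c c'] this[of c' c] show ?thesis
    by (simp add: norm_minus_commute abs_le_iff)
qed

lemma norm_matrix_vector_le:
  fixes A :: "real^'n^'m"
  shows "norm (A *v x) \<le> norm A * norm x"
proof -
  have "(norm (A *v x))\<^sup>2 = (\<Sum>i\<in>UNIV. (A $ i \<bullet> x)\<^sup>2)"
    by (simp add: norm_vec_def L2_set_def sum_nonneg matrix_vector_mult_def inner_vec_def)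
  also have "\<dots> \<le> (\<Sum>i\<in>UNIV. (norm (A $ i))\<^sup>2 * (norm x)\<^sup>2)"
    by (intro sum_mono) (metis Cauchy_Schwarz_ineq power2_norm_eq_inner)
  also have "\<dots> = (norm A * norm x)\<^sup>2"
    by (simp add: norm_vec_def[of A] L2_set_def sum_nonneg power_mult_distrib sum_distrib_right)
  finally show ?thesis
    by (rule power2_le_imp_le) simp
qed

lemma L2_space_surface_subset:
  fixes g :: "real^'n \<Rightarrow> 'b::euclidean_space"
  assumes g: "g \<in> L2_space (restrict_space surface_measure A) UNIV" and B: "B \<subseteq> A" "B \<in> sets borel" "A \<in> sets borel"
  shows "g \<in> L2_space (restrict_space surface_measure B) UNIV"
proof -
  have [simp]: "sets (surface_measure :: (real^'n) measure) = sets borel"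
    by (simp add: surface_measure_def)
  have [simp]: "space (surface_measure :: (real^'n) measure) = UNIV"
    using sets_eq_imp_space_eq[of surface_measure "borel :: (real^'n) measure"] by simp
  have m: "g \<in> borel_measurable (restrict_space surface_measure B)"
    by (rule measurable_restrict_mono[OF _ B(1)]) (use g in \<open>simp add: L2_space_def\<close>)
  have "integrable surface_measure (\<lambda>x. indicator A x *\<^sub>R (norm (g x))\<^sup>2)"
    using g B by (simp add: L2_space_def integrable_restrict_space)
  then have "integrable surface_measure (\<lambda>x. indicator B x *\<^sub>R (indicator A x *\<^sub>R (norm (g x))\<^sup>2))"
    by (rule integrable_mult_indicator[rotated]) (use B in simp)
  also have "(\<lambda>x. indicator B x *\<^sub>R (indicator A x *\<^sub>R (norm (g x))\<^sup>2)) = (\<lambda>x. indicator B x *\<^sub>R (norm (g x))\<^sup>2)"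
    using B(1) by (auto simp: indicator_def fun_eq_iff)
  finally have "integrable (restrict_space surface_measure B) (\<lambda>x. (norm (g x))\<^sup>2)"
    using B by (simp add: integrable_restrict_space)
  then show ?thesis using m by (simp add: L2_space_def)
qed

section \<open>Sums over elements and sides\<close>

lemma sqrt_add_square_lipschitz:
  fixes a b r :: real
  assumes "0 \<le> r"
  shows "\<bar>sqrt (r + a\<^sup>2) - sqrt (r + b\<^sup>2)\<bar> \<le> \<bar>a - b\<bar>"
proof -
  have "\<bar>norm (sqrt r, a) - norm (sqrt r, b)\<bar> \<le> norm ((sqrt r, a) - (sqrt r, b))"
    by (rule norm_triangle_ineq3)
  then show ?thesis using assms by (simp add: norm_Pair)
qed

lemma L2_set_diff_le: "\<bar>L2_set f A - L2_set h A\<bar> \<le> L2_set (\<lambda>i. f i - h i) A"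
proof -
  have "L2_set f A \<le> L2_set (\<lambda>i. f i - h i) A + L2_set h A" for f h :: "_ \<Rightarrow> real"
    using L2_set_triangle_ineq[of "\<lambda>i. f i - h i" h A] by simp
  from this[of f h] this[of h f] show ?thesis
    by (simp add: L2_set_def power2_commute abs_le_iff)
qed

text \<open>
  The triangle inequality for the Euclidean norm, applied to the sides of an element, to an element, and
  to the elements of \<open>S\<close>. The common terms \<open>\<alpha> T\<close> cancel.
\<close>

lemma sqrt_sum_estimators_diff:
  fixes \<alpha> \<beta> :: "'a \<Rightarrow> real" and r s :: "'a \<Rightarrow> 'b \<Rightarrow> real"
  assumes nonneg: "\<And>T. T \<in> S \<Longrightarrow> 0 \<le> \<alpha> T" "\<And>T. T \<in> S \<Longrightarrow> 0 \<le> \<beta> T"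
  shows "\<bar>sqrt (\<Sum>T\<in>S. \<alpha> T + \<beta> T * (\<Sum>E\<in>F T. (r T E)\<^sup>2)) - sqrt (\<Sum>T\<in>S. \<alpha> T + \<beta> T * (\<Sum>E\<in>F T. (s T E)\<^sup>2))\<bar>
    \<le> sqrt (\<Sum>T\<in>S. \<beta> T * (\<Sum>E\<in>F T. (r T E - s T E)\<^sup>2))"
proof -
  define \<eta> where "\<eta> q T = sqrt (\<alpha> T + (sqrt (\<beta> T) * L2_set (q T) (F T))\<^sup>2)" for q T
  have sq: "(sqrt (\<beta> T) * L2_set f (F T))\<^sup>2 = \<beta> T * (\<Sum>E\<in>F T. (f E)\<^sup>2)" if "T \<in> S" for T f
    using nonneg(2)[OF that] by (simp add: power_mult_distrib L2_set_def sum_nonneg)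
  have eq: "sqrt (\<Sum>T\<in>S. \<alpha> T + \<beta> T * (\<Sum>E\<in>F T. (q T E)\<^sup>2)) = L2_set (\<eta> q) S" for q
    unfolding L2_set_def[of _ S] \<eta>_def using nonneg
    by (intro arg_cong[where f = sqrt] sum.cong) (auto simp: sq sum_nonneg)
  have "\<bar>L2_set (\<eta> r) S - L2_set (\<eta> s) S\<bar> \<le> L2_set (\<lambda>T. \<eta> r T - \<eta> s T) S"
    by (rule L2_set_diff_le)
  also have "\<dots> \<le> sqrt (\<Sum>T\<in>S. \<beta> T * (\<Sum>E\<in>F T. (r T E - s T E)\<^sup>2))"
    unfolding L2_set_def
  proof (intro real_sqrt_le_mono sum_mono)
    fix T assume T: "T \<in> S"
    have "\<bar>\<eta> r T - \<eta> s T\<bar> \<le> \<bar>sqrt (\<beta> T) * L2_set (r T) (F T) - sqrt (\<beta> T) * L2_set (s T) (F T)\<bar>"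
      unfolding \<eta>_def by (rule sqrt_add_square_lipschitz[OF nonneg(1)[OF T]])
    also have "\<dots> = sqrt (\<beta> T) * \<bar>L2_set (r T) (F T) - L2_set (s T) (F T)\<bar>"
      using nonneg(2)[OF T] by (simp add: abs_mult flip: right_diff_distrib)
    also have "\<dots> \<le> sqrt (\<beta> T) * L2_set (\<lambda>E. r T E - s T E) (F T)"
      using nonneg(2)[OF T] by (intro mult_left_mono L2_set_diff_le) simp
    finally have "(\<eta> r T - \<eta> s T)\<^sup>2 \<le> (sqrt (\<beta> T) * L2_set (\<lambda>E. r T E - s T E) (F T))\<^sup>2"
      by (intro abs_le_square_iff[THEN iffD1]) linarith
    then show "(\<eta> r T - \<eta> s T)\<^sup>2 \<le> \<beta> T * (\<Sum>E\<in>F T. (r T E - s T E)\<^sup>2)"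
      by (simp add: sq[OF T])
  qed
  finally show ?thesis unfolding eq .
qed

text \<open>
  Double counting: each \<open>K\<close> has at most \<open>N\<close> incident \<open>E\<close>, and each \<open>E\<close> is met by at most \<open>m\<close> elements \<open>T\<close>.
\<close>

lemma sum_over_incident_pairs_le:
  fixes w :: "'a \<Rightarrow> real" and F :: "'a \<Rightarrow> 'b set"
  assumes fin: "finite \<K>" "\<And>K. K \<in> \<K> \<Longrightarrow> finite (F K)" and S: "S \<subseteq> \<K>"
    and N: "\<And>K. K \<in> \<K> \<Longrightarrow> card (F K) \<le> N"
    and m: "\<And>E. card {K \<in> \<K>. E \<in> F K} \<le> m"
    and w: "\<And>K. K \<in> \<K> \<Longrightarrow> 0 \<le> w K"
  shows "(\<Sum>T\<in>S. \<Sum>E\<in>F T. \<Sum>K | K \<in> \<K> \<and> E \<in> F K. w K) \<le> real (m * N) * (\<Sum>K\<in>\<K>. w K)"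
proof -
  define A where "A = (\<Union>K\<in>\<K>. F K)"
  define h where "h E = (\<Sum>K | K \<in> \<K> \<and> E \<in> F K. w K)" for E
  have A: "finite A" using fin by (auto simp: A_def)
  have h: "0 \<le> h E" for E unfolding h_def by (intro sum_nonneg) (auto simp: w)
  have sub: "F K = {E \<in> A. E \<in> F K}" if "K \<in> \<K>" for K using that by (auto simp: A_def)
  have "(\<Sum>T\<in>S. \<Sum>E\<in>F T. h E) \<le> (\<Sum>T\<in>\<K>. \<Sum>E\<in>F T. h E)"
    by (intro sum_mono2 fin S sum_nonneg h)
  also have "\<dots> = (\<Sum>T\<in>\<K>. \<Sum>E | E \<in> A \<and> E \<in> F T. h E)"
    by (intro sum.cong refl) (use sub in auto)
  also have "\<dots> = (\<Sum>E\<in>A. \<Sum>T | T \<in> \<K> \<and> E \<in> F T. h E)"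
    by (rule sum.swap_restrict[OF fin(1) A])
  also have "\<dots> = (\<Sum>E\<in>A. real (card {T \<in> \<K>. E \<in> F T}) * h E)"
    by simp
  also have "\<dots> \<le> (\<Sum>E\<in>A. real m * h E)"
    by (intro sum_mono mult_right_mono h) (simp add: m)
  also have "\<dots> = real m * (\<Sum>E\<in>A. \<Sum>K | K \<in> \<K> \<and> E \<in> F K. w K)"
    by (simp add: h_def sum_distrib_left)
  also have "(\<Sum>E\<in>A. \<Sum>K | K \<in> \<K> \<and> E \<in> F K. w K) = (\<Sum>K\<in>\<K>. \<Sum>E | E \<in> A \<and> E \<in> F K. w K)"
    by (rule sum.swap_restrict[OF A fin(1)])
  also have "\<dots> = (\<Sum>K\<in>\<K>. real (card (F K)) * w K)"
    by (intro sum.cong refl) (simp add: sub[symmetric])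
  also have "\<dots> \<le> (\<Sum>K\<in>\<K>. real N * w K)"
    by (intro sum_mono mult_right_mono w) (auto simp: N)
  also have "\<dots> = real N * (\<Sum>K\<in>\<K>. w K)"
    by (simp add: sum_distrib_left)
  finally show ?thesis
    by (simp add: h_def mult.assoc mult_left_mono)
qed

section \<open>Stresses of discrete states\<close>

lemma weak_grad_spec:
  assumes "v \<in> H1_space \<Omega>"
  shows "weak_grad \<Omega> v \<in> L2_space (lebesgue_on \<Omega>) UNIV" "is_weak_grad \<Omega> v (weak_grad \<Omega> v)"
proof -
  have "\<exists>G. G \<in> L2_space (lebesgue_on \<Omega>) UNIV \<and> is_weak_grad \<Omega> v G"
    using assms by (auto simp: H1_space_def)
  from someI_ex[OF this]
  show "weak_grad \<Omega> v \<in> L2_space (lebesgue_on \<Omega>) UNIV" "is_weak_grad \<Omega> v (weak_grad \<Omega> v)"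
    by (simp_all add: weak_grad_def)
qed

lemma stress_in_L2:
  fixes \<C> :: "real^'n^'n \<Rightarrow> real^'n^'n"
  assumes C: "linear \<C>" and v: "v \<in> H1_space \<Omega>" and q: "q \<in> Q_space \<Omega>"
  shows "stress \<C> \<Omega> v q \<in> L2_space (lebesgue_on \<Omega>) UNIV"
proof -
  have "linear (\<lambda>G :: real^'n^'n. (1/2) *\<^sub>R (G + transpose G))"
    by (rule linearI) (auto simp: vec_eq_iff transpose_def algebra_simps)
  from L2_space_linear[OF this weak_grad_spec(1)[OF v]]
  have eps: "(\<lambda>x. strain \<Omega> v x) \<in> L2_space (lebesgue_on \<Omega>) UNIV"
    by (simp add: strain_def)
  have "q \<in> L2_space (lebesgue_on \<Omega>) UNIV"
    using q by (auto simp: Q_space_def L2_space_def)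
  from L2_space_linear[OF _ this, of uminus]
  have "(\<lambda>x. - q x) \<in> L2_space (lebesgue_on \<Omega>) UNIV"
    by (simp add: linear_uminus)
  from L2_space_linear[OF C L2_space_add[OF eps this]]
  show ?thesis by (simp add: stress_def[abs_def])
qed

lemma L2_space_component_integrable:
  fixes G :: "real^'n \<Rightarrow> real^'m^'k"
  assumes "G \<in> L2_space (lebesgue_on \<Omega>) UNIV" "open \<Omega>" "bounded \<Omega>"
  shows "integrable (lebesgue_on \<Omega>) (\<lambda>x. G x $ i $ j)"
proof (rule Bochner_Integration.integrable_bound)
  have fin: "finite_measure (lebesgue_on \<Omega>)"
    using assms(2,3) by (intro finite_measure_lebesgue_on bounded_set_imp_lmeasurable) auto
  show "integrable (lebesgue_on \<Omega>) (\<lambda>x. 1 + (norm (G x))\<^sup>2)"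
    using assms(1) fin by (intro Bochner_Integration.integrable_add)
      (auto simp: L2_space_def finite_measure.integrable_const)
  have Gm: "G \<in> borel_measurable (lebesgue_on \<Omega>)" using assms(1) by (auto simp: L2_space_def)
  have "(\<lambda>A :: real^'m^'k. A $ i $ j) \<in> borel_measurable borel"
    by (intro borel_measurable_continuous_onI continuous_intros)
  then show "(\<lambda>x. G x $ i $ j) \<in> borel_measurable (lebesgue_on \<Omega>)"
    using measurable_compose[OF Gm] by blast
  show "AE x in lebesgue_on \<Omega>. norm (G x $ i $ j) \<le> norm (1 + (norm (G x))\<^sup>2)"
  proof (rule AE_I2)
    fix x
    have "\<bar>G x $ i $ j\<bar> \<le> norm (G x)"
      using component_le_norm_cart[of "G x $ i" j] Finite_Cartesian_Product.norm_nth_le[of "G x" i] by linarith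
    also have "\<dots> \<le> 1 + (norm (G x))\<^sup>2"
    proof -
      have "2 * norm (G x) \<le> 1 + (norm (G x))\<^sup>2"
        using sum_squares_bound[of 1 "norm (G x)"] by simp
      then show ?thesis using norm_ge_zero[of "G x"] by linarith
    qed
    finally show "norm (G x $ i $ j) \<le> norm (1 + (norm (G x))\<^sup>2)" by simp
  qed
qed

lemma simplex_frontier_AE:
  fixes T :: "'a::euclidean_space set"
  assumes "full_simplex T"
  shows "AE x in lebesgue. x \<in> T \<longrightarrow> x \<in> interior T"
proof (rule AE_I')
  show "frontier T \<in> null_sets lebesgue"
    using negligible_convex_frontier[OF full_simplex_basics(1)[OF assms]]
    by (simp add: negligible_iff_null_sets)
  show "{x \<in> space lebesgue. \<not> (x \<in> T \<longrightarrow> x \<in> interior T)} \<subseteq> frontier T"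
    using closure_subset[of T] by (auto simp: frontier_def)
qed

lemma simplex_Int_open_sets:
  fixes T \<Omega> :: "'a::euclidean_space set"
  assumes "full_simplex T" "open \<Omega>"
  shows "T \<inter> \<Omega> \<in> sets lebesgue"
proof -
  have "T \<in> sets lebesgue"
    by (rule fmeasurableD[OF lmeasurable_compact[OF full_simplex_basics(2)[OF assms(1)]]])
  moreover have "\<Omega> \<in> sets lebesgue" using assms(2) by simp
  ultimately show ?thesis by (rule sets.Int)
qed

text \<open>
  The element differs from its interior by a null set, and the interior is not a null set, so at most one
  constant is attained almost everywhere.
\<close>

lemma elt_value_eqI:
  fixes T \<Omega> :: "(real^'n) set"
  assumes T: "full_simplex T" "interior T \<subseteq> \<Omega>" and \<Omega>: "open \<Omega>"
    and AE: "AE x in lebesgue. x \<in> interior T \<longrightarrow> \<tau> x = c"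
  shows "elt_value \<Omega> \<tau> T = c"
proof -
  have S: "T \<inter> \<Omega> \<in> sets lebesgue"
    by (rule simplex_Int_open_sets[OF T(1) \<Omega>])
  have iff: "(AE x in lebesgue_on (T \<inter> \<Omega>). \<tau> x = b) \<longleftrightarrow> (AE x in lebesgue. x \<in> T \<inter> \<Omega> \<longrightarrow> \<tau> x = b)" for b
    using S by (intro AE_restrict_space_iff) simp
  show ?thesis
    unfolding elt_value_def
  proof (rule the_equality)
    show "AE x in lebesgue_on (T \<inter> \<Omega>). \<tau> x = c"
      unfolding iff using AE simplex_frontier_AE[OF T(1)] by eventually_elim blast
    fix b assume "AE x in lebesgue_on (T \<inter> \<Omega>). \<tau> x = b"
    then have "AE x in lebesgue. x \<in> T \<inter> \<Omega> \<longrightarrow> \<tau> x = b" unfolding iff .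
    with AE have ae: "AE x in lebesgue. x \<in> interior T \<longrightarrow> b = c"
      by eventually_elim (use T(2) interior_subset[of T] in blast)
    show "b = c"
    proof (rule ccontr)
      assume "b \<noteq> c"
      with ae have "AE x in lebesgue. x \<notin> interior T" by simp
      then have "interior T \<in> null_sets lebesgue"
        using AE_iff_null_sets[of "interior T" lebesgue] by simp
      then have "negligible (interior T)" by (simp add: negligible_iff_null_sets)
      then show False
        using open_not_negligible[of "interior T"] full_simplex_basics(5)[OF T(1)] by simp
    qed
  qed
qed

text \<open>
  This justifies \<^const>\<open>elt_value\<close>, which is a definite description, for the stresses of discrete states.
\<close>

lemma stress_AE_const:
  fixes \<T> :: "('n::finite) mesh" and \<C> :: "real^'n^'n \<Rightarrow> real^'n^'n"
  assumes \<Omega>: "open \<Omega>" "lipschitz_boundary \<Omega>" and mesh: "is_mesh \<Omega> \<T>"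
    and z: "(v, q, \<beta>) \<in> X_discrete \<Omega> \<Gamma>D \<T>" and T: "T \<in> elements \<T>"
  shows "AE x in lebesgue. x \<in> interior T \<longrightarrow> stress \<C> \<Omega> v q x = elt_value \<Omega> (stress \<C> \<Omega> v q) T"
proof -
  note m = is_mesh_elements[OF mesh]
  have sT: "full_simplex T" by (rule m(2)[OF T])
  have "interior T \<subseteq> interior (closure \<Omega>)"
    by (rule interior_mono[OF m(6)[OF T]])
  then have sub: "interior T \<subseteq> \<Omega>"
    using lipschitz_boundary_interior_closure[OF \<Omega>(2,1)] by blast
  have "compact (closure \<Omega>)"
    unfolding m(5)[symmetric] using m(1,2) full_simplex_basics(2) by (intro compact_Union) auto
  then have b\<Omega>: "bounded \<Omega>" using bounded_subset[OF compact_imp_bounded closure_subset] by blast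
  have S: "T \<inter> \<Omega> \<in> sets lebesgue"
    by (rule simplex_Int_open_sets[OF sT \<Omega>(1)])
  have AE_T: "AE x in lebesgue. x \<in> interior T \<longrightarrow> P x" if "AE x in lebesgue_on (T \<inter> \<Omega>). P x" for P
  proof -
    have "AE x in lebesgue. x \<in> T \<inter> \<Omega> \<longrightarrow> P x"
      using that S by (subst (asm) AE_restrict_space_iff) auto
    then show ?thesis
      by eventually_elim (use sub interior_subset[of T] in blast)
  qed
  have v: "v \<in> H1_space \<Omega>" using z by (auto simp: X_discrete_def V_discrete_def V_space_def)
  obtain A b where "AE x in lebesgue_on (T \<inter> \<Omega>). v x = A *v x + b"
    using z T by (auto simp: X_discrete_def V_discrete_def)
  then have affine: "AE x in lebesgue. x \<in> interior T \<longrightarrow> v x = A *v x + b" by (rule AE_T)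
  obtain c where "AE x in lebesgue_on (T \<inter> \<Omega>). q x = c"
    using z T by (auto simp: X_discrete_def Q_discrete_def)
  then have qc: "AE x in lebesgue. x \<in> interior T \<longrightarrow> q x = c" by (rule AE_T)
  have bT: "bounded (interior T)"
    using full_simplex_basics(2)[OF sT] compact_imp_bounded bounded_interior by blast
  have vm: "v \<in> borel_measurable (lebesgue_on \<Omega>)"
    using v by (auto simp: H1_space_def L2_space_def)
  have "AE x in lebesgue. x \<in> interior T \<longrightarrow> weak_grad \<Omega> v x = A"
    by (rule weak_grad_eq_AE_of_affine[OF weak_grad_spec(2)[OF v] \<Omega>(1) open_interior bT sub affine
        L2_space_component_integrable[OF weak_grad_spec(1)[OF v] \<Omega>(1) b\<Omega>] vm])
  with qc have *: "AE x in lebesgue. x \<in> interior T \<longrightarrow>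
      stress \<C> \<Omega> v q x = \<C> ((1/2) *\<^sub>R (A + transpose A) - c)"
    by eventually_elim (simp add: stress_def strain_def)
  show ?thesis
    unfolding elt_value_eqI[OF sT sub \<Omega>(1) *] by (rule *)
qed

text \<open>
  The interiors of the elements are disjoint, and they carry the full measure of the elements.
\<close>

lemma sum_element_integrals_le:
  fixes \<T> :: "('n::finite) mesh" and \<delta> :: "real^'n \<Rightarrow> 'b::euclidean_space"
  assumes \<Omega>: "open \<Omega>" "lipschitz_boundary \<Omega>" and mesh: "is_mesh \<Omega> \<T>"
    and \<delta>: "\<delta> \<in> L2_space (lebesgue_on \<Omega>) UNIV"
    and const: "\<And>K. K \<in> elements \<T> \<Longrightarrow> AE x in lebesgue. x \<in> interior K \<longrightarrow> \<delta> x = c K"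
  shows "(\<Sum>K\<in>elements \<T>. measure lebesgue K * (norm (c K))\<^sup>2) \<le> (L2_norm (lebesgue_on \<Omega>) \<delta>)\<^sup>2"
proof -
  note m = is_mesh_elements[OF mesh]
  have sub: "interior K \<subseteq> \<Omega>" if "K \<in> elements \<T>" for K
    using interior_mono[OF m(6)[OF that]] lipschitz_boundary_interior_closure[OF \<Omega>(2,1)] by blast
  have [simp]: "\<Omega> \<in> sets lebesgue" using \<Omega> by auto
  let ?f = "\<lambda>x. indicator \<Omega> x * (norm (\<delta> x))\<^sup>2"
  have int: "integrable lebesgue ?f"
    using \<delta> by (simp add: L2_space_def integrable_restrict_space)
  have int_K: "integrable lebesgue (\<lambda>x. indicator (interior K) x * ?f x)" for K
    using integrable_mult_indicator[OF _ int, of "interior K"] by simp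
  have elem: "measure lebesgue K * (norm (c K))\<^sup>2 = (\<integral>x. indicator (interior K) x * ?f x \<partial>lebesgue)"
    if K: "K \<in> elements \<T>" for K
  proof -
    have cK: "compact K" "convex K" using m(2)[OF K] full_simplex_basics by auto
    have "(\<integral>x. indicator (interior K) x * ?f x \<partial>lebesgue) = (\<integral>x. indicator (interior K) x * (norm (c K))\<^sup>2 \<partial>lebesgue)"
    proof (rule integral_cong_AE)
      show "AE x in lebesgue. indicator (interior K) x * ?f x = indicator (interior K) x * (norm (c K))\<^sup>2"
        using const[OF K] by eventually_elim (use sub[OF K] in \<open>auto simp: indicator_def\<close>)
      show "(\<lambda>x. indicator (interior K) x * ?f x) \<in> borel_measurable lebesgue"
        using int_K by blast
      show "(\<lambda>x. indicator (interior K) x * (norm (c K))\<^sup>2) \<in> borel_measurable lebesgue"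
        by (intro borel_measurable_times borel_measurable_indicator) auto
    qed
    also have "\<dots> = measure lebesgue (interior K) * (norm (c K))\<^sup>2"
      by simp
    also have "measure lebesgue (interior K) = measure lebesgue K"
      by (rule measure_interior[OF compact_imp_bounded[OF cK(1)] negligible_convex_frontier[OF cK(2)]])
    finally show ?thesis by simp
  qed
  have disj: "interior K \<inter> interior K' = {}" if K: "K \<in> elements \<T>" "K' \<in> elements \<T>" "K \<noteq> K'" for K K'
  proof -
    have "K \<inter> K' \<noteq> K \<or> K \<inter> K' \<noteq> K'" using K(3) by blast
    then have "(K \<inter> K') \<inter> interior K = {} \<or> (K \<inter> K') \<inter> interior K' = {}"
      using face_of_disjoint_interior[OF m(3)[OF K(1,2)]] face_of_disjoint_interior[OF m(4)[OF K(2,1)]] by blast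
    then show ?thesis using interior_subset[of K] interior_subset[of K'] by blast
  qed
  have "(\<Sum>K\<in>elements \<T>. measure lebesgue K * (norm (c K))\<^sup>2)
      = (\<integral>x. (\<Sum>K\<in>elements \<T>. indicator (interior K) x * ?f x) \<partial>lebesgue)"
    using elem int_K by (simp add: Bochner_Integration.integral_sum)
  also have "\<dots> \<le> (\<integral>x. ?f x \<partial>lebesgue)"
  proof (rule integral_mono[OF _ int])
    show "integrable lebesgue (\<lambda>x. \<Sum>K\<in>elements \<T>. indicator (interior K) x * ?f x)"
      by (intro Bochner_Integration.integrable_sum int_K)
    fix x
    have "(\<Sum>K\<in>elements \<T>. indicator (interior K) x * ?f x)
        = indicator (\<Union>K\<in>elements \<T>. interior K) x * ?f x"
      using disj m(1) by (subst indicator_UN_disjoint)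
        (auto simp: disjoint_family_on_def sum_distrib_right)
    then show "(\<Sum>K\<in>elements \<T>. indicator (interior K) x * ?f x) \<le> ?f x"
      by (simp add: mult_left_le_one_le)
  qed
  also have "\<dots> = (L2_norm (lebesgue_on \<Omega>) \<delta>)\<^sup>2"
    by (simp add: L2_norm_square integral_restrict_space)
  finally show ?thesis .
qed

section \<open>Stability of the estimator\<close>

lemma square_abs_le_two_sum:
  fixes r a b s :: real
  assumes "\<bar>r\<bar> \<le> (a + b) * sqrt s" "0 \<le> s" "0 \<le> a" "0 \<le> b"
  shows "r\<^sup>2 \<le> 2 * s * (a\<^sup>2 + b\<^sup>2)"
proof -
  have "r\<^sup>2 \<le> ((a + b) * sqrt s)\<^sup>2"
    using power_mono[OF assms(1), of 2] by simp
  also have "\<dots> = (a + b)\<^sup>2 * s"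
    using assms by (simp add: power_mult_distrib)
  also have "\<dots> \<le> (2 * a\<^sup>2 + 2 * b\<^sup>2) * s"
    using sum_squares_bound[of a b] assms by (intro mult_right_mono) (auto simp: power2_sum)
  finally show ?thesis by (simp add: algebra_simps)
qed

text \<open>
  A mesh and a refinement of it, with a discrete state on each. Refinement is captured by the
  inclusion of elements.
\<close>

locale refined_mesh =
  fixes \<Omega> \<Gamma>D :: "(real^'n::finite) set" and g :: "real^'n \<Rightarrow> real^'n"
    and \<C> :: "real^'n^'n \<Rightarrow> real^'n^'n" and \<nu> :: "(real^'n) set \<Rightarrow> real^'n"
    and \<T> \<T>' :: "'n mesh"
    and v v' :: "real^'n \<Rightarrow> real^'n" and q q' :: "real^'n \<Rightarrow> real^'n^'n" and \<beta> \<beta>' :: "real^'n \<Rightarrow> real"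
  assumes dim: "2 \<le> CARD('n)"
    and \<Omega>: "open \<Omega>" "lipschitz_boundary \<Omega>" and \<Gamma>D: "closed \<Gamma>D"
    and g: "g \<in> L2_space (restrict_space surface_measure (frontier \<Omega> - \<Gamma>D)) UNIV"
    and linear_C: "linear \<C>"
    and mesh: "is_mesh \<Omega> \<T>" and mesh': "is_mesh \<Omega> \<T>'"
    and refines: "\<And>K. K \<in> elements \<T>' \<Longrightarrow> \<exists>T \<in> elements \<T>. K \<subseteq> T"
    and normals: "\<And>T E. T \<in> elements \<T>' \<Longrightarrow> E \<in> sides T \<Longrightarrow> normal_to (\<nu> E) E"
    and z: "(v, q, \<beta>) \<in> X_discrete \<Omega> \<Gamma>D \<T>" and z': "(v', q', \<beta>') \<in> X_discrete \<Omega> \<Gamma>D \<T>'"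
begin

definition stress_diff :: "real^'n \<Rightarrow> real^'n^'n" where
  "stress_diff x = stress \<C> \<Omega> v' q' x - stress \<C> \<Omega> v q x"

definition elt_diff :: "(real^'n) set \<Rightarrow> real^'n^'n" where
  "elt_diff K = elt_value \<Omega> stress_diff K"

lemma interior_subset_domain: "K \<in> elements \<T>' \<Longrightarrow> interior K \<subseteq> \<Omega>"
  using interior_mono[OF is_mesh_elements(6)[OF mesh']] lipschitz_boundary_interior_closure[OF \<Omega>(2,1)]
  by blast

lemma stress_diff_AE:
  assumes K: "K \<in> elements \<T>'" and T: "T \<in> elements \<T>" "K \<subseteq> T"
  shows "AE x in lebesgue. x \<in> interior K \<longrightarrow>
      stress_diff x = elt_value \<Omega> (stress \<C> \<Omega> v' q') K - elt_value \<Omega> (stress \<C> \<Omega> v q) T"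
  using stress_AE_const[OF \<Omega> mesh' z' K, of \<C>] stress_AE_const[OF \<Omega> mesh z T(1), of \<C>]
  by eventually_elim (use interior_mono[OF T(2)] in \<open>auto simp: stress_diff_def\<close>)

text \<open>
  The value on a fine element is obtained from any coarse element that contains it.
\<close>

lemma elt_diff_eq:
  assumes K: "K \<in> elements \<T>'" and T: "T \<in> elements \<T>" "K \<subseteq> T"
  shows "elt_diff K = elt_value \<Omega> (stress \<C> \<Omega> v' q') K - elt_value \<Omega> (stress \<C> \<Omega> v q) T"
  unfolding elt_diff_def
  by (rule elt_value_eqI[OF is_mesh_elements(2)[OF mesh' K] interior_subset_domain[OF K] \<Omega>(1)
      stress_diff_AE[OF assms]])

lemma sum_elt_diff_le:
  "(\<Sum>K\<in>elements \<T>'. measure lebesgue K * (norm (elt_diff K))\<^sup>2) \<le> (err_measure \<C> \<Omega> (v', q', \<beta>') (v, q, \<beta>))\<^sup>2"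
proof -
  have H1: "v \<in> H1_space \<Omega>" "v' \<in> H1_space \<Omega>" "q \<in> Q_space \<Omega>" "q' \<in> Q_space \<Omega>"
    using z z' by (auto simp: X_discrete_def V_discrete_def V_space_def Q_discrete_def)
  have "(\<lambda>x. - stress \<C> \<Omega> v q x) \<in> L2_space (lebesgue_on \<Omega>) UNIV"
    by (rule L2_space_linear[OF _ stress_in_L2[OF linear_C H1(1,3)], of uminus]) (simp add: linear_uminus)
  from L2_space_add[OF stress_in_L2[OF linear_C H1(2,4)] this]
  have "stress_diff \<in> L2_space (lebesgue_on \<Omega>) UNIV"
    by (simp add: stress_diff_def[abs_def])
  then have "(\<Sum>K\<in>elements \<T>'. measure lebesgue K * (norm (elt_diff K))\<^sup>2)
      \<le> (L2_norm (lebesgue_on \<Omega>) stress_diff)\<^sup>2"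
  proof (rule sum_element_integrals_le[OF \<Omega> mesh'])
    fix K assume K: "K \<in> elements \<T>'"
    obtain T where T: "T \<in> elements \<T>" "K \<subseteq> T" using refines[OF K] by blast
    show "AE x in lebesgue. x \<in> interior K \<longrightarrow> stress_diff x = elt_diff K"
      unfolding elt_diff_eq[OF K T] by (rule stress_diff_AE[OF K T])
  qed
  then show ?thesis
    by (simp add: err_measure_def stress_diff_def[abs_def])
qed

lemma facet_surface:
  assumes T: "T \<in> elements \<T>'" "E \<in> sides T"
  shows "compact E" "E \<in> sets borel" "emeasure surface_measure E < \<infinity>"
proof -
  have F: "full_simplex T" "E facet_of T"
    using T is_mesh_elements(2)[OF mesh'] by (auto simp: sides_def)
  show cE: "compact E" by (rule facet_aff_dim(3)[OF F])
  then show "E \<in> sets borel" by (rule borel_compact)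
  show "emeasure surface_measure E < \<infinity>"
    by (rule surface_measure_facet(1)[OF normals[OF T] cE _ _ dim, of "max 1 (diameter E)"]) auto
qed

text \<open>
  For an interior side the jumps on the two meshes are attached to possibly different neighbours, but the
  fine neighbours are contained in the coarse ones, so the difference is the jump of the difference of the
  stresses on the fine mesh.
\<close>

lemma side_residual_diff:
  assumes T: "T \<in> elements \<T>" "T \<in> elements \<T>'" and E: "E \<in> sides T"
  shows "(side_residual \<Omega> \<Gamma>D g \<C> \<nu> \<T>' (v', q', \<beta>') E - side_residual \<Omega> \<Gamma>D g \<C> \<nu> \<T> (v, q, \<beta>) E)\<^sup>2
    \<le> 2 * measure surface_measure E * (\<Sum>K | K \<in> elements \<T>' \<and> E \<in> sides K. (norm (elt_diff K))\<^sup>2)"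
    (is "(?R' - ?R)\<^sup>2 \<le> 2 * ?\<mu> * ?S")
proof -
  note n = normals[OF T(2) E]
  have norm_n: "norm (\<nu> E) = 1" using n by (simp add: normal_to_def)
  have Mv: "norm (A *v \<nu> E) \<le> norm A" for A :: "real^'n^'n"
    using norm_matrix_vector_le[of A "\<nu> E"] norm_n by simp
  have S: "0 \<le> ?S" by (intro sum_nonneg) simp
  have finK: "finite {K. K \<in> elements \<T>' \<and> E \<in> sides K}"
    using is_mesh_elements(1)[OF mesh'] by simp
  have sets_eq: "sets (surface_measure :: (real^'n) measure) = sets borel"
    by (simp add: surface_measure_def)
  note fs = facet_surface[OF T(2) E]
  consider "\<not> E \<subseteq> frontier \<Omega>" | "E \<subseteq> frontier \<Omega>" "E \<subseteq> \<Gamma>D" | "E \<subseteq> frontier \<Omega>" "\<not> E \<subseteq> \<Gamma>D"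
    by blast
  then show ?thesis
  proof cases
    case 1
    define K where "K = elt_towards \<T>' E (\<nu> E)"
    define L where "L = elt_towards \<T>' E (- \<nu> E)"
    have K: "K \<in> elements \<T>'" "E \<in> sides K" "towards K E (\<nu> E)"
      using elt_towards_interior[OF mesh' \<Omega>(1) n T(2) E 1] by (auto simp: K_def)
    have L: "L \<in> elements \<T>'" "E \<in> sides L" "towards L E (- \<nu> E)"
      using elt_towards_interior[OF mesh' \<Omega>(1) normal_to_minus[OF n] T(2) E 1] by (auto simp: L_def)
    have "K \<noteq> L"
    proof
      assume "K = L"
      then show False
        using towards_or[OF is_mesh_elements(2)[OF mesh' K(1)] _ n] K L by (auto simp: sides_def)
    qed
    have oldK: "elt_towards \<T> E (\<nu> E) \<in> elements \<T>" "K \<subseteq> elt_towards \<T> E (\<nu> E)"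
      using elt_towards_interior[OF mesh \<Omega>(1) n T(1) E 1]
        elt_towards_subset[OF mesh mesh' \<Omega>(1) n refines T E 1] by (auto simp: K_def)
    have oldL: "elt_towards \<T> E (- \<nu> E) \<in> elements \<T>" "L \<subseteq> elt_towards \<T> E (- \<nu> E)"
      using elt_towards_interior[OF mesh \<Omega>(1) normal_to_minus[OF n] T(1) E 1]
        elt_towards_subset[OF mesh mesh' \<Omega>(1) normal_to_minus[OF n] refines T E 1] by (auto simp: L_def)
    let ?J' = "jump \<Omega> \<T>' (stress \<C> \<Omega> v' q') E (\<nu> E)" and ?J = "jump \<Omega> \<T> (stress \<C> \<Omega> v q) E (\<nu> E)"
    have J: "?J' - ?J = elt_diff K - elt_diff L"
      unfolding jump_def elt_diff_eq[OF K(1) oldK] elt_diff_eq[OF L(1) oldL]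
      by (simp add: K_def L_def)
    have R: "?R' = norm (?J' *v \<nu> E) * sqrt ?\<mu>" "?R = norm (?J *v \<nu> E) * sqrt ?\<mu>"
      using 1 L2_norm_const[OF fs(2)[folded sets_eq] fs(3)] by (simp_all add: side_residual_def)
    have "\<bar>?R' - ?R\<bar> = \<bar>norm (?J' *v \<nu> E) - norm (?J *v \<nu> E)\<bar> * sqrt ?\<mu>"
      unfolding R by (simp add: abs_mult flip: left_diff_distrib)
    also have "\<dots> \<le> (norm (elt_diff K) + norm (elt_diff L)) * sqrt ?\<mu>"
    proof (intro mult_right_mono)
      have "\<bar>norm (?J' *v \<nu> E) - norm (?J *v \<nu> E)\<bar> \<le> norm ((?J' - ?J) *v \<nu> E)"
        unfolding matrix_vector_mult_diff_rdistrib by (rule norm_triangle_ineq3)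
      also have "\<dots> \<le> norm (elt_diff K - elt_diff L)" unfolding J by (rule Mv)
      also have "\<dots> \<le> norm (elt_diff K) + norm (elt_diff L)" by (rule norm_triangle_ineq4)
      finally show "\<bar>norm (?J' *v \<nu> E) - norm (?J *v \<nu> E)\<bar> \<le> norm (elt_diff K) + norm (elt_diff L)" .
    qed simp
    finally have "(?R' - ?R)\<^sup>2 \<le> 2 * ?\<mu> * ((norm (elt_diff K))\<^sup>2 + (norm (elt_diff L))\<^sup>2)"
      by (intro square_abs_le_two_sum) auto
    also have "\<dots> = 2 * ?\<mu> * (\<Sum>K\<in>{K, L}. (norm (elt_diff K))\<^sup>2)"
      using \<open>K \<noteq> L\<close> by simp
    also have "\<dots> \<le> 2 * ?\<mu> * ?S"
      using K L finK by (intro mult_left_mono sum_mono2) auto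
    finally show ?thesis .
  next
    case 2
    then show ?thesis using S by (simp add: side_residual_def)
  next
    case 3
    let ?A = "E \<inter> (frontier \<Omega> - \<Gamma>D)"
    have A: "frontier \<Omega> - \<Gamma>D \<in> sets borel" "?A \<in> sets borel"
      using fs(2) \<Gamma>D by (auto intro!: sets.Int sets.Diff)
    have A_le: "emeasure surface_measure ?A \<le> emeasure surface_measure E"
      using fs(2) by (intro emeasure_mono) (auto simp: sets_eq)
    have A_fin: "emeasure surface_measure ?A < \<infinity>"
      using le_less_trans[OF A_le fs(3)] .
    have mA: "measure surface_measure ?A \<le> ?\<mu>"
      unfolding measure_def using A_le fs(3) by (intro enn2real_mono) auto
    have gA: "g \<in> L2_space (restrict_space surface_measure ?A) UNIV"
      by (rule L2_space_surface_subset[OF g _ A(2,1)]) blast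
    let ?c' = "elt_value \<Omega> (stress \<C> \<Omega> v' q') T *v \<nu> E" and ?c = "elt_value \<Omega> (stress \<C> \<Omega> v q) T *v \<nu> E"
    have "?R' = L2_norm (restrict_space surface_measure ?A) (\<lambda>x. g x - ?c')"
      "?R = L2_norm (restrict_space surface_measure ?A) (\<lambda>x. g x - ?c)"
      using 3 boundary_elt_eq[OF mesh' \<Omega> n T(2) E 3(1)] boundary_elt_eq[OF mesh \<Omega> n T(1) E 3(1)]
      by (simp_all add: side_residual_def)
    then have "\<bar>?R' - ?R\<bar> \<le> norm (?c' - ?c) * sqrt (measure surface_measure ?A)"
      using L2_norm_const_residual_diff[OF A(2)[folded sets_eq] A_fin gA, of ?c' ?c] by simp
    also have "\<dots> \<le> (norm (elt_diff T) + 0) * sqrt ?\<mu>"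
    proof (intro mult_mono real_sqrt_le_mono mA)
      have "?c' - ?c = elt_diff T *v \<nu> E"
        unfolding elt_diff_eq[OF T(2,1) subset_refl] matrix_vector_mult_diff_rdistrib ..
      then show "norm (?c' - ?c) \<le> norm (elt_diff T) + 0" using Mv by simp
    qed auto
    finally have "(?R' - ?R)\<^sup>2 \<le> 2 * ?\<mu> * ((norm (elt_diff T))\<^sup>2 + 0\<^sup>2)"
      by (intro square_abs_le_two_sum) auto
    also have "\<dots> = 2 * ?\<mu> * (\<Sum>K\<in>{T}. (norm (elt_diff K))\<^sup>2)"
      by simp
    also have "\<dots> \<le> 2 * ?\<mu> * ?S"
      using T E finK by (intro mult_left_mono sum_mono2) auto
    finally show ?thesis .
  qed
qed

text \<open>
  With the scaling inequality, each squared difference of residuals is bounded by the integrals of the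
  squared difference of the stresses over the at most two fine elements at that side. In the constant, 4 is the product of the 2 from
  \<open>side_residual_diff\<close> and the 2 elements at a side, and \<open>d + 1\<close> bounds the number of sides of an element.
\<close>

lemma estimator_diff:
  assumes S: "S \<subseteq> elements \<T> \<inter> elements \<T>'" and C: "0 \<le> C"
    and scaling: "\<And>T K E. T \<in> elements \<T>' \<Longrightarrow> K \<in> elements \<T>' \<Longrightarrow> E \<in> sides T \<Longrightarrow> E \<in> sides K \<Longrightarrow>
      sqrt (measure lebesgue T) * measure surface_measure E \<le> C * measure lebesgue K"
  shows "\<bar>sqrt (\<Sum>T\<in>S. eta_sq \<Omega> \<Gamma>D f g \<C> \<nu> \<T>' (v', q', \<beta>') T) -
      sqrt (\<Sum>T\<in>S. eta_sq \<Omega> \<Gamma>D f g \<C> \<nu> \<T> (v, q, \<beta>) T)\<bar>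
    \<le> sqrt (4 * C * real (CARD('n) + 1)) * err_measure \<C> \<Omega> (v', q', \<beta>') (v, q, \<beta>)"
proof -
  let ?R' = "side_residual \<Omega> \<Gamma>D g \<C> \<nu> \<T>' (v', q', \<beta>')" and ?R = "side_residual \<Omega> \<Gamma>D g \<C> \<nu> \<T> (v, q, \<beta>)"
  let ?w = "\<lambda>K. measure lebesgue K * (norm (elt_diff K))\<^sup>2"
  let ?d = "err_measure \<C> \<Omega> (v', q', \<beta>') (v, q, \<beta>)"
  note m' = is_mesh_elements[OF mesh']
  have pair: "sqrt (measure lebesgue T) * (?R' E - ?R E)\<^sup>2 \<le> 2 * C * (\<Sum>K | K \<in> elements \<T>' \<and> E \<in> sides K. ?w K)"
    if T: "T \<in> S" and E: "E \<in> sides T" for T E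
  proof -
    have T2: "T \<in> elements \<T>" "T \<in> elements \<T>'" using T S by auto
    have "sqrt (measure lebesgue T) * (?R' E - ?R E)\<^sup>2
        \<le> sqrt (measure lebesgue T) * (2 * measure surface_measure E *
          (\<Sum>K | K \<in> elements \<T>' \<and> E \<in> sides K. (norm (elt_diff K))\<^sup>2))"
      by (intro mult_left_mono side_residual_diff[OF T2 E]) simp
    also have "\<dots> = (\<Sum>K | K \<in> elements \<T>' \<and> E \<in> sides K.
        2 * ((sqrt (measure lebesgue T) * measure surface_measure E) * (norm (elt_diff K))\<^sup>2))"
      by (simp add: sum_distrib_left mult_ac)
    also have "\<dots> \<le> (\<Sum>K | K \<in> elements \<T>' \<and> E \<in> sides K. 2 * ((C * measure lebesgue K) * (norm (elt_diff K))\<^sup>2))"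
      using T2 E by (intro sum_mono mult_left_mono mult_right_mono scaling) auto
    also have "\<dots> = 2 * C * (\<Sum>K | K \<in> elements \<T>' \<and> E \<in> sides K. ?w K)"
      by (simp add: sum_distrib_left mult_ac)
    finally show ?thesis .
  qed
  have two: "card {K \<in> elements \<T>'. E \<in> sides K} \<le> 2" for E
  proof (cases "{K \<in> elements \<T>'. E \<in> sides K} = {}")
    case False
    then have n: "normal_to (\<nu> E) E" using normals by blast
    have "{K \<in> elements \<T>'. E \<in> sides K} \<subseteq> {elt_towards \<T>' E (\<nu> E), elt_towards \<T>' E (- \<nu> E)}"
      using elt_towards_cases[OF mesh' n] by blast
    then have "card {K \<in> elements \<T>'. E \<in> sides K} \<le> card {elt_towards \<T>' E (\<nu> E), elt_towards \<T>' E (- \<nu> E)}"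
      by (intro card_mono) auto
    also have "\<dots> \<le> 2" by (simp add: card_insert_if)
    finally show ?thesis .
  next
    case True
    show ?thesis unfolding True by simp
  qed
  have "\<bar>sqrt (\<Sum>T\<in>S. eta_sq \<Omega> \<Gamma>D f g \<C> \<nu> \<T>' (v', q', \<beta>') T) - sqrt (\<Sum>T\<in>S. eta_sq \<Omega> \<Gamma>D f g \<C> \<nu> \<T> (v, q, \<beta>) T)\<bar>
      \<le> sqrt (\<Sum>T\<in>S. sqrt (measure lebesgue T) * (\<Sum>E\<in>sides T. (?R' E - ?R E)\<^sup>2))"
    unfolding eta_sq_def by (rule sqrt_sum_estimators_diff) auto
  also have "\<dots> \<le> sqrt (4 * C * real (CARD('n) + 1) * ?d\<^sup>2)"
  proof (rule real_sqrt_le_mono)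
    have "(\<Sum>T\<in>S. sqrt (measure lebesgue T) * (\<Sum>E\<in>sides T. (?R' E - ?R E)\<^sup>2))
        \<le> (\<Sum>T\<in>S. \<Sum>E\<in>sides T. 2 * C * (\<Sum>K | K \<in> elements \<T>' \<and> E \<in> sides K. ?w K))"
      unfolding sum_distrib_left by (intro sum_mono) (use pair in \<open>simp add: sum_distrib_left\<close>)
    also have "\<dots> = 2 * C * (\<Sum>T\<in>S. \<Sum>E\<in>sides T. \<Sum>K | K \<in> elements \<T>' \<and> E \<in> sides K. ?w K)"
      by (simp add: sum_distrib_left)
    also have "\<dots> \<le> 2 * C * (real (2 * (CARD('n) + 1)) * (\<Sum>K\<in>elements \<T>'. ?w K))"
      using S C two m'(1) finite_card_sides[OF m'(2)]
      by (intro mult_left_mono sum_over_incident_pairs_le) auto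
    also have "\<dots> \<le> 2 * C * (real (2 * (CARD('n) + 1)) * ?d\<^sup>2)"
      using C by (intro mult_left_mono sum_elt_diff_le) auto
    also have "\<dots> = 4 * C * real (CARD('n) + 1) * ?d\<^sup>2"
      by simp
    finally show "(\<Sum>T\<in>S. sqrt (measure lebesgue T) * (\<Sum>E\<in>sides T. (?R' E - ?R E)\<^sup>2))
        \<le> 4 * C * real (CARD('n) + 1) * ?d\<^sup>2" .
  qed
  also have "\<dots> = sqrt (4 * C * real (CARD('n) + 1)) * ?d"
  proof -
    have "0 \<le> ?d" by (simp add: err_measure_def L2_norm_nonneg)
    then show ?thesis by (simp add: real_sqrt_mult)
  qed
  finally show ?thesis .
qed

end

theorem lemma1:
  fixes \<Omega> \<Gamma>D :: "(real^'n) set"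
    and f g :: "real^'n \<Rightarrow> real^'n"
    and \<C> :: "real^'n^'n \<Rightarrow> real^'n^'n" and \<kappa> :: real
    and \<T>0 :: "'n mesh"
    and \<nu> :: "(real^'n) set \<Rightarrow> real^'n"
  assumes "CARD('n) = 2 \<or> CARD('n) = 3"
    and "open \<Omega>" and "connected \<Omega>" and "\<Omega> \<noteq> {}" and "lipschitz_boundary \<Omega>"
    and "closed \<Gamma>D" and "\<Gamma>D \<noteq> {}" and "\<Gamma>D \<subseteq> frontier \<Omega>" and "emeasure surface_measure \<Gamma>D > 0"
    and "f \<in> L2_space (lebesgue_on \<Omega>) UNIV"
    and "g \<in> L2_space (restrict_space surface_measure (frontier \<Omega> - \<Gamma>D)) UNIV"
    and "elasticity_tensor \<C> \<kappa>"
    and "is_mesh \<Omega> \<T>0"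
    and "uniformly_shape_regular (NVB_meshes \<Omega> \<T>0)"
    and "unit_normals (NVB_meshes \<Omega> \<T>0) \<nu>"
  shows "\<exists>C1>0. \<forall>\<T> \<in> NVB_meshes \<Omega> \<T>0. \<forall>\<T>' \<in> NVB_meshes \<Omega> \<T>.
           \<forall>S. S \<subseteq> elements \<T> \<inter> elements \<T>' \<longrightarrow>
             (\<forall>z \<in> X_discrete \<Omega> \<Gamma>D \<T>. \<forall>z' \<in> X_discrete \<Omega> \<Gamma>D \<T>'.
               \<bar>sqrt (\<Sum>T\<in>S. eta_sq \<Omega> \<Gamma>D f g \<C> \<nu> \<T>' z' T) -
                sqrt (\<Sum>T\<in>S. eta_sq \<Omega> \<Gamma>D f g \<C> \<nu> \<T> z T)\<bar>
               \<le> C1 * err_measure \<C> \<Omega> z' z)"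
proof -
  have dim: "2 \<le> CARD('n)" using assms(1) by auto
  obtain c where c: "c > 0" "\<And>\<T> T. \<T> \<in> NVB_meshes \<Omega> \<T>0 \<Longrightarrow> T \<in> elements \<T> \<Longrightarrow> diameter T \<le> c * inradius T"
    using assms(14) unfolding uniformly_shape_regular_def by blast
  have bounded: "bounded (closure \<Omega>)"
  proof -
    note m = is_mesh_elements[OF assms(13)]
    have "compact (closure \<Omega>)"
      unfolding m(5)[symmetric] using m(1,2) full_simplex_basics(2) by (intro compact_Union) auto
    then show ?thesis by (rule compact_imp_bounded)
  qed
  \<comment> \<open>A bound for the diameters of all sides; the shift makes it positive.\<close>
  define M where "M = diameter (closure \<Omega>) + 1"
  have M: "M > 0" using diameter_ge_0[OF bounded] by (simp add: M_def)
  obtain C where C: "C > 0" "\<And>(T :: (real^'n) set) K E n. full_simplex T \<Longrightarrow> full_simplex K \<Longrightarrow>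
      E facet_of T \<Longrightarrow> E facet_of K \<Longrightarrow> normal_to n E \<Longrightarrow> diameter E \<le> M \<Longrightarrow>
      diameter T \<le> c * inradius T \<Longrightarrow> diameter K \<le> c * inradius K \<Longrightarrow>
      sqrt (measure lebesgue T) * measure surface_measure E \<le> C * measure lebesgue K"
    using shape_regular_scaling[OF c(1) M dim] by blast
  show ?thesis
  proof (intro exI[of _ "sqrt (4 * C * real (CARD('n) + 1))"] conjI ballI allI impI)
    show "0 < sqrt (4 * C * real (CARD('n) + 1))" using C(1) by simp
    fix \<T> \<T>' :: "'n mesh" and S and z z' :: "'n state"
    assume T: "\<T> \<in> NVB_meshes \<Omega> \<T>0" and T': "\<T>' \<in> NVB_meshes \<Omega> \<T>"
      and S: "S \<subseteq> elements \<T> \<inter> elements \<T>'"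
      and z: "z \<in> X_discrete \<Omega> \<Gamma>D \<T>" and z': "z' \<in> X_discrete \<Omega> \<Gamma>D \<T>'"
    have T'0: "\<T>' \<in> NVB_meshes \<Omega> \<T>0" by (rule NVB_meshes_trans[OF T' T])
    have mesh: "is_mesh \<Omega> \<T>" "is_mesh \<Omega> \<T>'"
      using T T'0 assms(13) by (auto intro: NVB_meshes_is_mesh)
    note m' = is_mesh_elements[OF mesh(2)]
    have normals: "normal_to (\<nu> E) E" if "K \<in> elements \<T>'" "E \<in> sides K" for K E
      using assms(15) T'0 that unfolding unit_normals_def normal_to_def by blast
    obtain v q \<beta> where zv: "z = (v, q, \<beta>)" by (cases z)
    obtain v' q' \<beta>' where zv': "z' = (v', q', \<beta>')" by (cases z')
    have "linear \<C>" using assms(12) by (simp add: elasticity_tensor_def)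
    then interpret refined_mesh \<Omega> \<Gamma>D g \<C> \<nu> \<T> \<T>' v v' q q' \<beta> \<beta>'
      by (rule refined_mesh.intro[OF dim assms(2,5,6,11) _ mesh NVB_meshes_element_subset[OF T' mesh(1)]
            normals z[unfolded zv] z'[unfolded zv']])
    show "\<bar>sqrt (\<Sum>T\<in>S. eta_sq \<Omega> \<Gamma>D f g \<C> \<nu> \<T>' z' T) - sqrt (\<Sum>T\<in>S. eta_sq \<Omega> \<Gamma>D f g \<C> \<nu> \<T> z T)\<bar>
        \<le> sqrt (4 * C * real (CARD('n) + 1)) * err_measure \<C> \<Omega> z' z"
      unfolding zv zv'
    proof (rule estimator_diff[OF S])
      show "0 \<le> C" using C(1) by simp
      fix T K E assume T: "T \<in> elements \<T>'" "K \<in> elements \<T>'" and E: "E \<in> sides T" "E \<in> sides K"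
      have facets: "E facet_of T" "E facet_of K" using E by (auto simp: sides_def)
      have "E \<subseteq> closure \<Omega>"
        using facet_aff_dim(5)[OF m'(2)[OF T(1)] facets(1)] m'(6)[OF T(1)] by blast
      then have "diameter E \<le> M"
        using diameter_subset[OF _ bounded, of E] by (simp add: M_def)
      then show "sqrt (measure lebesgue T) * measure surface_measure E \<le> C * measure lebesgue K"
        by (intro C(2)[OF m'(2)[OF T(1)] m'(2)[OF T(2)] facets normals[OF T(1) E(1)] _
            c(2)[OF T'0 T(1)] c(2)[OF T'0 T(2)]])
    qed
  qed
qed

end
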